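(* Let $M,N\ge 1$ and consider the real compound $M\times N$ $X$ network ($M$ transmitters, $N$ receivers) with a finite number $J_j\ge 1$ of possible states at receiver $j$, $j=1,\dots,N$. Then, almost surely (with respect to the draw of the channel states), the total number of degrees of freedom is $d=\frac{MN}{M+N-1}$.
   Context: Real compound $M\times N$ $X$ network. There are $M$ single-antenna transmitters and $N$ single-antenna receivers. Every transmitter $i$ has an independent message $W^{[ji]}$ of rate $R^{[ji]}$ for every receiver $j$, for a total of $MN$ messages; each transmitter encodes only its own messages. For each receiver $j$ there is a finite set of $J_j$ possible channel vectors (states) $(h^{[j1]}_{k_j},\dots,h^{[jM]}_{k_j})\in\mathbb{R}^M$, $k_j=1,\dots,J_j$. If receiver $j$ is in state $k_j$, its received signal (at each time) is $$y^{[j]}_{k_j}=\sum_{i=1}^{M}h^{[ji]}_{k_j}x^{[i]}+z^{[j]}_{k_j},$$ where $x^{[i]}\in\mathbb{R}$ is the signal of transmitter $i$, subject to the average power constraint $E((x^{[i]})^2)\le P$ (averaged over the codeword), and $z^{[j]}_{k_j}$ is white real Gaussian noise with zero mean and unit variance. The states are fixed throughout the duration of communication. The sets of possible states are known to all nodes and do not depend on $P$; the transmitters do not know which states are realized, while the receivers have perfect channel knowledge. Almost surely. All the coefficients of all possible states are drawn from a continuous distribution (absolutely continuous with respect to Lebesgue measure), so that almost surely they are algebraically independent over the rationals; "almost surely" refers to this draw. Achievable rates. A rate tuple $(R^{[ji]})_{j,i}$ is achievable at power $P$ if there are codes (encoders not depending on the realized states) of growing block length such that every receiver $j$ decodes all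 its messages $W^{[j1]},\dots,W^{[jM]}$ with arbitrarily small error probability, regardless of the channel realization. Degrees of freedom. The total number of degrees of freedom is $$d=\lim_{P\to\infty}\frac{C_\Sigma(P)}{\frac12\log P},$$ where $C_\Sigma(P)$ is the supremum of $\sum_{j=1}^N\sum_{i=1}^M R^{[ji]}$ over all rate tuples achievable at power $P$. *)

theory Defs
  imports "HOL-Probability.Probability"
begin

text \<open>
  Conventions: transmitters are indexed by \<open>i < M\<close>, receivers by \<open>j < N\<close>, and the states of
  receiver \<open>j\<close> by \<open>k < J j\<close>.  A family \<open>h\<close> of channel coefficients is a function with
  \<open>h (j, i, k)\<close> the gain from transmitter \<open>i\<close> to receiver \<open>j\<close> when receiver \<open>j\<close> is in state \<open>k\<close>.
  A message family is \<open>w\<close>, where \<open>w j i\<close> goes from transmitter \<open>i\<close> to receiver \<open>j\<close>.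
  Rates are in bits per channel use.
\<close>

definition coeff_index :: "nat \<Rightarrow> nat \<Rightarrow> (nat \<Rightarrow> nat) \<Rightarrow> (nat \<times> nat \<times> nat) set" where
  "coeff_index M N J = {(j, i, k). j < N \<and> i < M \<and> k < J j}"

definition coeff_lebesgue ::
    "nat \<Rightarrow> nat \<Rightarrow> (nat \<Rightarrow> nat) \<Rightarrow> (nat \<times> nat \<times> nat \<Rightarrow> real) measure" where
  "coeff_lebesgue M N J = Pi\<^sub>M (coeff_index M N J) (\<lambda>_. lborel)"

definition realizations :: "nat \<Rightarrow> (nat \<Rightarrow> nat) \<Rightarrow> (nat \<Rightarrow> nat) set" where
  "realizations N J = (\<Pi>\<^sub>E j\<in>{..<N}. {..<J j})"

definition gaussian_noise :: "nat \<Rightarrow> (nat \<Rightarrow> real) measure" where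
  "gaussian_noise n =
     Pi\<^sub>M {..<n} (\<lambda>_. density lborel (\<lambda>x. ennreal (std_normal_density x)))"

text \<open>
  At block length \<open>n\<close>, a message of rate \<open>r\<close> takes \<open>\<lceil>2 powr (n * r)\<rceil>\<close> values.  The messages
  are independent and uniform, that is, the whole family is uniform on the product set.
\<close>

definition message_families ::
    "nat \<Rightarrow> nat \<Rightarrow> nat \<Rightarrow> (nat \<Rightarrow> nat \<Rightarrow> real) \<Rightarrow> (nat \<Rightarrow> nat \<Rightarrow> nat) set" where
  "message_families M N n R =
     (\<Pi>\<^sub>E j\<in>{..<N}. \<Pi>\<^sub>E i\<in>{..<M}. {..<nat \<lceil>2 powr (real n * R j i)\<rceil>})"

definition message_pmf ::
    "nat \<Rightarrow> nat \<Rightarrow> nat \<Rightarrow> (nat \<Rightarrow> nat \<Rightarrow> real) \<Rightarrow> (nat \<Rightarrow> nat \<Rightarrow> nat) pmf" where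
  "message_pmf M N n R = pmf_of_set (message_families M N n R)"

text \<open>
  The encoder of transmitter \<open>i\<close> sees only its own messages \<open>\<lambda>j. w j i\<close>, and not the channel
  realization.  A decoder sees the realization and the received block, and returns an estimate
  of the message from each transmitter \<open>i\<close>.
\<close>

type_synonym encoders = "nat \<Rightarrow> (nat \<Rightarrow> nat) \<Rightarrow> nat \<Rightarrow> real"
type_synonym decoders = "nat \<Rightarrow> (nat \<Rightarrow> nat) \<Rightarrow> (nat \<Rightarrow> real) \<Rightarrow> nat \<Rightarrow> nat"

definition channel_input ::
    "encoders \<Rightarrow> (nat \<Rightarrow> nat \<Rightarrow> nat) \<Rightarrow> nat \<Rightarrow> nat \<Rightarrow> real" where
  "channel_input enc w i t = enc i (\<lambda>j. w j i) t"

definition channel_output ::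
    "nat \<Rightarrow> (nat \<times> nat \<times> nat \<Rightarrow> real) \<Rightarrow> nat \<Rightarrow> encoders \<Rightarrow> (nat \<Rightarrow> nat \<Rightarrow> nat) \<Rightarrow>
     (nat \<Rightarrow> nat) \<Rightarrow> nat \<Rightarrow> (nat \<Rightarrow> real) \<Rightarrow> nat \<Rightarrow> real" where
  "channel_output M h n enc w \<kappa> j z =
     (\<lambda>t\<in>{..<n}. (\<Sum>i<M. h (j, i, \<kappa> j) * channel_input enc w i t) + z t)"

definition power_constraint ::
    "nat \<Rightarrow> nat \<Rightarrow> nat \<Rightarrow> (nat \<Rightarrow> nat \<Rightarrow> real) \<Rightarrow> real \<Rightarrow> encoders \<Rightarrow> bool" where
  "power_constraint M N n R P enc \<longleftrightarrow>
     (\<forall>i<M. measure_pmf.expectation (message_pmf M N n R)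
              (\<lambda>w. (\<Sum>t<n. (channel_input enc w i t)\<^sup>2) / real n) \<le> P)"

definition measurable_decoders ::
    "nat \<Rightarrow> nat \<Rightarrow> (nat \<Rightarrow> nat) \<Rightarrow> nat \<Rightarrow> decoders \<Rightarrow> bool" where
  "measurable_decoders M N J n dec \<longleftrightarrow>
     (\<forall>\<kappa>\<in>realizations N J. \<forall>j<N. \<forall>i<M.
        (\<lambda>y. dec j \<kappa> y i) \<in> measurable (Pi\<^sub>M {..<n} (\<lambda>_. borel)) (count_space UNIV))"

definition error_prob ::
    "nat \<Rightarrow> nat \<Rightarrow> (nat \<times> nat \<times> nat \<Rightarrow> real) \<Rightarrow> nat \<Rightarrow> (nat \<Rightarrow> nat \<Rightarrow> real) \<Rightarrow>
     encoders \<Rightarrow> decoders \<Rightarrow> (nat \<Rightarrow> nat) \<Rightarrow> nat \<Rightarrow> real" where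
  "error_prob M N h n R enc dec \<kappa> j =
     measure_pmf.expectation (message_pmf M N n R)
       (\<lambda>w. measure (gaussian_noise n)
          {z \<in> space (gaussian_noise n).
             \<exists>i<M. dec j \<kappa> (channel_output M h n enc w \<kappa> j z) i \<noteq> w j i})"

text \<open>
  "Codes of growing block length with arbitrarily small error" is rendered by infinitely many
  block lengths for every error bound; this is the same as a sequence of codes whose block length
  tends to infinity and whose error tends to 0.
\<close>

definition achievable ::
    "nat \<Rightarrow> nat \<Rightarrow> (nat \<Rightarrow> nat) \<Rightarrow> (nat \<times> nat \<times> nat \<Rightarrow> real) \<Rightarrow> real \<Rightarrow>
     (nat \<Rightarrow> nat \<Rightarrow> real) \<Rightarrow> bool" where
  "achievable M N J h P R \<longleftrightarrow>
     (\<forall>j<N. \<forall>i<M. 0 \<le> R j i) \<and>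
     (\<forall>\<epsilon>>0. \<exists>\<^sub>F n in sequentially. \<exists>enc dec.
        power_constraint M N n R P enc \<and>
        measurable_decoders M N J n dec \<and>
        (\<forall>\<kappa>\<in>realizations N J. \<forall>j<N. error_prob M N h n R enc dec \<kappa> j \<le> \<epsilon>))"

text \<open>
  The supremum is taken in the extended reals, so that it is meaningful without a prior
  boundedness proof.
\<close>

definition sum_capacity ::
    "nat \<Rightarrow> nat \<Rightarrow> (nat \<Rightarrow> nat) \<Rightarrow> (nat \<times> nat \<times> nat \<Rightarrow> real) \<Rightarrow> real \<Rightarrow> ereal" where
  "sum_capacity M N J h P =
     (SUP R\<in>{R. achievable M N J h P R}. ereal (\<Sum>j<N. \<Sum>i<M. R j i))"

definition has_dof ::
    "nat \<Rightarrow> nat \<Rightarrow> (nat \<Rightarrow> nat) \<Rightarrow> (nat \<times> nat \<times> nat \<Rightarrow> real) \<Rightarrow> real \<Rightarrow> bool" where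
  "has_dof M N J h d \<longleftrightarrow>
     ((\<lambda>P. sum_capacity M N J h P / ereal (1 / 2 * log 2 P)) \<longlongrightarrow> ereal d) at_top"

end

theory Submission
  imports Defs "HOL-Computational_Algebra.Fundamental_Theorem_Algebra"
begin

text \<open>
  Converse.  Fix a receiver \<open>j\<close> and a transmitter \<open>i\<close> and freeze all messages that neither go to
  \<open>j\<close> nor come from \<open>i\<close>.  Once receiver \<open>j\<close> has decoded its own messages it knows all inputs but
  that of \<open>i\<close>, and a noisy copy of the input of \<open>i\<close> is left.  If its noise is reduced by a constant
  factor, then adding independent noise turns this copy into an observation of any other receiver,
  so that all messages from \<open>i\<close> can be decoded as well.  A change of measure to one Gaussian law
  of variance of order \<open>P\<close> bounds the number of jointly decodable messages at block length \<open>n\<close> by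
  \<open>(const * sqrt P) ^ n\<close>.  Summing over the pairs \<open>(j, i)\<close> counts every message \<open>M + N - 1\<close> times.

  Achievability.  The messages for receiver \<open>j\<close> are modulated onto integers times monomials in the
  coefficients of the other receivers, so that at every other receiver, in every state, they align
  in slightly more directions than one transmitter uses.  The monomials are multiplied by \<open>S\<close>
  auxiliary real weights, which are chosen depending on \<open>P\<close>.  A received difference is a linear form
  in these weights, with integer polynomials in the channel coefficients as coefficients.  By a
  Borel-Cantelli argument a nonzero integer polynomial with coefficients bounded by \<open>Q\<close> has almost
  surely absolute value at least \<open>const * Q powr (- C)\<close>, where \<open>C\<close> does not depend on \<open>S\<close>.  A union
  bound over the differences then provides weights with nearly optimal minimum distance, up to the
  factor \<open>Q ^ C\<close>, whose cost is negligible for large \<open>S\<close>.  Hence no Khintchine-Groshev theorem for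
  manifolds is needed.  A Gilbert-Varshamov outer code removes the remaining decision errors.
\<close>

subsection \<open>Values of integer polynomials at almost every point\<close>

text \<open>The degrees of freedom come out as a ratio of two exponents of \<open>Q\<close>, that of
  the alphabet size and that of the peak amplitude. The exponent \<open>C\<close> alone would be far
  too large for a minimum distance: it outgrows the number of directions as \<open>m\<close> grows.
  The weights separate two tasks. Algebraic independence only has to keep nonzero coefficients from
  being tiny, at the single price \<open>Q ^ C\<close>; the exponent that counts comes from the
  number of vectors of received coefficients, which alignment reduces to order
  \<open>Q ^ (S * num_dirs)\<close>. A message thus uses \<open>Q ^ (S * m ^ G)\<close> symbols at
  peak amplitude of order \<open>Q ^ (C + S * num_dirs + 1)\<close>, where \<open>G\<close> is the
  number of channel coefficients and \<open>num_dirs = M * m ^ G + (N - 1) * (m + 1) ^ G\<close>.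
  The ratio approaches \<open>1 / (M + N - 1)\<close>. The weights may depend on all possible states
  and on \<open>P\<close>, but not on the realized states, so one choice has to serve all receivers
  and states; this costs only a constant factor. In the converse, too, constant factors per channel
  use vanish after division by \<open>log 2 P\<close>, so counting can replace entropy
  inequalities.\<close>

lemma emeasure_poly_sublevel:
  fixes p :: "real poly"
  assumes r: "r \<ge> 0"
  shows "emeasure lborel {x. \<bar>poly p x\<bar> < \<bar>lead_coeff p\<bar> * r ^ degree p}
           \<le> ennreal (2 * real (degree p) * r)"
proof -
  let ?q = "map_poly complex_of_real p"
  have deg: "degree ?q = degree p" by (simp add: degree_map_poly)
  obtain root where root: "smult (lead_coeff ?q) (\<Prod>i<degree ?q. [:-root i, 1:]) = ?q"
    using complex_poly_decompose' by blast
  have eval: "complex_of_real (poly p x) =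
      complex_of_real (lead_coeff p) * (\<Prod>i<degree p. (complex_of_real x - root i))" for x
  proof -
    have "complex_of_real (poly p x) = poly ?q (complex_of_real x)"
      by (induct p) (simp_all add: map_poly_pCons)
    also have "\<dots> = poly (smult (lead_coeff ?q) (\<Prod>i<degree ?q. [:-root i, 1:])) (complex_of_real x)"
      using root by simp
    also have "\<dots> = lead_coeff ?q * (\<Prod>i<degree p. (complex_of_real x - root i))"
      by (simp add: poly_prod deg)
    finally show ?thesis by (simp add: deg coeff_map_poly)
  qed
  \<comment> \<open>Factor over the complex numbers: if the real part of every root is farther than
    \<open>r\<close> from \<open>x\<close>, every factor has modulus at least \<open>r\<close>.
    Hence a small value forces \<open>x\<close> into one of \<open>degree p\<close> intervals of
    length \<open>2 * r\<close>.\<close>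
  have sub: "{x. \<bar>poly p x\<bar> < \<bar>lead_coeff p\<bar> * r ^ degree p}
      \<subseteq> (\<Union>i<degree p. {Re (root i) - r..Re (root i) + r})"
  proof (rule ccontr)
    assume "\<not> ?thesis"
    then obtain x where x: "\<bar>poly p x\<bar> < \<bar>lead_coeff p\<bar> * r ^ degree p"
      and "x \<notin> (\<Union>i<degree p. {Re (root i) - r..Re (root i) + r})" by blast
    then have far: "\<And>i. i < degree p \<Longrightarrow> \<not> (Re (root i) - r \<le> x \<and> x \<le> Re (root i) + r)" by auto
    have ge: "r \<le> norm (complex_of_real x - root i)" if "i < degree p" for i
    proof -
      have "r \<le> \<bar>Re (complex_of_real x - root i)\<bar>" using far[OF that] by (auto simp: abs_if)
      then show ?thesis using abs_Re_le_cmod order_trans by blast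
    qed
    have "r ^ degree p = (\<Prod>i<degree p. r)" by simp
    also have "\<dots> \<le> (\<Prod>i<degree p. norm (complex_of_real x - root i))"
      using ge r by (intro prod_mono) auto
    finally have "\<bar>lead_coeff p\<bar> * r ^ degree p \<le> \<bar>lead_coeff p\<bar> * (\<Prod>i<degree p. norm (complex_of_real x - root i))"
      by (intro mult_left_mono) auto
    also have "\<dots> = norm (complex_of_real (poly p x))"
      unfolding eval by (simp add: norm_mult prod_norm)
    finally show False using x by simp
  qed
  have "emeasure lborel {x. \<bar>poly p x\<bar> < \<bar>lead_coeff p\<bar> * r ^ degree p}
      \<le> emeasure lborel (\<Union>i<degree p. {Re (root i) - r..Re (root i) + r})"
    by (intro emeasure_mono sub) auto
  also have "\<dots> \<le> (\<Sum>i<degree p. emeasure lborel {Re (root i) - r..Re (root i) + r})"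
    by (intro emeasure_subadditive_finite) auto
  also have "\<dots> = (\<Sum>i<degree p. ennreal (2 * r))" using r by simp
  also have "\<dots> = ennreal (2 * real (degree p) * r)"
    using r by (subst sum_ennreal) (auto simp: algebra_simps)
  finally show ?thesis .
qed

text \<open>Tonelli: a measurable set almost all of whose sections are null is null. It lets the
  coefficients be drawn one after another.\<close>

lemma (in product_sigma_finite) AE_PiM_insertI:
  assumes I: "finite I" "i \<notin> I"
    and P: "{x \<in> space (Pi\<^sub>M (insert i I) M). P x} \<in> sets (Pi\<^sub>M (insert i I) M)"
    and ae: "AE x in Pi\<^sub>M I M. AE y in M i. P (x(i := y))"
  shows "AE x in Pi\<^sub>M (insert i I) M. P x"
proof -
  let ?N = "{x \<in> space (Pi\<^sub>M (insert i I) M). \<not> P x}"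
  have N: "?N \<in> sets (Pi\<^sub>M (insert i I) M)"
    using sets.compl_sets[OF P] by (rule back_subst[where P = "\<lambda>A. A \<in> _"]) auto
  have "emeasure (Pi\<^sub>M (insert i I) M) ?N = (\<integral>\<^sup>+ x. indicator ?N x \<partial>Pi\<^sub>M (insert i I) M)"
    using N by simp
  also have "\<dots> = (\<integral>\<^sup>+ x. \<integral>\<^sup>+ y. indicator ?N (x(i := y)) \<partial>M i \<partial>Pi\<^sub>M I M)"
    using I N by (intro product_nn_integral_insert) auto
  also have "\<dots> = (\<integral>\<^sup>+ x. 0 \<partial>Pi\<^sub>M I M)"
  proof (rule nn_integral_cong_AE)
    show "AE x in Pi\<^sub>M I M. (\<integral>\<^sup>+ y. indicator ?N (x(i := y)) \<partial>M i) = 0"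
      using ae
    proof eventually_elim
      case (elim x)
      then have "(\<integral>\<^sup>+ y. indicator ?N (x(i := y)) \<partial>M i) = (\<integral>\<^sup>+ y. 0 \<partial>M i)"
        by (intro nn_integral_cong_AE) (auto elim: eventually_mono)
      then show ?case by simp
    qed
  qed
  finally have "?N \<in> null_sets (Pi\<^sub>M (insert i I) M)" using N by auto
  then show ?thesis by (rule AE_I') auto
qed

text \<open>The degree is bounded in each variable separately, so that splitting off a variable
  leaves a univariate polynomial of degree at most \<open>D\<close> whose coefficients are
  polynomials of the same kind.\<close>

definition exponents :: "'a set \<Rightarrow> nat \<Rightarrow> ('a \<Rightarrow> nat) set" where
  "exponents I D = I \<rightarrow>\<^sub>E {..D}"

definition int_poly :: "'a set \<Rightarrow> nat \<Rightarrow> (('a \<Rightarrow> nat) \<Rightarrow> int) \<Rightarrow> ('a \<Rightarrow> real) \<Rightarrow> real" where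
  "int_poly I D b h = (\<Sum>e\<in>exponents I D. of_int (b e) * (\<Prod>\<alpha>\<in>I. h \<alpha> ^ e \<alpha>))"

definition int_coeffs :: "'a set \<Rightarrow> nat \<Rightarrow> nat \<Rightarrow> (('a \<Rightarrow> nat) \<Rightarrow> int) set" where
  "int_coeffs I D Q = {b \<in> exponents I D \<rightarrow>\<^sub>E {- int Q..int Q}. \<exists>e\<in>exponents I D. b e \<noteq> 0}"

lemma finite_exponents: "finite I \<Longrightarrow> finite (exponents I D)"
  unfolding exponents_def by (intro finite_PiE) auto

lemma finite_int_coeffs: "finite I \<Longrightarrow> finite (int_coeffs I D Q)"
  unfolding int_coeffs_def using finite_exponents[of I D] by (auto intro!: finite_PiE)

lemma card_int_coeffs_le:
  assumes "finite I"
  shows "card (int_coeffs I D Q) \<le> (2 * Q + 1) ^ card (exponents I D)"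
proof -
  have "card (int_coeffs I D Q) \<le> card (exponents I D \<rightarrow>\<^sub>E {- int Q..int Q})"
    using assms finite_exponents[of I D]
    by (intro card_mono) (auto simp: int_coeffs_def intro!: finite_PiE)
  also have "\<dots> = (2 * Q + 1) ^ card (exponents I D)"
    using assms finite_exponents[of I D]
    by (simp add: card_PiE nat_add_distrib nat_mult_distrib power_mult_distrib flip: mult_2)
  finally show ?thesis .
qed

lemma int_poly_insert:
  assumes I: "finite I" "\<alpha> \<notin> I"
  shows "int_poly (insert \<alpha> I) D b (h(\<alpha> := x)) =
    (\<Sum>d\<le>D. int_poly I D (\<lambda>g\<in>exponents I D. b (g(\<alpha> := d))) h * x ^ d)"
proof -
  have ex: "exponents (insert \<alpha> I) D = (\<lambda>(d, g). g(\<alpha> := d)) ` ({..D} \<times> exponents I D)"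
    unfolding exponents_def by (subst PiE_insert_eq) auto
  have inj: "inj_on (\<lambda>(d, g). g(\<alpha> := d)) ({..D} \<times> exponents I D)"
    unfolding exponents_def using inj_combinator[OF I(2), of "\<lambda>_. {..D}"] by simp
  have "int_poly (insert \<alpha> I) D b (h(\<alpha> := x)) =
    (\<Sum>(d, g)\<in>{..D} \<times> exponents I D. of_int (b (g(\<alpha> := d))) *
        (\<Prod>\<beta>\<in>insert \<alpha> I. (h(\<alpha> := x)) \<beta> ^ (g(\<alpha> := d)) \<beta>))"
    unfolding int_poly_def ex by (subst sum.reindex[OF inj]) (simp add: case_prod_beta)
  also have "\<dots> = (\<Sum>(d, g)\<in>{..D} \<times> exponents I D.
        of_int (b (g(\<alpha> := d))) * (\<Prod>\<beta>\<in>I. h \<beta> ^ g \<beta>) * x ^ d)"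
  proof -
    have "(\<Prod>\<beta>\<in>insert \<alpha> I. (h(\<alpha> := x)) \<beta> ^ (g(\<alpha> := d)) \<beta>) = (\<Prod>\<beta>\<in>I. h \<beta> ^ g \<beta>) * x ^ d" for d g
    proof -
      have "(\<Prod>\<beta>\<in>I. (h(\<alpha> := x)) \<beta> ^ (g(\<alpha> := d)) \<beta>) = (\<Prod>\<beta>\<in>I. h \<beta> ^ g \<beta>)"
        using I by (intro prod.cong) auto
      then show ?thesis using I by simp
    qed
    then show ?thesis by (simp only: mult.assoc case_prod_conv)
  qed
  also have "\<dots> = (\<Sum>d\<le>D. int_poly I D (\<lambda>g\<in>exponents I D. b (g(\<alpha> := d))) h * x ^ d)"
    unfolding int_poly_def by (simp add: sum.cartesian_product[symmetric] sum_distrib_right)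
  finally show ?thesis .
qed

lemma int_poly_measurable:
  "finite I \<Longrightarrow> int_poly I D b \<in> borel_measurable (Pi\<^sub>M I (\<lambda>_. lborel))"
  unfolding int_poly_def by measurable

text \<open>The constant is \<open>1 / Suc n\<close> with a natural number \<open>n\<close>, so that
  its existence is a countable union and stays measurable. It may depend on the point
  \<open>h\<close>, whereas one exponent \<open>C\<close> has to do for almost all
  \<open>h\<close>.\<close>

definition dioph_bound :: "'a set \<Rightarrow> nat \<Rightarrow> nat \<Rightarrow> nat \<Rightarrow> ('a \<Rightarrow> real) \<Rightarrow> bool" where
  "dioph_bound I D C n h \<longleftrightarrow>
     (\<forall>Q. \<forall>b\<in>int_coeffs I D (Suc Q). 1 / (real (Suc n) * real (Suc Q) ^ C) \<le> \<bar>int_poly I D b h\<bar>)"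

text \<open>With the old coefficients frozen, the polynomial is univariate in the new one, and its
  leading coefficient is the value of a nonzero integer polynomial in the old ones, to which
  \<open>lb\<close> applies. The set of bad \<open>x\<close> for height \<open>Suc Q\<close> then
  has measure of order \<open>1 / Suc Q ^ 2\<close>, which is summable.\<close>

lemma AE_dioph_bound_step:
  assumes I: "finite I" "\<alpha> \<notin> I" and lb: "dioph_bound I D C n h"
  defines "m \<equiv> card (exponents (insert \<alpha> I) D)"
  shows "AE x in lborel. \<exists>n'. dioph_bound (insert \<alpha> I) D (C + (m + 2) * D) n' (h(\<alpha> := x))"
proof -
  let ?I = "insert \<alpha> I"
  define a where "a b d = int_poly I D (\<lambda>g\<in>exponents I D. b (g(\<alpha> := d))) h" for b d
  define p where "p b = (\<Sum>d\<le>D. monom (a b d) d)" for b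
  have poly_p: "poly (p b) x = int_poly ?I D b (h(\<alpha> := x))" for b x
    unfolding p_def a_def int_poly_insert[OF I] by (simp add: poly_sum poly_monom)
  have coeff_p: "coeff (p b) d = (if d \<le> D then a b d else 0)" for b d
    unfolding p_def by (simp add: coeff_sum)
  have deg_p: "degree (p b) \<le> D" for b
    by (rule degree_le) (simp add: coeff_p)
  \<comment> \<open>\<open>Suc Q ^ m\<close> pays for the number of polynomials of height
    \<open>Suc Q\<close>, and the two further powers make the measures summable. Values can shrink
    by \<open>r Q ^ D\<close>, which is the source of \<open>(m + 2) * D\<close> in the
    exponent.\<close>
  define r where "r Q = 1 / real (Suc Q) ^ (m + 2)" for Q
  have r0: "0 < r Q" for Q by (simp add: r_def)
  have r1: "r Q \<le> 1" for Q
  proof -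
    have "1 \<le> real (Suc Q) ^ (m + 2)" by (rule one_le_power) simp
    then show ?thesis unfolding r_def by (subst divide_le_eq_1_pos) linarith+
  qed
  have coeff_big: "1 / (real (Suc n) * real (Suc Q) ^ C) \<le> \<bar>a b d\<bar>"
    if "b \<in> int_coeffs ?I D (Suc Q)" "d \<le> D" "a b d \<noteq> 0" for Q b d
  proof -
    let ?b = "\<lambda>g\<in>exponents I D. b (g(\<alpha> := d))"
    have "\<exists>g\<in>exponents I D. ?b g \<noteq> 0"
    proof (rule ccontr)
      assume "\<not> ?thesis"
      then have "a b d = 0" unfolding a_def int_poly_def by (intro sum.neutral) auto
      then show False using that by simp
    qed
    moreover have "g(\<alpha> := d) \<in> exponents ?I D" if "g \<in> exponents I D" for g
      using that \<open>d \<le> D\<close> by (auto simp: exponents_def PiE_iff extensional_def)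
    ultimately have "?b \<in> int_coeffs I D (Suc Q)"
      using that(1) unfolding int_coeffs_def by (auto simp: PiE_iff)
    then show ?thesis using lb unfolding dioph_bound_def a_def by blast
  qed
  have p_nz: "p b \<noteq> 0" if b: "b \<in> int_coeffs ?I D (Suc Q)" for b Q
  proof -
    obtain e where e: "e \<in> exponents ?I D" "b e \<noteq> 0" using b by (auto simp: int_coeffs_def)
    define d where "d = e \<alpha>"
    have d: "d \<le> D" using e by (auto simp: exponents_def d_def)
    \<comment> \<open>Exponent vectors are extensional, so removing the new variable means resetting
      it to \<open>undefined\<close>.\<close>
    define g where "g = e(\<alpha> := undefined)"
    have g: "g \<in> exponents I D" "g(\<alpha> := d) = e"
      using e I by (auto simp: exponents_def PiE_iff extensional_def g_def d_def)
    let ?b = "\<lambda>g\<in>exponents I D. b (g(\<alpha> := d))"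
    have "g(\<alpha> := d) \<in> exponents ?I D" if "g \<in> exponents I D" for g
      using that d by (auto simp: exponents_def PiE_iff extensional_def)
    then have "?b \<in> int_coeffs I D (Suc Q)"
      using b g e unfolding int_coeffs_def by (auto simp: PiE_iff)
    then have "1 / (real (Suc n) * real (Suc Q) ^ C) \<le> \<bar>a b d\<bar>"
      using lb unfolding dioph_bound_def a_def by blast
    moreover have "0 < 1 / (real (Suc n) * real (Suc Q) ^ C)" by simp
    ultimately have "a b d \<noteq> 0" by linarith
    then have "coeff (p b) d \<noteq> 0" using d by (simp add: coeff_p)
    then show ?thesis by auto
  qed
  define Bd where "Bd Q b = {x. \<bar>poly (p b) x\<bar> < \<bar>lead_coeff (p b)\<bar> * r Q ^ degree (p b)}" for Q b
  define A where "A Q = (\<Union>b\<in>int_coeffs ?I D (Suc Q). Bd Q b)" for Q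
  have [measurable]: "poly (p b) \<in> borel_measurable borel" for b
    by (intro borel_measurable_continuous_onI continuous_intros)
  have Bd_meas [measurable]: "Bd Q b \<in> sets lborel" for Q b unfolding Bd_def by simp
  have A_meas [measurable]: "A Q \<in> sets lborel" for Q
    unfolding A_def using I Bd_meas by (intro sets.finite_UN finite_int_coeffs) (auto simp del: sets_lborel)
  have A_le: "emeasure lborel (A Q) \<le> ennreal (3 ^ m * 2 * real D * (1 / real (Suc Q) ^ 2))" for Q
  proof -
    have "emeasure lborel (A Q) \<le> (\<Sum>b\<in>int_coeffs ?I D (Suc Q). emeasure lborel (Bd Q b))"
      unfolding A_def using I Bd_meas
      by (intro emeasure_subadditive_finite finite_int_coeffs) (auto simp del: sets_lborel)
    also have "\<dots> \<le> (\<Sum>b\<in>int_coeffs ?I D (Suc Q). ennreal (2 * real D * r Q))"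
    proof (rule sum_mono)
      fix b assume "b \<in> int_coeffs ?I D (Suc Q)"
      have "emeasure lborel (Bd Q b) \<le> ennreal (2 * real (degree (p b)) * r Q)"
        unfolding Bd_def by (rule emeasure_poly_sublevel) (use r0[of Q] in simp)
      also have "\<dots> \<le> ennreal (2 * real D * r Q)"
        using deg_p[of b] r0[of Q] by (intro ennreal_leI mult_right_mono) auto
      finally show "emeasure lborel (Bd Q b) \<le> ennreal (2 * real D * r Q)" .
    qed
    also have "\<dots> = ennreal (real (card (int_coeffs ?I D (Suc Q))) * (2 * real D * r Q))"
      using r0[of Q] by (simp add: ennreal_mult ennreal_of_nat_eq_real_of_nat)
    also have "\<dots> \<le> ennreal (3 ^ m * 2 * real D * (1 / real (Suc Q) ^ 2))"
    proof (rule ennreal_leI)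
      have "real (card (int_coeffs ?I D (Suc Q))) \<le> real ((2 * Suc Q + 1) ^ m)"
        unfolding m_def of_nat_le_iff using I by (intro card_int_coeffs_le) auto
      also have "\<dots> \<le> real ((3 * Suc Q) ^ m)"
        unfolding of_nat_le_iff by (intro power_mono) auto
      also have "\<dots> = 3 ^ m * real (Suc Q) ^ m"
        by (simp only: of_nat_power of_nat_mult power_mult_distrib of_nat_numeral)
      finally have "real (card (int_coeffs ?I D (Suc Q))) * (2 * real D * r Q) \<le>
          3 ^ m * real (Suc Q) ^ m * (2 * real D * r Q)"
        using r0[of Q] by (intro mult_right_mono) auto
      also have "\<dots> = 3 ^ m * 2 * real D * (1 / real (Suc Q) ^ 2)"
      proof -
        define q where "q = real (Suc Q)"
        have "q \<noteq> 0" by (simp add: q_def)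
        then show ?thesis unfolding r_def q_def[symmetric] by (simp add: power_add power2_eq_square mult.assoc)
      qed
      finally show "real (card (int_coeffs ?I D (Suc Q))) * (2 * real D * r Q)
          \<le> 3 ^ m * 2 * real D * (1 / real (Suc Q) ^ 2)" .
    qed
    finally show ?thesis .
  qed
  have "AE x in lborel. eventually (\<lambda>Q. x \<in> space lborel - A Q) sequentially"
  proof (rule borel_cantelli_AE1)
    show fin: "emeasure lborel (A Q) < \<infinity>" for Q
      using A_le[of Q] by (rule le_less_trans) simp
    have sm: "summable (\<lambda>Q. 3 ^ m * 2 * real D * (1 / real (Suc Q) ^ 2))"
    proof (rule summable_mult)
      have "summable (\<lambda>Q. inverse (real Q ^ 2))" by (rule inverse_power_summable) simp
      then have "summable (\<lambda>Q. inverse (real (Suc Q) ^ 2))" by (subst summable_Suc_iff)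
      then show "summable (\<lambda>Q. 1 / real (Suc Q) ^ 2)" by (simp only: inverse_eq_divide)
    qed
    have "measure lborel (A Q) \<le> 3 ^ m * 2 * real D * (1 / real (Suc Q) ^ 2)" for Q
      unfolding measure_def using A_le[of Q] by (intro enn2real_leI) auto
    then show "summable (\<lambda>Q. measure lborel (A Q))"
      by (intro summable_comparison_test'[OF sm]) auto
  qed (rule A_meas)
  then show ?thesis
  proof eventually_elim
    case (elim x)
    let ?C = "C + (m + 2) * D"
    obtain Q0 where Q0: "\<And>Q. Q \<ge> Q0 \<Longrightarrow> x \<notin> A Q"
      using elim by (auto simp: eventually_sequentially)
    have big: "1 / (real (Suc n) * real (Suc Q) ^ ?C) \<le> \<bar>int_poly ?I D b (h(\<alpha> := x))\<bar>"
      if "Q \<ge> Q0" and b: "b \<in> int_coeffs ?I D (Suc Q)" for Q b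
    proof -
      have "x \<notin> Bd Q b" using Q0[OF that(1)] b by (auto simp: A_def)
      then have "\<bar>lead_coeff (p b)\<bar> * r Q ^ degree (p b) \<le> \<bar>int_poly ?I D b (h(\<alpha> := x))\<bar>"
        by (simp add: Bd_def poly_p not_less)
      moreover have "1 / (real (Suc n) * real (Suc Q) ^ C) * r Q ^ D \<le>
          \<bar>lead_coeff (p b)\<bar> * r Q ^ degree (p b)"
      proof (rule mult_mono)
        have "lead_coeff (p b) \<noteq> 0" using p_nz[OF b] by simp
        then show "1 / (real (Suc n) * real (Suc Q) ^ C) \<le> \<bar>lead_coeff (p b)\<bar>"
          using coeff_big[OF b, of "degree (p b)"] deg_p[of b] by (simp add: coeff_p)
        show "r Q ^ D \<le> r Q ^ degree (p b)"
          using deg_p[of b] r0[of Q] r1[of Q] by (intro power_decreasing) auto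
      qed (use r0[of Q] in auto)
      moreover have "1 / (real (Suc n) * real (Suc Q) ^ C) * r Q ^ D = 1 / (real (Suc n) * real (Suc Q) ^ ?C)"
        unfolding r_def
        by (simp only: power_add[of _ C] power_mult power_divide power_one times_divide_times_eq mult_1 mult.assoc)
      ultimately show ?thesis by linarith
    qed
    \<comment> \<open>Only heights from \<open>Q0\<close> on are controlled. A smaller height is
      raised to \<open>Q' = max Q Q0\<close>, and \<open>Suc Q' \<le> Suc Q0 * Suc Q\<close> lets
      \<open>n'\<close> absorb the loss.\<close>
    obtain n' where n': "real (Suc n) * real (Suc Q0) ^ ?C \<le> real n'"
      using real_arch_simple by blast
    have "dioph_bound ?I D ?C n' (h(\<alpha> := x))"
      unfolding dioph_bound_def
    proof (intro allI ballI)
      fix Q b assume b: "b \<in> int_coeffs ?I D (Suc Q)"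
      define Q' where "Q' = max Q Q0"
      have "b \<in> int_coeffs ?I D (Suc Q')"
        using b by (auto simp: int_coeffs_def PiE_iff Q'_def le_max_iff_disj min_le_iff_disj)
      then have "1 / (real (Suc n) * real (Suc Q') ^ ?C) \<le> \<bar>int_poly ?I D b (h(\<alpha> := x))\<bar>"
        by (intro big) (auto simp: Q'_def)
      moreover have "1 / (real (Suc n') * real (Suc Q) ^ ?C) \<le> 1 / (real (Suc n) * real (Suc Q') ^ ?C)"
      proof (rule divide_left_mono)
        have "Suc Q' \<le> Suc Q0 * Suc Q" by (auto simp: Q'_def max_def)
        then have "real (Suc Q') ^ ?C \<le> (real (Suc Q0) * real (Suc Q)) ^ ?C"
          unfolding of_nat_mult[symmetric] by (intro power_mono) (simp_all only: of_nat_le_iff)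
        then have "real (Suc n) * real (Suc Q') ^ ?C \<le> real (Suc n) * real (Suc Q0) ^ ?C * real (Suc Q) ^ ?C"
          by (simp add: power_mult_distrib mult.assoc del: of_nat_Suc)
        also have "\<dots> \<le> real (Suc n') * real (Suc Q) ^ ?C"
          using n' by (intro mult_right_mono) auto
        finally show "real (Suc n) * real (Suc Q') ^ ?C \<le> real (Suc n') * real (Suc Q) ^ ?C" .
      qed (auto simp del: of_nat_Suc)
      ultimately show "1 / (real (Suc n') * real (Suc Q) ^ ?C) \<le> \<bar>int_poly ?I D b (h(\<alpha> := x))\<bar>"
        by linarith
    qed
    then show ?case by blast
  qed
qed

lemma AE_dioph_bound:
  assumes "finite I"
  shows "\<exists>C. AE h in Pi\<^sub>M I (\<lambda>_. lborel). \<exists>n. dioph_bound I D C n h"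
  using assms
proof (induction I rule: finite_induct)
  case empty
  \<comment> \<open>Without variables the polynomial is a nonzero integer.\<close>
  have "dioph_bound {} D 0 0 h" for h :: "'a \<Rightarrow> real"
    unfolding dioph_bound_def int_coeffs_def int_poly_def exponents_def by auto
  then show ?case by auto
next
  case (insert \<alpha> I)
  interpret product_sigma_finite "\<lambda>_::'a. lborel :: real measure" ..
  obtain C where C: "AE h in Pi\<^sub>M I (\<lambda>_. lborel). \<exists>n. dioph_bound I D C n h"
    using insert.IH by blast
  define C' where "C' = C + (card (exponents (insert \<alpha> I) D) + 2) * D"
  have "AE h in Pi\<^sub>M (insert \<alpha> I) (\<lambda>_. lborel). \<exists>n. dioph_bound (insert \<alpha> I) D C' n h"
  proof (rule AE_PiM_insertI)
    show "{h \<in> space (Pi\<^sub>M (insert \<alpha> I) (\<lambda>_. lborel)). \<exists>n. dioph_bound (insert \<alpha> I) D C' n h}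
        \<in> sets (Pi\<^sub>M (insert \<alpha> I) (\<lambda>_. lborel))"
      unfolding dioph_bound_def
      using int_poly_measurable[of "insert \<alpha> I" D] insert.hyps
      by (intro sets.sets_Collect_countable_Ex sets.sets_Collect_countable_All
          sets.sets_Collect_finite_All finite_int_coeffs) auto
    show "AE h in Pi\<^sub>M I (\<lambda>_. lborel). AE x in lborel. \<exists>n. dioph_bound (insert \<alpha> I) D C' n (h(\<alpha> := x))"
      using C
    proof eventually_elim
      case (elim h)
      then obtain n where "dioph_bound I D C n h" ..
      then show ?case unfolding C'_def by (rule AE_dioph_bound_step[OF insert.hyps(1,2)])
    qed
  qed (use insert.hyps in auto)
  then show ?case by blast
qed

subsection \<open>Separating weights, outer codes and Gaussian tails\<close>

text \<open>The weights are fixed one coordinate at a time. A vector \<open>c\<close> with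
  \<open>c a \<noteq> 0\<close> excludes for the weight of \<open>a\<close> an interval of length
  \<open>2 * \<eta> / \<rho>\<close> at most, whatever the earlier weights are; a vector with
  \<open>c a = 0\<close> keeps the separation it already has. Each step has to avoid at most
  \<open>card C\<close> intervals, so the smallness condition does not involve the number of
  coordinates.\<close>

lemma separating_weights:
  fixes C :: "('a \<Rightarrow> real) set"
  assumes K: "finite K" and C: "finite C" and \<rho>: "\<rho> > 0" and \<eta>: "\<eta> \<ge> 0"
    and big: "\<And>c s. c \<in> C \<Longrightarrow> s \<in> K \<Longrightarrow> c s \<noteq> 0 \<Longrightarrow> \<rho> \<le> \<bar>c s\<bar>"
    and small: "real (card C) * (2 * \<eta> / \<rho>) < 1"
  shows "\<exists>\<theta>. (\<forall>s\<in>K. 0 \<le> \<theta> s \<and> \<theta> s \<le> 1) \<and>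
           (\<forall>c\<in>C. (\<exists>s\<in>K. c s \<noteq> 0) \<longrightarrow> \<eta> \<le> \<bar>\<Sum>s\<in>K. \<theta> s * c s\<bar>)"
  using K big
proof (induction K rule: finite_induct)
  case empty
  then show ?case by simp
next
  case (insert a K)
  obtain \<theta> where \<theta>: "\<forall>s\<in>K. 0 \<le> \<theta> s \<and> \<theta> s \<le> 1"
    "\<forall>c\<in>C. (\<exists>s\<in>K. c s \<noteq> 0) \<longrightarrow> \<eta> \<le> \<bar>\<Sum>s\<in>K. \<theta> s * c s\<bar>"
    using insert.IH insert.prems by auto
  define t where "t c = (\<Sum>s\<in>K. \<theta> s * c s)" for c
  \<comment> \<open>For \<open>c a = 0\<close> the quotient defaults to \<open>0\<close>; this
    interval is avoided as well, which keeps all lengths equal.\<close>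
  define B where "B c = {- t c / c a - \<eta> / \<rho>..- t c / c a + \<eta> / \<rho>}" for c
  have "emeasure lborel (\<Union>c\<in>C. B c) \<le> (\<Sum>c\<in>C. emeasure lborel (B c))"
    unfolding B_def using C by (intro emeasure_subadditive_finite) auto
  also have "\<dots> = (\<Sum>c\<in>C. ennreal (2 * \<eta> / \<rho>))"
    unfolding B_def using \<eta> \<rho> by (intro sum.cong) (auto simp: field_simps)
  also have "\<dots> = ennreal (real (card C) * (2 * \<eta> / \<rho>))"
    using \<eta> \<rho> by (subst sum_ennreal) auto
  also have "\<dots> < ennreal 1"
    using small by (intro ennreal_lessI) auto
  also have "\<dots> = emeasure lborel {0..1::real}" by simp
  finally have less: "emeasure lborel (\<Union>c\<in>C. B c) < emeasure lborel {0..1::real}" .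
  have "\<not> {0..1} \<subseteq> (\<Union>c\<in>C. B c)"
  proof
    assume "{0..1} \<subseteq> (\<Union>c\<in>C. B c)"
    moreover have "(\<Union>c\<in>C. B c) \<in> sets lborel"
      unfolding B_def using C by (intro sets.finite_UN) auto
    ultimately show False using less emeasure_mono[of "{0..1}" "\<Union>c\<in>C. B c" lborel] by simp
  qed
  then obtain x where "x \<in> {0..1}" "x \<notin> (\<Union>c\<in>C. B c)" by blast
  then have x: "0 \<le> x" "x \<le> 1" "\<And>c. c \<in> C \<Longrightarrow> x \<notin> B c" by auto
  have sum_eq: "(\<Sum>s\<in>insert a K. (\<theta>(a := x)) s * c s) = x * c a + t c" for c
  proof -
    have "(\<Sum>s\<in>K. (\<theta>(a := x)) s * c s) = t c"
      unfolding t_def using insert.hyps by (intro sum.cong) auto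
    then show ?thesis using insert.hyps by simp
  qed
  have sep: "\<eta> \<le> \<bar>x * c a + t c\<bar>" if "c \<in> C" "c a \<noteq> 0" for c
  proof -
    have "\<eta> / \<rho> \<le> \<bar>x + t c / c a\<bar>" using x(3)[OF that(1)] by (auto simp: B_def abs_if)
    then have "\<rho> * (\<eta> / \<rho>) \<le> \<bar>c a\<bar> * \<bar>x + t c / c a\<bar>"
      using insert.prems[of c a] that \<rho> \<eta> by (intro mult_mono) auto
    also have "\<dots> = \<bar>c a * (x + t c / c a)\<bar>" by (simp add: abs_mult)
    also have "c a * (x + t c / c a) = x * c a + t c" using that by (simp add: field_simps)
    finally show ?thesis using \<rho> by simp
  qed
  show ?case
  proof (intro exI[of _ "\<theta>(a := x)"] conjI ballI impI)
    fix c assume c: "c \<in> C" "\<exists>s\<in>insert a K. c s \<noteq> 0"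
    show "\<eta> \<le> \<bar>\<Sum>s\<in>insert a K. (\<theta>(a := x)) s * c s\<bar>"
    proof (cases "c a = 0")
      case True
      then have "\<exists>s\<in>K. c s \<noteq> 0" using c by auto
      then show ?thesis using \<theta>(2) c(1) True unfolding sum_eq by (simp add: t_def)
    next
      case False
      then show ?thesis using sep[OF c(1)] by (simp add: sum_eq del: fun_upd_apply)
    qed
  qed (use x \<theta> in auto)
qed

section \<open>Outer codes in the Hamming metric\<close>

definition hamming :: "nat \<Rightarrow> (nat \<Rightarrow> 'a) \<Rightarrow> (nat \<Rightarrow> 'a) \<Rightarrow> nat" where
  "hamming n x y = card {t. t < n \<and> x t \<noteq> y t}"

text \<open>A word in the ball is determined by a set of positions outside of which it equals
  \<open>c\<close> and by its letters there. The crude count \<open>2 ^ n\<close> for the sets costs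
  one bit per channel use, negligible once \<open>log 2 (card A)\<close> grows with the
  power.\<close>

lemma card_hamming_ball_le:
  assumes A: "finite A" "A \<noteq> {}" and c: "c \<in> {..<n} \<rightarrow>\<^sub>E A"
  shows "card {x \<in> {..<n} \<rightarrow>\<^sub>E A. hamming n c x \<le> d} \<le> 2 ^ n * card A ^ d"
proof -
  define S where "S = {T. T \<subseteq> {..<n} \<and> card T \<le> d}"
  define E where "E T = {x \<in> {..<n} \<rightarrow>\<^sub>E A. \<forall>t<n. t \<notin> T \<longrightarrow> x t = c t}" for T
  have q: "card A \<ge> 1" using A by (simp add: Suc_le_eq card_gt_0_iff)
  have finS: "finite S" unfolding S_def by auto
  have E_card: "card (E T) \<le> card A ^ d" if T: "T \<in> S" for T
  proof -
    have finT: "finite T" using T finite_subset by (auto simp: S_def)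
    have inj: "inj_on (\<lambda>x. restrict x T) (E T)"
    proof (rule inj_onI)
      fix x y assume xy: "x \<in> E T" "y \<in> E T" "restrict x T = restrict y T"
      show "x = y"
      proof (rule PiE_ext)
        show "x \<in> {..<n} \<rightarrow>\<^sub>E A" "y \<in> {..<n} \<rightarrow>\<^sub>E A" using xy by (auto simp: E_def)
        fix t assume t: "t \<in> {..<n}"
        show "x t = y t"
        proof (cases "t \<in> T")
          case True
          then show ?thesis using fun_cong[OF xy(3), of t] by simp
        qed (use xy t in \<open>auto simp: E_def\<close>)
      qed
    qed
    have "card (E T) \<le> card (T \<rightarrow>\<^sub>E A)"
      using T by (intro card_inj_on_le[OF inj] finite_PiE finT A) (auto simp: E_def S_def PiE_iff)
    also have "\<dots> = card A ^ card T" using finT by (simp add: card_PiE)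
    also have "\<dots> \<le> card A ^ d" using T q by (intro power_increasing) (auto simp: S_def)
    finally show ?thesis .
  qed
  have "card {x \<in> {..<n} \<rightarrow>\<^sub>E A. hamming n c x \<le> d} \<le> card (\<Union>T\<in>S. E T)"
  proof (rule card_mono)
    show "finite (\<Union>T\<in>S. E T)"
      using finS A by (auto simp: E_def intro!: finite_PiE)
    show "{x \<in> {..<n} \<rightarrow>\<^sub>E A. hamming n c x \<le> d} \<subseteq> (\<Union>T\<in>S. E T)"
    proof
      fix x assume "x \<in> {x \<in> {..<n} \<rightarrow>\<^sub>E A. hamming n c x \<le> d}"
      then have "{t. t < n \<and> c t \<noteq> x t} \<in> S" "x \<in> E {t. t < n \<and> c t \<noteq> x t}"
        by (auto simp: S_def E_def hamming_def)
      then show "x \<in> (\<Union>T\<in>S. E T)" by blast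
    qed
  qed
  also have "\<dots> \<le> (\<Sum>T\<in>S. card (E T))" by (rule card_UN_le[OF finS])
  also have "\<dots> \<le> (\<Sum>T\<in>S. card A ^ d)" by (intro sum_mono E_card)
  also have "\<dots> = card S * card A ^ d" by simp
  also have "\<dots> \<le> 2 ^ n * card A ^ d"
  proof (rule mult_right_mono)
    have "card S \<le> card (Pow {..<n})" unfolding S_def by (intro card_mono) auto
    then show "card S \<le> 2 ^ n" by (simp add: card_Pow)
  qed auto
  finally show ?thesis .
qed

text \<open>The balls of radius \<open>d\<close> around a maximal code with this separation cover
  all words, since an uncovered word could be added; comparing cardinalities gives the size.\<close>

lemma gilbert_varshamov:
  assumes A: "finite A" "A \<noteq> {}"
  obtains C where "C \<subseteq> {..<n} \<rightarrow>\<^sub>E A" "\<And>x y. x \<in> C \<Longrightarrow> y \<in> C \<Longrightarrow> x \<noteq> y \<Longrightarrow> d < hamming n x y"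
    "card A ^ n \<le> card C * (2 ^ n * card A ^ d)"
proof -
  let ?W = "{..<n} \<rightarrow>\<^sub>E A"
  define F where "F = {C. C \<subseteq> ?W \<and> (\<forall>x\<in>C. \<forall>y\<in>C. x \<noteq> y \<longrightarrow> d < hamming n x y)}"
  have finW: "finite ?W" using A by (intro finite_PiE) auto
  have "finite F" using finW by (auto simp: F_def intro: finite_subset[of _ "Pow ?W"])
  moreover have "{} \<in> F" by (simp add: F_def)
  ultimately obtain C where C: "C \<in> F" and max: "\<And>C'. C' \<in> F \<Longrightarrow> C \<subseteq> C' \<Longrightarrow> C = C'"
    using finite_has_maximal2[of F "{}"] by metis
  have finC: "finite C" using C finW finite_subset by (auto simp: F_def)
  have cover: "?W \<subseteq> (\<Union>c\<in>C. {x \<in> ?W. hamming n c x \<le> d})"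
  proof
    fix x assume x: "x \<in> ?W"
    show "x \<in> (\<Union>c\<in>C. {x \<in> ?W. hamming n c x \<le> d})"
    proof (rule ccontr)
      assume far: "x \<notin> (\<Union>c\<in>C. {x \<in> ?W. hamming n c x \<le> d})"
      have sym: "hamming n x c = hamming n c x" for c
        unfolding hamming_def by (rule arg_cong[where f = card]) auto
      have far': "d < hamming n c x" if "c \<in> C" for c
        using far x that by (auto simp: not_le)
      have CW: "C \<subseteq> ?W" and sep: "\<forall>u\<in>C. \<forall>v\<in>C. u \<noteq> v \<longrightarrow> d < hamming n u v"
        using C by (simp_all add: F_def)
      have "\<forall>u\<in>insert x C. \<forall>v\<in>insert x C. u \<noteq> v \<longrightarrow> d < hamming n u v"
        using far' sep sym by (metis insert_iff)
      then have "insert x C \<in> F" using x CW by (simp add: F_def)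
      then have "x \<in> C" using max by blast
      then show False using far'[of x] by (simp add: hamming_def)
    qed
  qed
  have "card A ^ n = card ?W" by (simp add: card_PiE)
  also have "\<dots> \<le> card (\<Union>c\<in>C. {x \<in> ?W. hamming n c x \<le> d})"
    using finC finW by (intro card_mono cover) auto
  also have "\<dots> \<le> (\<Sum>c\<in>C. card {x \<in> ?W. hamming n c x \<le> d})" by (rule card_UN_le[OF finC])
  also have "\<dots> \<le> (\<Sum>c\<in>C. 2 ^ n * card A ^ d)"
    using C by (intro sum_mono card_hamming_ball_le A) (auto simp: F_def)
  also have "\<dots> = card C * (2 ^ n * card A ^ d)" by simp
  finally show thesis using C that by (auto simp: F_def)
qed

section \<open>Tails of Gaussian noise blocks\<close>

abbreviation std_gaussian :: "real measure" where
  "std_gaussian \<equiv> density lborel (\<lambda>x. ennreal (std_normal_density x))"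

lemma prob_space_std_gaussian: "prob_space std_gaussian"
  by (rule prob_space_normal_density) simp

lemma prob_space_gaussian_noise: "prob_space (gaussian_noise n)"
  unfolding gaussian_noise_def by (intro prob_space_PiM prob_space_std_gaussian)

lemma gaussian_tail_small:
  assumes "\<delta> > 0"
  obtains T where "T > 0" "measure std_gaussian {x. T \<le> \<bar>x\<bar>} \<le> \<delta>"
proof -
  interpret prob_space std_gaussian by (rule prob_space_std_gaussian)
  have "(\<lambda>k. prob {x. real k \<le> \<bar>x\<bar>}) \<longlonglongrightarrow> prob (\<Inter>k. {x. real k \<le> \<bar>x\<bar>})"
    by (intro finite_Lim_measure_decseq) (auto simp: decseq_def)
  moreover have "(\<Inter>k. {x::real. real k \<le> \<bar>x\<bar>}) = {}"
  proof (rule equals0I)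
    fix x assume x: "x \<in> (\<Inter>k. {x::real. real k \<le> \<bar>x\<bar>})"
    obtain k where "\<bar>x\<bar> < real k" using reals_Archimedean2 by blast
    then show False using x by (auto simp: not_le[symmetric])
  qed
  ultimately have "(\<lambda>k. prob {x. real k \<le> \<bar>x\<bar>}) \<longlonglongrightarrow> 0" by simp
  then have "\<forall>\<^sub>F k in sequentially. prob {x. real k \<le> \<bar>x\<bar>} < \<delta>"
    using assms by (rule order_tendstoD)
  then have "\<forall>\<^sub>F k in sequentially. prob {x. real k \<le> \<bar>x\<bar>} < \<delta> \<and> k > 0"
    using eventually_gt_at_top[of 0] by eventually_elim auto
  then obtain k where "prob {x. real k \<le> \<bar>x\<bar>} < \<delta>" "k > 0"
    using eventually_happens by (metis (mono_tags, lifting) trivial_limit_sequentially)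
  then show thesis using that[of "real k"] by simp
qed

text \<open>A union bound over at most \<open>2 ^ n\<close> sets of \<open>k\<close> positions; on a
  fixed set, independence gives the power. For \<open>k\<close> a fixed fraction of
  \<open>n\<close>, a small enough tail beats \<open>2 ^ n\<close>, which controls the number of
  spoiled symbols.\<close>

lemma gaussian_noise_many_large:
  "measure (gaussian_noise n) {z \<in> space (gaussian_noise n). k \<le> card {t. t < n \<and> T \<le> \<bar>z t\<bar>}}
     \<le> 2 ^ n * measure std_gaussian {x. T \<le> \<bar>x\<bar>} ^ k"
proof -
  interpret G: prob_space std_gaussian by (rule prob_space_std_gaussian)
  interpret N: prob_space "gaussian_noise n" by (rule prob_space_gaussian_noise)
  interpret P: finite_product_prob_space "\<lambda>_::nat. std_gaussian" "{..<n}" by standard simp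
  let ?p = "measure std_gaussian {x. T \<le> \<bar>x\<bar>}"
  define S where "S = {A. A \<subseteq> {..<n} \<and> card A = k}"
  define E where "E A = ({..<n} \<rightarrow>\<^sub>E UNIV) \<inter> {z. \<forall>t\<in>A. T \<le> \<bar>z t :: real\<bar>}" for A
  have E_eq: "E A = (\<Pi>\<^sub>E t\<in>{..<n}. if t \<in> A then {x. T \<le> \<bar>x\<bar>} else UNIV)" if "A \<subseteq> {..<n}" for A
    using that by (auto simp: E_def PiE_iff split: if_splits)
  have finS: "finite S" unfolding S_def by auto
  have E_sets: "E A \<in> sets (gaussian_noise n)" if "A \<in> S" for A
    using that unfolding S_def by (auto simp: E_eq gaussian_noise_def intro!: sets_PiM_I_finite)
  have E_meas: "measure (gaussian_noise n) (E A) = ?p ^ k" if "A \<in> S" for A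
  proof -
    have A: "A \<subseteq> {..<n}" "card A = k" using that by (auto simp: S_def)
    have "measure (gaussian_noise n) (E A) =
        (\<Prod>t<n. measure std_gaussian (if t \<in> A then {x. T \<le> \<bar>x\<bar>} else UNIV))"
      unfolding E_eq[OF A(1)] gaussian_noise_def by (rule P.prob_times) auto
    also have "\<dots> = (\<Prod>t<n. if t \<in> A then ?p else 1)"
      using G.prob_space by (intro prod.cong) auto
    also have "\<dots> = (\<Prod>t\<in>A. ?p)" using A by (simp add: prod.inter_restrict[symmetric] Int_absorb1 del: prod_constant)
    finally show ?thesis using A by simp
  qed
  have "measure (gaussian_noise n) {z \<in> space (gaussian_noise n). k \<le> card {t. t < n \<and> T \<le> \<bar>z t\<bar>}}
      \<le> measure (gaussian_noise n) (\<Union>A\<in>S. E A)"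
  proof (rule N.finite_measure_mono)
    show "(\<Union>A\<in>S. E A) \<in> sets (gaussian_noise n)"
      using finS E_sets by (intro sets.finite_UN)
    show "{z \<in> space (gaussian_noise n). k \<le> card {t. t < n \<and> T \<le> \<bar>z t\<bar>}} \<subseteq> (\<Union>A\<in>S. E A)"
    proof
      fix z assume z: "z \<in> {z \<in> space (gaussian_noise n). k \<le> card {t. t < n \<and> T \<le> \<bar>z t\<bar>}}"
      then obtain A where "A \<subseteq> {t. t < n \<and> T \<le> \<bar>z t\<bar>}" "card A = k"
        using obtain_subset_with_card_n by (metis (no_types, lifting) mem_Collect_eq)
      then have "A \<in> S" "z \<in> E A"
        using z by (auto simp: S_def E_def gaussian_noise_def space_PiM)
      then show "z \<in> (\<Union>A\<in>S. E A)" by blast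
    qed
  qed
  also have "\<dots> \<le> (\<Sum>A\<in>S. measure (gaussian_noise n) (E A))"
    using finS E_sets by (intro N.finite_measure_subadditive_finite) auto
  also have "\<dots> = real (card S) * ?p ^ k" using E_meas by simp
  also have "\<dots> \<le> 2 ^ n * ?p ^ k"
  proof (rule mult_right_mono)
    have "card S \<le> card (Pow {..<n})" unfolding S_def by (intro card_mono) auto
    then have "real (card S) \<le> real (2 ^ n)" unfolding of_nat_le_iff by (simp add: card_Pow)
    then show "real (card S) \<le> 2 ^ n" by simp
  qed auto
  finally show ?thesis .
qed

subsection \<open>Splitting and shifting Gaussian noise\<close>

lemma sets_gaussian_noise [measurable_cong]: "sets (gaussian_noise n) = sets (Pi\<^sub>M {..<n} (\<lambda>_. borel))"
  unfolding gaussian_noise_def by (intro sets_PiM_cong) auto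

lemma space_gaussian_noise: "space (gaussian_noise n) = {..<n} \<rightarrow>\<^sub>E UNIV"
  by (simp add: gaussian_noise_def space_PiM)

text \<open>Stability of the normal law under independent sums, as an iterated integral, so that it
  can be applied coordinate by coordinate to noise blocks.\<close>

lemma std_gaussian_mixture:
  fixes a b :: real
  assumes a: "a \<noteq> 0" and b: "b \<noteq> 0" and ab: "a\<^sup>2 + b\<^sup>2 = 1" and A[measurable]: "A \<in> sets borel"
  shows "(\<integral>\<^sup>+ x. \<integral>\<^sup>+ y. indicator A (a * x + b * y) \<partial>std_gaussian \<partial>std_gaussian) = emeasure std_gaussian A"
proof -
  interpret G: prob_space std_gaussian by (rule prob_space_std_gaussian)
  interpret P: pair_prob_space std_gaussian std_gaussian ..
  let ?P = "std_gaussian \<Otimes>\<^sub>M std_gaussian"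
  have dfst: "distr ?P borel fst = std_gaussian"
    using G.distr_pair_fst[of std_gaussian] by (simp cong: distr_cong)
  have dsnd: "distr ?P borel snd = std_gaussian"
  proof (rule measure_eqI)
    fix A assume "A \<in> sets (distr ?P borel snd)"
    then have A: "A \<in> sets borel" by simp
    have "emeasure (distr ?P borel snd) A = emeasure ?P (UNIV \<times> A)"
      using A by (subst emeasure_distr) (auto simp: space_pair_measure intro!: arg_cong[where f = "emeasure ?P"])
    also have "\<dots> = emeasure std_gaussian UNIV * emeasure std_gaussian A"
      using A by (intro G.emeasure_pair_measure_Times) auto
    finally show "emeasure (distr ?P borel snd) A = emeasure std_gaussian A"
      using G.emeasure_space_1 by simp
  qed simp
  have n1: "distributed ?P lborel fst (normal_density 0 1)"
    unfolding distributed_def using dfst by (simp cong: distr_cong)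
  have n2: "distributed ?P lborel snd (normal_density 0 1)"
    unfolding distributed_def using dsnd by (simp cong: distr_cong)
  have n1': "distributed ?P lborel (\<lambda>\<omega>. a * fst \<omega>) (normal_density 0 \<bar>a\<bar>)"
    using P.normal_density_affine[OF n1, of a 0] a by simp
  have n2': "distributed ?P lborel (\<lambda>\<omega>. b * snd \<omega>) (normal_density 0 \<bar>b\<bar>)"
    using P.normal_density_affine[OF n2, of b 0] b by simp
  have ind0: "P.indep_var borel fst borel snd"
    unfolding P.indep_var_distribution_eq using dfst dsnd
    by (auto simp: distr_id2 cong: sets_pair_measure_cong)
  have ind: "P.indep_var borel (\<lambda>\<omega>. a * fst \<omega>) borel (\<lambda>\<omega>. b * snd \<omega>)"
    using P.indep_var_compose[OF ind0, of "\<lambda>x. a * x" borel "\<lambda>x. b * x" borel] by (simp add: comp_def)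
  have "distributed ?P lborel (\<lambda>\<omega>. a * fst \<omega> + b * snd \<omega>) (normal_density (0 + 0) (sqrt (\<bar>a\<bar>\<^sup>2 + \<bar>b\<bar>\<^sup>2)))"
    by (rule P.add_indep_normal[OF ind _ _ n1' n2']) (use a b in auto)
  then have "distr ?P lborel (\<lambda>\<omega>. a * fst \<omega> + b * snd \<omega>) = std_gaussian"
    using ab by (simp add: distributed_def)
  then have "emeasure std_gaussian A = emeasure (distr ?P lborel (\<lambda>\<omega>. a * fst \<omega> + b * snd \<omega>)) A" by simp
  also have "\<dots> = (\<integral>\<^sup>+ \<omega>. indicator A \<omega> \<partial>distr ?P lborel (\<lambda>\<omega>. a * fst \<omega> + b * snd \<omega>))"
    by simp
  also have "\<dots> = (\<integral>\<^sup>+ \<omega>. indicator A (a * fst \<omega> + b * snd \<omega>) \<partial>?P)"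
    by (rule nn_integral_distr) measurable
  also have "\<dots> = (\<integral>\<^sup>+ x. \<integral>\<^sup>+ y. indicator A (a * x + b * y) \<partial>std_gaussian \<partial>std_gaussian)"
    by (subst G.nn_integral_fst[symmetric]) simp_all
  finally show ?thesis by simp
qed

definition mix :: "nat \<Rightarrow> real \<Rightarrow> real \<Rightarrow> (nat \<Rightarrow> real) \<Rightarrow> (nat \<Rightarrow> real) \<Rightarrow> nat \<Rightarrow> real" where
  "mix n a b u v = (\<lambda>t\<in>{..<n}. a * u t + b * v t)"

lemma measurable_mix [measurable]:
  "(\<lambda>\<omega>. mix n a b (fst \<omega>) (snd \<omega>)) \<in> measurable (Pi\<^sub>M {..<n} (\<lambda>_. borel) \<Otimes>\<^sub>M Pi\<^sub>M {..<n} (\<lambda>_. borel)) (Pi\<^sub>M {..<n} (\<lambda>_. borel))"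
  unfolding mix_def by measurable

text \<open>A normalized mixture of two independent noise blocks is again a noise block. So the
  noises of all receivers can be built from one pair of blocks without changing any single error
  probability.\<close>

lemma distr_gaussian_noise_mix:
  assumes ab: "a \<noteq> 0" "b \<noteq> 0" "a\<^sup>2 + b\<^sup>2 = 1"
  shows "distr (gaussian_noise n \<Otimes>\<^sub>M gaussian_noise n) (gaussian_noise n)
           (\<lambda>\<omega>. mix n a b (fst \<omega>) (snd \<omega>)) = gaussian_noise n"
proof -
  interpret G: prob_space std_gaussian by (rule prob_space_std_gaussian)
  interpret N: prob_space "gaussian_noise n" by (rule prob_space_gaussian_noise)
  interpret NN: pair_prob_space "gaussian_noise n" "gaussian_noise n" ..
  interpret S: product_sigma_finite "\<lambda>_::nat. std_gaussian" ..
  let ?\<gamma> = "gaussian_noise n"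
  let ?f = "\<lambda>\<omega>. mix n a b (fst \<omega>) (snd \<omega>)"
  have meas: "?f \<in> measurable (?\<gamma> \<Otimes>\<^sub>M ?\<gamma>) ?\<gamma>" by measurable
  have "distr (?\<gamma> \<Otimes>\<^sub>M ?\<gamma>) ?\<gamma> ?f = Pi\<^sub>M {..<n} (\<lambda>_. std_gaussian)"
  proof (rule S.PiM_eqI)
    show "sets (distr (?\<gamma> \<Otimes>\<^sub>M ?\<gamma>) ?\<gamma> ?f) = sets (Pi\<^sub>M {..<n} (\<lambda>_. std_gaussian))"
      by (simp add: gaussian_noise_def)
    fix A assume "\<And>i. i \<in> {..<n} \<Longrightarrow> A i \<in> sets std_gaussian"
    then have A [measurable]: "\<And>i. i < n \<Longrightarrow> A i \<in> sets borel" by simp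
    have box: "Pi\<^sub>E {..<n} A \<in> sets ?\<gamma>"
      unfolding sets_gaussian_noise using A by (intro sets_PiM_I_finite) auto
    have "emeasure (distr (?\<gamma> \<Otimes>\<^sub>M ?\<gamma>) ?\<gamma> ?f) (Pi\<^sub>E {..<n} A) =
        (\<integral>\<^sup>+ z. indicator (Pi\<^sub>E {..<n} A) z \<partial>distr (?\<gamma> \<Otimes>\<^sub>M ?\<gamma>) ?\<gamma> ?f)" using box by simp
    also have "\<dots> = (\<integral>\<^sup>+ \<omega>. indicator (Pi\<^sub>E {..<n} A) (?f \<omega>) \<partial>(?\<gamma> \<Otimes>\<^sub>M ?\<gamma>))"
      using meas box by (intro nn_integral_distr) auto
    also have "\<dots> = (\<integral>\<^sup>+ u. \<integral>\<^sup>+ v. indicator (Pi\<^sub>E {..<n} A) (mix n a b u v) \<partial>?\<gamma> \<partial>?\<gamma>)"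
    proof (subst N.nn_integral_fst[symmetric])
      show "(\<lambda>\<omega>. indicator (Pi\<^sub>E {..<n} A) (?f \<omega>)) \<in> borel_measurable (?\<gamma> \<Otimes>\<^sub>M ?\<gamma>)"
        using meas box by (intro measurable_compose[OF meas]) auto
    qed simp
    also have "\<dots> = (\<integral>\<^sup>+ u. \<integral>\<^sup>+ v. (\<Prod>t<n. indicator (A t) (a * u t + b * v t)) \<partial>?\<gamma> \<partial>?\<gamma>)"
      by (intro nn_integral_cong) (auto simp: mix_def PiE_iff indicator_def prod.If_cases extensional_def split: if_splits)
    also have "\<dots> = (\<integral>\<^sup>+ u. (\<Prod>t<n. \<integral>\<^sup>+ y. indicator (A t) (a * u t + b * y) \<partial>std_gaussian) \<partial>?\<gamma>)"
      unfolding gaussian_noise_def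
      by (intro nn_integral_cong S.product_nn_integral_prod) auto
    also have "\<dots> = (\<Prod>t<n. \<integral>\<^sup>+ x. \<integral>\<^sup>+ y. indicator (A t) (a * x + b * y) \<partial>std_gaussian \<partial>std_gaussian)"
      unfolding gaussian_noise_def
      by (rule S.product_nn_integral_prod) auto
    also have "\<dots> = (\<Prod>t<n. emeasure std_gaussian (A t))"
      using ab A by (intro prod.cong std_gaussian_mixture) auto
    finally show "emeasure (distr (?\<gamma> \<Otimes>\<^sub>M ?\<gamma>) ?\<gamma> ?f) (Pi\<^sub>E {..<n} A) = (\<Prod>t<n. emeasure std_gaussian (A t))" .
  qed simp
  then show ?thesis by (simp add: gaussian_noise_def)
qed

text \<open>Change of measure by pointwise domination: the reference Gaussian on the right does not
  depend on the shift \<open>a\<close>. As long as \<open>a\<close> is of the order of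
  \<open>r\<close>, the price is of order \<open>r / s\<close>, the number of amplitudes that noise
  of size \<open>s\<close> leaves distinguishable.\<close>

lemma nn_integral_shifted_gaussian_le:
  fixes s r a :: real
  assumes s: "0 < s" "s \<le> r" and f[measurable]: "f \<in> borel_measurable borel"
  shows "(\<integral>\<^sup>+ x. f (a + s * x) \<partial>std_gaussian)
    \<le> ennreal (sqrt 2 * r / s * exp (a\<^sup>2 / (2 * r\<^sup>2))) *
        (\<integral>\<^sup>+ y. f y \<partial>density lborel (\<lambda>x. ennreal (normal_density 0 (sqrt 2 * r) x)))"
proof -
  let ?K = "sqrt 2 * r / s * exp (a\<^sup>2 / (2 * r\<^sup>2))"
  have r: "r > 0" using s by simp
  have dens: "normal_density a s y \<le> ?K * normal_density 0 (sqrt 2 * r) y" for y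
  proof -
    have "(y - a)\<^sup>2 / (2 * r\<^sup>2) \<le> (y - a)\<^sup>2 / (2 * s\<^sup>2)"
      using s by (intro divide_left_mono) (auto intro: power_mono)
    \<comment> \<open>This trades the square around the shift for the one around \<open>0\<close>;
      its factor 2 is the reason for the variance \<open>2 * r\<^sup>2\<close> of the reference
      law.\<close>
    moreover have "y\<^sup>2 \<le> 2 * (y - a)\<^sup>2 + 2 * a\<^sup>2"
      using zero_le_power2[of "y - 2 * a"] by (simp add: power2_eq_square algebra_simps)
    then have "y\<^sup>2 / (4 * r\<^sup>2) \<le> (2 * (y - a)\<^sup>2 + 2 * a\<^sup>2) / (4 * r\<^sup>2)"
      by (intro divide_right_mono) auto
    then have "y\<^sup>2 / (4 * r\<^sup>2) \<le> (y - a)\<^sup>2 / (2 * r\<^sup>2) + a\<^sup>2 / (2 * r\<^sup>2)"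
      by (simp add: add_divide_distrib)
    ultimately have "- ((y - a)\<^sup>2 / (2 * s\<^sup>2)) \<le> a\<^sup>2 / (2 * r\<^sup>2) + - (y\<^sup>2 / (4 * r\<^sup>2))" by linarith
    then have "exp (- ((y - a)\<^sup>2 / (2 * s\<^sup>2))) \<le> exp (a\<^sup>2 / (2 * r\<^sup>2)) * exp (- (y\<^sup>2 / (4 * r\<^sup>2)))"
      by (simp add: exp_add[symmetric] del: exp_le_cancel_iff) simp
    then have "1 / (s * sqrt (2 * pi)) * exp (- ((y - a)\<^sup>2 / (2 * s\<^sup>2)))
        \<le> 1 / (s * sqrt (2 * pi)) * (exp (a\<^sup>2 / (2 * r\<^sup>2)) * exp (- (y\<^sup>2 / (4 * r\<^sup>2))))"
      using s by (intro mult_left_mono) auto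
    moreover have "normal_density a s y = 1 / (s * sqrt (2 * pi)) * exp (- ((y - a)\<^sup>2 / (2 * s\<^sup>2)))"
      using s by (simp add: normal_density_def real_sqrt_mult)
    moreover have "?K * normal_density 0 (sqrt 2 * r) y =
        1 / (s * sqrt (2 * pi)) * (exp (a\<^sup>2 / (2 * r\<^sup>2)) * exp (- (y\<^sup>2 / (4 * r\<^sup>2))))"
    proof -
      have "sqrt (2 * pi * (sqrt 2 * r)\<^sup>2) = sqrt 2 * (r * sqrt (2 * pi))"
        using r by (simp add: real_sqrt_mult power_mult_distrib)
      then show ?thesis using r s by (simp add: normal_density_def power_mult_distrib)
    qed
    ultimately show ?thesis by simp
  qed
  have "(\<integral>\<^sup>+ x. f (a + s * x) \<partial>std_gaussian) = (\<integral>\<^sup>+ x. ennreal (std_normal_density x) * f (a + s * x) \<partial>lborel)"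
    by (subst nn_integral_density) auto
  also have "\<dots> = (\<integral>\<^sup>+ x. ennreal s * (ennreal (normal_density a s (a + s * x)) * f (a + s * x)) \<partial>lborel)"
  proof (intro nn_integral_cong)
    fix x
    have "std_normal_density x = s * normal_density a s (a + s * x)"
      using s by (simp add: normal_density_def real_sqrt_mult power_mult_distrib)
    then show "ennreal (std_normal_density x) * f (a + s * x) =
        ennreal s * (ennreal (normal_density a s (a + s * x)) * f (a + s * x))"
      using s by (simp add: ennreal_mult mult.assoc)
  qed
  also have "\<dots> = ennreal \<bar>s\<bar> * (\<integral>\<^sup>+ x. ennreal (normal_density a s (a + s * x)) * f (a + s * x) \<partial>lborel)"
    using s by (subst nn_integral_cmult) auto
  also have "\<dots> = (\<integral>\<^sup>+ y. ennreal (normal_density a s y) * f y \<partial>lborel)"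
    using s by (subst nn_integral_real_affine[of "\<lambda>y. ennreal (normal_density a s y) * f y" s a]) auto
  also have "\<dots> \<le> (\<integral>\<^sup>+ y. ennreal ?K * (ennreal (normal_density 0 (sqrt 2 * r) y) * f y) \<partial>lborel)"
  proof (intro nn_integral_mono)
    fix y
    have "ennreal (normal_density a s y) \<le> ennreal ?K * ennreal (normal_density 0 (sqrt 2 * r) y)"
      using dens[of y] r s by (simp add: ennreal_mult[symmetric] ennreal_leI)
    then show "ennreal (normal_density a s y) * f y \<le> ennreal ?K * (ennreal (normal_density 0 (sqrt 2 * r) y) * f y)"
      by (simp add: mult.assoc[symmetric] mult_right_mono)
  qed
  also have "\<dots> = ennreal ?K * (\<integral>\<^sup>+ y. f y \<partial>density lborel (\<lambda>x. ennreal (normal_density 0 (sqrt 2 * r) x)))"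
    by (subst nn_integral_cmult) (auto simp: nn_integral_density)
  finally show ?thesis .
qed

lemma nn_integral_shifted_gaussian_PiM_le:
  fixes a :: "'i \<Rightarrow> real"
  assumes s: "0 < s" "s \<le> r" and I: "finite I"
    and F: "F \<in> borel_measurable (Pi\<^sub>M I (\<lambda>_. borel))"
  shows "(\<integral>\<^sup>+ u. F (\<lambda>i\<in>I. a i + s * u i) \<partial>Pi\<^sub>M I (\<lambda>_. std_gaussian))
    \<le> (\<Prod>i\<in>I. ennreal (sqrt 2 * r / s * exp ((a i)\<^sup>2 / (2 * r\<^sup>2)))) *
        (\<integral>\<^sup>+ y. F y \<partial>Pi\<^sub>M I (\<lambda>_. density lborel (\<lambda>x. ennreal (normal_density 0 (sqrt 2 * r) x))))"
  using I F
proof (induction I arbitrary: F rule: finite_induct)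
  case empty
  then show ?case by (simp add: PiM_empty nn_integral_count_space_finite)
next
  case (insert i I)
  define N where "N = density lborel (\<lambda>x. ennreal (normal_density 0 (sqrt 2 * r) x))"
  define K where "K = (\<lambda>i. ennreal (sqrt 2 * r / s * exp ((a i)\<^sup>2 / (2 * r\<^sup>2))))"
  interpret G: prob_space std_gaussian by (rule prob_space_std_gaussian)
  interpret Ns: prob_space N unfolding N_def by (rule prob_space_normal_density) (use s in simp)
  interpret M: product_sigma_finite "\<lambda>_::'i. std_gaussian" ..
  interpret N: product_sigma_finite "\<lambda>_::'i. N" ..
  have setsN [measurable_cong]: "sets N = sets borel" by (simp add: N_def)
  note F [measurable] = insert.prems
  have upd: "(\<lambda>(w, y). w(i := y)) \<in> measurable (Pi\<^sub>M I (\<lambda>_. borel) \<Otimes>\<^sub>M borel) (Pi\<^sub>M (insert i I) (\<lambda>_. borel :: real measure))"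
    by (rule measurable_add_dim)
  \<comment> \<open>The new coordinate is already integrated against the reference law here, so the
    induction hypothesis is applied to \<open>F'\<close>; hence the induction over arbitrary
    \<open>F\<close>.\<close>
  define F' where "F' w = (\<integral>\<^sup>+ y. F (w(i := y)) \<partial>N)" for w
  have F2: "(\<lambda>(w, y). F (w(i := y))) \<in> borel_measurable (Pi\<^sub>M I (\<lambda>_. borel) \<Otimes>\<^sub>M borel)"
    using measurable_compose[OF upd F] by (simp add: case_prod_beta)
  have "(\<lambda>(w, y). F (w(i := y))) \<in> borel_measurable (Pi\<^sub>M I (\<lambda>_. borel) \<Otimes>\<^sub>M N)"
    using F2 by (simp cong: measurable_cong_sets sets_pair_measure_cong add: setsN)
  then have F': "F' \<in> borel_measurable (Pi\<^sub>M I (\<lambda>_. borel))"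
    unfolding F'_def by (rule Ns.borel_measurable_nn_integral)
  have sPM: "sets (Pi\<^sub>M A (\<lambda>_. std_gaussian)) = sets (Pi\<^sub>M A (\<lambda>_. borel))" for A :: "'i set"
    by (intro sets_PiM_cong) auto
  have sPN: "sets (Pi\<^sub>M A (\<lambda>_. N)) = sets (Pi\<^sub>M A (\<lambda>_. borel))" for A :: "'i set"
    using setsN by (intro sets_PiM_cong) auto
  have shift: "(\<lambda>u. \<lambda>i\<in>A. a i + s * u i) \<in> measurable (Pi\<^sub>M A (\<lambda>_. std_gaussian)) (Pi\<^sub>M A (\<lambda>_. borel))" for A :: "'i set"
    by measurable
  have "(\<integral>\<^sup>+ u. F (\<lambda>k\<in>insert i I. a k + s * u k) \<partial>Pi\<^sub>M (insert i I) (\<lambda>_. std_gaussian)) =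
      (\<integral>\<^sup>+ u. \<integral>\<^sup>+ x. F (\<lambda>k\<in>insert i I. a k + s * (u(i := x)) k) \<partial>std_gaussian \<partial>Pi\<^sub>M I (\<lambda>_. std_gaussian))"
    using insert.hyps by (intro M.product_nn_integral_insert measurable_compose[OF shift F])
  also have "\<dots> = (\<integral>\<^sup>+ u. \<integral>\<^sup>+ x. F ((\<lambda>k\<in>I. a k + s * u k)(i := a i + s * x)) \<partial>std_gaussian \<partial>Pi\<^sub>M I (\<lambda>_. std_gaussian))"
  proof -
    have "(\<lambda>k\<in>insert i I. a k + s * (u(i := x)) k) = (\<lambda>k\<in>I. a k + s * u k)(i := a i + s * x)" for u x
      using insert.hyps by (auto simp: restrict_def)
    then show ?thesis by (simp only:)
  qed
  also have "\<dots> \<le> (\<integral>\<^sup>+ u. K i * F' (\<lambda>k\<in>I. a k + s * u k) \<partial>Pi\<^sub>M I (\<lambda>_. std_gaussian))"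
  proof (intro nn_integral_mono)
    fix u
    have "(\<lambda>k\<in>I. a k + s * u k) \<in> space (Pi\<^sub>M I (\<lambda>_. borel :: real measure))" by (simp add: space_PiM)
    then have "(\<lambda>y. F ((\<lambda>k\<in>I. a k + s * u k)(i := y))) \<in> borel_measurable borel"
      using measurable_compose[OF measurable_Pair1' F2] by simp
    then show "(\<integral>\<^sup>+ x. F ((\<lambda>k\<in>I. a k + s * u k)(i := a i + s * x)) \<partial>std_gaussian) \<le> K i * F' (\<lambda>k\<in>I. a k + s * u k)"
      unfolding F'_def N_def K_def by (rule nn_integral_shifted_gaussian_le[OF s])
  qed
  also have "\<dots> = K i * (\<integral>\<^sup>+ u. F' (\<lambda>k\<in>I. a k + s * u k) \<partial>Pi\<^sub>M I (\<lambda>_. std_gaussian))"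
    by (intro nn_integral_cmult measurable_compose[OF shift F'])
  also have "\<dots> \<le> K i * ((\<Prod>i\<in>I. K i) * (\<integral>\<^sup>+ y. F' y \<partial>Pi\<^sub>M I (\<lambda>_. N)))"
    unfolding K_def N_def by (intro mult_left_mono insert.IH F') auto
  also have "(\<integral>\<^sup>+ y. F' y \<partial>Pi\<^sub>M I (\<lambda>_. N)) = (\<integral>\<^sup>+ y. F y \<partial>Pi\<^sub>M (insert i I) (\<lambda>_. N))"
    unfolding F'_def using insert.hyps F
    by (subst N.product_nn_integral_insert) (auto simp: measurable_cong_sets[OF sPN refl])
  finally show ?case using insert.hyps by (simp add: mult.assoc K_def N_def)
qed

subsection \<open>Converse\<close>

definition signal ::
    "nat \<Rightarrow> (nat \<times> nat \<times> nat \<Rightarrow> real) \<Rightarrow> encoders \<Rightarrow> (nat \<Rightarrow> nat \<Rightarrow> nat) \<Rightarrow> (nat \<Rightarrow> nat) \<Rightarrow> nat \<Rightarrow> nat \<Rightarrow> real" where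
  "signal M h enc w \<kappa> j t = (\<Sum>i<M. h (j, i, \<kappa> j) * channel_input enc w i t)"

definition decodes ::
    "nat \<Rightarrow> (nat \<times> nat \<times> nat \<Rightarrow> real) \<Rightarrow> nat \<Rightarrow> encoders \<Rightarrow> decoders \<Rightarrow> (nat \<Rightarrow> nat) \<Rightarrow>
     (nat \<Rightarrow> nat \<Rightarrow> nat) \<Rightarrow> nat \<Rightarrow> (nat \<Rightarrow> real) \<Rightarrow> bool" where
  "decodes M h n enc dec \<kappa> w j z \<longleftrightarrow>
     (\<forall>i<M. dec j \<kappa> (channel_output M h n enc w \<kappa> j z) i = w j i)"

lemma channel_output_eq:
  "channel_output M h n enc w \<kappa> j z = (\<lambda>t\<in>{..<n}. signal M h enc w \<kappa> j t + z t)"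
  by (simp add: channel_output_def signal_def)

lemma message_families_eqI:
  assumes "w \<in> message_families M N n R" "w' \<in> message_families M N n R"
    and eq: "\<And>j i. j < N \<Longrightarrow> i < M \<Longrightarrow> w j i = w' j i"
  shows "w = w'"
proof (rule PiE_ext)
  show "w \<in> {..<N} \<rightarrow>\<^sub>E ({..<M} \<rightarrow>\<^sub>E UNIV)" "w' \<in> {..<N} \<rightarrow>\<^sub>E ({..<M} \<rightarrow>\<^sub>E UNIV)"
    using assms(1,2) by (auto simp: message_families_def PiE_iff)
  fix j assume j: "j \<in> {..<N}"
  show "w j = w' j"
  proof (rule PiE_ext)
    show "w j \<in> {..<M} \<rightarrow>\<^sub>E UNIV" "w' j \<in> {..<M} \<rightarrow>\<^sub>E UNIV"
      using assms(1,2) j by (auto simp: message_families_def PiE_iff)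
  qed (use eq j in auto)
qed

text \<open>
  Receiver \<open>j\<close> recovers its own messages; then only the input of transmitter \<open>i\<close> is unknown,
  and a scaled version of it is what is left after subtraction.
\<close>

lemma decode_unique:
  assumes w: "w \<in> message_families M N n R" "w' \<in> message_families M N n R"
    and ji: "j < N" "i < M" and nz: "h (j, i, \<kappa> j) \<noteq> 0"
    and agree: "\<And>j' i'. j' < N \<Longrightarrow> i' < M \<Longrightarrow> j' \<noteq> j \<Longrightarrow> i' \<noteq> i \<Longrightarrow> w j' i' = w' j' i'"
    and y: "\<And>t. t < n \<Longrightarrow> signal M h enc w \<kappa> j t / h (j, i, \<kappa> j) + s * u t =
                          signal M h enc w' \<kappa> j t / h (j, i, \<kappa> j) + s * u' t"
    and ok: "\<And>j'. j' < N \<Longrightarrow> decodes M h n enc dec \<kappa> w j' (mix n (s * h (j', i, \<kappa> j')) (\<beta> j') u v)"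
    and ok': "\<And>j'. j' < N \<Longrightarrow> decodes M h n enc dec \<kappa> w' j' (mix n (s * h (j', i, \<kappa> j')) (\<beta> j') u' v)"
  shows "w = w'"
proof -
  let ?g = "\<lambda>j. h (j, i, \<kappa> j)"
  let ?S = "\<lambda>w j t. signal M h enc w \<kappa> j t"
  \<comment> \<open>The difference in the assumption is the part of the signal at \<open>j'\<close>
    that is not a multiple of the signal at \<open>j\<close>. Once it agrees, the shared observation
    and the same \<open>v\<close> give receiver \<open>j'\<close> identical blocks for both
    families, hence identical decisions.\<close>
  have same: "w j' i' = w' j' i'"
    if j': "j' < N" "i' < M" and "\<And>t. t < n \<Longrightarrow> ?S w j' t - ?g j' * ?S w j t / ?g j = ?S w' j' t - ?g j' * ?S w' j t / ?g j"
    for j' i'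
  proof -
    have "channel_output M h n enc w \<kappa> j' (mix n (s * ?g j') (\<beta> j') u v) =
          channel_output M h n enc w' \<kappa> j' (mix n (s * ?g j') (\<beta> j') u' v)"
      unfolding channel_output_eq
    proof (rule restrict_ext)
      fix t assume "t \<in> {..<n}"
      then have t: "t < n" by simp
      have "?g j' * (?S w j t / ?g j + s * u t) = ?g j' * (?S w' j t / ?g j + s * u' t)"
        using y[OF t] by simp
      then show "?S w j' t + mix n (s * ?g j') (\<beta> j') u v t = ?S w' j' t + mix n (s * ?g j') (\<beta> j') u' v t"
        using that(3)[OF t] t by (simp add: mix_def algebra_simps)
    qed
    then show ?thesis using ok[of j'] ok'[of j'] j' by (simp add: decodes_def)
  qed
  \<comment> \<open>For \<open>j' = j\<close> that difference is zero, so receiver \<open>j\<close>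
    identifies its own messages first.\<close>
  have row: "w j i' = w' j i'" if "i' < M" for i'
    using ji(1) that nz by (intro same) auto
  have input: "channel_input enc w i' = channel_input enc w' i'" if "i' < M" "i' \<noteq> i" for i'
  proof -
    \<comment> \<open>An encoder is a function of the entire column, also at indices outside
      \<open>{..<N}\<close>, where both families are \<open>undefined\<close>.\<close>
    have "(\<lambda>j'. w j' i') = (\<lambda>j'. w' j' i')"
    proof
      fix j'
      show "w j' i' = w' j' i'"
      proof (cases "j' < N")
        case True
        then show ?thesis using row agree that by (cases "j' = j") auto
      next
        case False
        then have "w j' = w' j'" using w by (auto simp: message_families_def PiE_iff extensional_def)
        then show ?thesis by simp
      qed
    qed
    then show ?thesis by (simp add: channel_input_def fun_eq_iff)
  qed
  \<comment> \<open>The input of \<open>i\<close> cancels from the difference, which leaves only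
    inputs already known to agree.\<close>
  define T where "T w0 j' t = (\<Sum>i'\<in>{..<M} - {i}. h (j', i', \<kappa> j') * channel_input enc w0 i' t)" for w0 j' t
  have split: "?S w0 j' t - ?g j' * ?S w0 j t / ?g j = T w0 j' t - ?g j' * T w0 j t / ?g j" for w0 j' t
  proof -
    have "?S w0 j' t = ?g j' * channel_input enc w0 i t + T w0 j' t" for j'
      unfolding signal_def T_def using ji by (subst sum.remove[of _ i]) auto
    then show ?thesis using nz by (simp add: field_simps)
  qed
  have rest: "T w j' t = T w' j' t" for j' t
    unfolding T_def using input by (intro sum.cong) auto
  have "w j' i' = w' j' i'" if "j' < N" "i' < M" for j' i'
    by (intro same that) (simp only: split rest)
  then show ?thesis by (rule message_families_eqI[OF w])
qed

section \<open>Packing bound for jointly successful decoding\<close>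

lemma decodes_measurable:
  assumes dec: "measurable_decoders M N J n dec" and \<kappa>: "\<kappa> \<in> realizations N J" and j: "j < N"
  shows "Measurable.pred (gaussian_noise n) (decodes M h n enc dec \<kappa> w j)"
proof -
  have out: "channel_output M h n enc w \<kappa> j \<in> measurable (gaussian_noise n) (Pi\<^sub>M {..<n} (\<lambda>_. borel))"
    unfolding channel_output_def by measurable
  have "(\<lambda>z. dec j \<kappa> (channel_output M h n enc w \<kappa> j z) i) \<in> measurable (gaussian_noise n) (count_space UNIV)"
    if "i < M" for i
    using dec \<kappa> j that unfolding measurable_decoders_def by (intro measurable_compose[OF out]) auto
  then have [measurable]: "(\<lambda>z. dec j \<kappa> (channel_output M h n enc w \<kappa> j z) i) \<in> measurable (gaussian_noise n) (count_space UNIV)"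
    if "i \<in> {..<M}" for i using that by simp
  have "Measurable.pred (gaussian_noise n) (\<lambda>z. \<forall>i\<in>{..<M}. dec j \<kappa> (channel_output M h n enc w \<kappa> j z) i = w j i)"
    by measurable
  then show ?thesis unfolding decodes_def by (simp add: Ball_def)
qed

text \<open>The noises of all receivers come from one pair \<open>\<omega>\<close> of blocks, so
  that success of all of them is one event. This coupling is legitimate because the error
  probability of a receiver involves only the law of its own noise.\<close>

definition all_decode ::
    "nat \<Rightarrow> nat \<Rightarrow> (nat \<times> nat \<times> nat \<Rightarrow> real) \<Rightarrow> nat \<Rightarrow> encoders \<Rightarrow> decoders \<Rightarrow> (nat \<Rightarrow> nat) \<Rightarrow>
     (nat \<Rightarrow> real) \<Rightarrow> (nat \<Rightarrow> real) \<Rightarrow> (nat \<Rightarrow> nat \<Rightarrow> nat) \<Rightarrow> ((nat \<Rightarrow> real) \<times> (nat \<Rightarrow> real)) set" where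
  "all_decode M N h n enc dec \<kappa> \<alpha> \<beta> w = {\<omega> \<in> space (gaussian_noise n \<Otimes>\<^sub>M gaussian_noise n).
     \<forall>j\<in>{..<N}. decodes M h n enc dec \<kappa> w j (mix n (\<alpha> j) (\<beta> j) (fst \<omega>) (snd \<omega>))}"

lemma measurable_mix_noise:
  "(\<lambda>\<omega>. mix n a b (fst \<omega>) (snd \<omega>)) \<in> measurable (gaussian_noise n \<Otimes>\<^sub>M gaussian_noise n) (gaussian_noise n)"
  using measurable_mix by measurable

lemma all_decode_sets:
  assumes dec: "measurable_decoders M N J n dec" and \<kappa>: "\<kappa> \<in> realizations N J"
  shows "all_decode M N h n enc dec \<kappa> \<alpha> \<beta> w \<in> sets (gaussian_noise n \<Otimes>\<^sub>M gaussian_noise n)"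
  unfolding all_decode_def
proof (rule sets.sets_Collect_finite_All)
  fix j assume "j \<in> {..<N}"
  then have "Measurable.pred (gaussian_noise n) (decodes M h n enc dec \<kappa> w j)"
    using decodes_measurable[OF dec \<kappa>] by simp
  from measurable_compose[OF measurable_mix_noise this]
  show "{\<omega> \<in> space (gaussian_noise n \<Otimes>\<^sub>M gaussian_noise n).
      decodes M h n enc dec \<kappa> w j (mix n (\<alpha> j) (\<beta> j) (fst \<omega>) (snd \<omega>))} \<in> sets (gaussian_noise n \<Otimes>\<^sub>M gaussian_noise n)"
    by (simp add: pred_def)
qed simp

text \<open>A packing argument in place of an entropy bound. For fixed \<open>v\<close>, the
  observations on which everything is decoded as \<open>w\<close> form disjoint sets
  \<open>G w\<close> for different \<open>w\<close>, by \<open>decode_unique\<close>. Under the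
  common law \<open>Q\<close> their probabilities sum to at most 1, and each change of measure to
  \<open>Q\<close> costs at most the right-hand side as a factor.\<close>

lemma all_decode_sum_le:
  fixes s r c :: real
  assumes dec: "measurable_decoders M N J n dec" and \<kappa>: "\<kappa> \<in> realizations N J"
    and ji: "j < N" "i < M" and nz: "h (j, i, \<kappa> j) \<noteq> 0" and s: "0 < s" "s \<le> r"
    and S: "finite S" "S \<subseteq> message_families M N n R"
    and agree: "\<And>w w' j' i'. w \<in> S \<Longrightarrow> w' \<in> S \<Longrightarrow> j' < N \<Longrightarrow> i' < M \<Longrightarrow> j' \<noteq> j \<Longrightarrow> i' \<noteq> i \<Longrightarrow> w j' i' = w' j' i'"
    and pow: "\<And>w. w \<in> S \<Longrightarrow> (\<Sum>t<n. (signal M h enc w \<kappa> j t / h (j, i, \<kappa> j))\<^sup>2) \<le> real n * c * r\<^sup>2"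
  shows "(\<Sum>w\<in>S. measure (gaussian_noise n \<Otimes>\<^sub>M gaussian_noise n)
            (all_decode M N h n enc dec \<kappa> (\<lambda>j'. s * h (j', i, \<kappa> j')) \<beta> w))
          \<le> (sqrt 2 * r / s * exp (c / 2)) ^ n"
proof -
  interpret N: prob_space "gaussian_noise n" by (rule prob_space_gaussian_noise)
  interpret NN: pair_prob_space "gaussian_noise n" "gaussian_noise n" ..
  define \<gamma> where "\<gamma> = gaussian_noise n"
  define Q where "Q = Pi\<^sub>M {..<n} (\<lambda>_. density lborel (\<lambda>x. ennreal (normal_density 0 (sqrt 2 * r) x)))"
  have r: "r > 0" using s by simp
  interpret Q: prob_space Q
    unfolding Q_def using r by (intro prob_space_PiM prob_space_normal_density) simp
  have sets_Q: "sets Q = sets (Pi\<^sub>M {..<n} (\<lambda>_. borel))" unfolding Q_def by (intro sets_PiM_cong) auto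
  define E where "E w = all_decode M N h n enc dec \<kappa> (\<lambda>j'. s * h (j', i, \<kappa> j')) \<beta> w" for w
  have E_sets: "E w \<in> sets (\<gamma> \<Otimes>\<^sub>M \<gamma>)" for w
    unfolding E_def \<gamma>_def by (rule all_decode_sets[OF dec \<kappa>])
  define a where "a w t = signal M h enc w \<kappa> j t / h (j, i, \<kappa> j)" for w t
  define B where "B = (sqrt 2 * r / s * exp (c / 2)) ^ n"
  have B0: "B \<ge> 0" using r s by (simp add: B_def)
  have fixed_v: "(\<Sum>w\<in>S. emeasure \<gamma> ((\<lambda>u. (u, v)) -` E w)) \<le> ennreal B" if v: "v \<in> space \<gamma>" for v
  proof -
    \<comment> \<open>Success of \<open>w\<close> expressed through the observation
      \<open>y = a w + s * u\<close> alone; given \<open>w\<close>, the noise is recovered as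
      \<open>(y - a w) / s\<close>.\<close>
    define G where "G w = {y \<in> space (Pi\<^sub>M {..<n} (\<lambda>_. borel)). ((\<lambda>t\<in>{..<n}. (y t - a w t) / s), v) \<in> E w}" for w
    have G_sets: "G w \<in> sets (Pi\<^sub>M {..<n} (\<lambda>_. borel))" for w
    proof -
      have "(\<lambda>y. ((\<lambda>t\<in>{..<n}. (y t - a w t) / s), v)) \<in> measurable (Pi\<^sub>M {..<n} (\<lambda>_. borel)) (\<gamma> \<Otimes>\<^sub>M \<gamma>)"
        using v unfolding \<gamma>_def by measurable
      from measurable_sets[OF this E_sets] show ?thesis
        unfolding G_def vimage_def Int_def by (simp add: conj_commute)
    qed
    have le: "emeasure \<gamma> ((\<lambda>u. (u, v)) -` E w) \<le> ennreal B * emeasure Q (G w)" if "w \<in> S" for w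
    proof -
      have sect: "(\<lambda>u. (u, v)) -` E w \<in> sets \<gamma>" using E_sets by (rule sets_Pair2)
      have iff: "(u, v) \<in> E w \<longleftrightarrow> (\<lambda>t\<in>{..<n}. a w t + s * u t) \<in> G w" if "u \<in> space \<gamma>" for u
      proof -
        have "(\<lambda>t\<in>{..<n}. ((\<lambda>t\<in>{..<n}. a w t + s * u t) t - a w t) / s) = u"
          using that s by (auto simp: \<gamma>_def space_gaussian_noise PiE_iff extensional_def)
        then show ?thesis by (simp add: G_def space_PiM)
      qed
      have "emeasure \<gamma> ((\<lambda>u. (u, v)) -` E w) = (\<integral>\<^sup>+ u. indicator ((\<lambda>u. (u, v)) -` E w) u \<partial>\<gamma>)"
        using sect by simp
      also have "\<dots> = (\<integral>\<^sup>+ u. indicator (G w) (\<lambda>t\<in>{..<n}. a w t + s * u t) \<partial>\<gamma>)"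
        using iff by (intro nn_integral_cong) (auto simp: indicator_def)
      also have "\<dots> \<le> (\<Prod>t<n. ennreal (sqrt 2 * r / s * exp ((a w t)\<^sup>2 / (2 * r\<^sup>2)))) * (\<integral>\<^sup>+ y. indicator (G w) y \<partial>Q)"
        unfolding \<gamma>_def gaussian_noise_def Q_def using G_sets
        by (intro nn_integral_shifted_gaussian_PiM_le s) auto
      also have "(\<integral>\<^sup>+ y. indicator (G w) y \<partial>Q) = emeasure Q (G w)"
        using G_sets sets_Q by simp
      also have "(\<Prod>t<n. ennreal (sqrt 2 * r / s * exp ((a w t)\<^sup>2 / (2 * r\<^sup>2)))) =
          ennreal ((sqrt 2 * r / s) ^ n * exp ((\<Sum>t<n. (a w t)\<^sup>2) / (2 * r\<^sup>2)))"
      proof -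
        have "(\<Prod>t<n. sqrt 2 * r / s * exp ((a w t)\<^sup>2 / (2 * r\<^sup>2))) =
            (sqrt 2 * r / s) ^ n * exp ((\<Sum>t<n. (a w t)\<^sup>2) / (2 * r\<^sup>2))"
          by (simp only: prod.distrib prod_constant card_lessThan sum_divide_distrib exp_sum finite_lessThan)
        then show ?thesis using r s by (subst prod_ennreal) auto
      qed
      also have "\<dots> \<le> ennreal B"
      proof (rule ennreal_leI)
        have "(\<Sum>t<n. (a w t)\<^sup>2) / (2 * r\<^sup>2) \<le> (real n * c * r\<^sup>2) / (2 * r\<^sup>2)"
          using pow[OF that] r by (intro divide_right_mono) (auto simp: a_def)
        also have "\<dots> = real n * (c / 2)" using r by simp
        finally have "exp ((\<Sum>t<n. (a w t)\<^sup>2) / (2 * r\<^sup>2)) \<le> exp (c / 2) ^ n"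
          by (simp add: exp_of_nat_mult[symmetric])
        then show "(sqrt 2 * r / s) ^ n * exp ((\<Sum>t<n. (a w t)\<^sup>2) / (2 * r\<^sup>2)) \<le> B"
          unfolding B_def power_mult_distrib using r s by (intro mult_left_mono) auto
      qed
      finally show ?thesis by (simp add: mult_right_mono)
    qed
    have disj: "disjoint_family_on G S"
      unfolding disjoint_family_on_def
    proof (intro ballI impI equals0I)
      fix w w' y assume w: "w \<in> S" "w' \<in> S" "w \<noteq> w'" and y: "y \<in> G w \<inter> G w'"
      let ?u = "\<lambda>w. \<lambda>t\<in>{..<n}. (y t - a w t) / s"
      have "w = w'"
      proof (rule decode_unique[where u = "?u w" and u' = "?u w'" and s = s])
        show "w \<in> message_families M N n R" "w' \<in> message_families M N n R" using w S by auto
        show "w j' i' = w' j' i'" if "j' < N" "i' < M" "j' \<noteq> j" "i' \<noteq> i" for j' i'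
          using agree w that by blast
        show "signal M h enc w \<kappa> j t / h (j, i, \<kappa> j) + s * ?u w t = signal M h enc w' \<kappa> j t / h (j, i, \<kappa> j) + s * ?u w' t"
          if "t < n" for t using that s by (simp add: a_def)
        show "decodes M h n enc dec \<kappa> w j' (mix n (s * h (j', i, \<kappa> j')) (\<beta> j') (?u w) v)"
          "decodes M h n enc dec \<kappa> w' j' (mix n (s * h (j', i, \<kappa> j')) (\<beta> j') (?u w') v)" if "j' < N" for j'
          using y that by (auto simp: G_def E_def all_decode_def)
      qed (use ji nz in auto)
      then show False using w by simp
    qed
    have "(\<Sum>w\<in>S. emeasure \<gamma> ((\<lambda>u. (u, v)) -` E w)) \<le> (\<Sum>w\<in>S. ennreal B * emeasure Q (G w))"
      by (intro sum_mono le)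
    also have "\<dots> = ennreal B * emeasure Q (\<Union>w\<in>S. G w)"
      using G_sets sets_Q S(1) disj by (subst sum_emeasure[symmetric]) (auto simp: sum_distrib_left)
    also have "\<dots> \<le> ennreal B * 1" by (intro mult_left_mono Q.emeasure_le_1) auto
    finally show ?thesis by simp
  qed
  have "ennreal (\<Sum>w\<in>S. measure (\<gamma> \<Otimes>\<^sub>M \<gamma>) (E w)) = (\<Sum>w\<in>S. emeasure (\<gamma> \<Otimes>\<^sub>M \<gamma>) (E w))"
    unfolding \<gamma>_def by (subst sum_ennreal[symmetric]) (auto simp: NN.emeasure_eq_measure)
  also have "\<dots> = (\<Sum>w\<in>S. \<integral>\<^sup>+ v. emeasure \<gamma> ((\<lambda>u. (u, v)) -` E w) \<partial>\<gamma>)"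
    unfolding \<gamma>_def by (intro sum.cong refl NN.emeasure_pair_measure_alt2 E_sets[unfolded \<gamma>_def])
  also have "\<dots> = (\<integral>\<^sup>+ v. (\<Sum>w\<in>S. emeasure \<gamma> ((\<lambda>u. (u, v)) -` E w)) \<partial>\<gamma>)"
    unfolding \<gamma>_def
    by (intro nn_integral_sum[symmetric] NN.measurable_emeasure_Pair2 E_sets[unfolded \<gamma>_def])
  also have "\<dots> \<le> (\<integral>\<^sup>+ v. ennreal B \<partial>\<gamma>)" by (intro nn_integral_mono fixed_v)
  also have "\<dots> = ennreal B" unfolding \<gamma>_def using N.emeasure_space_1 by simp
  finally show ?thesis using B0 by (simp add: \<gamma>_def E_def B_def)
qed

abbreviation msg_count :: "nat \<Rightarrow> (nat \<Rightarrow> nat \<Rightarrow> real) \<Rightarrow> nat \<Rightarrow> nat \<Rightarrow> nat" where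
  "msg_count n R j i \<equiv> nat \<lceil>2 powr (real n * R j i)\<rceil>"

lemma msg_count_pos: "0 < msg_count n R j i"
proof -
  have "0 < 2 powr (real n * R j i)" by simp
  then have "0 < \<lceil>2 powr (real n * R j i)\<rceil>" by (simp only: zero_less_ceiling)
  then show ?thesis by simp
qed

lemma finite_message_families: "finite (message_families M N n R)"
  unfolding message_families_def by (intro finite_PiE) auto

lemma card_message_families:
  "card (message_families M N n R) = (\<Prod>p\<in>{..<N} \<times> {..<M}. msg_count n R (fst p) (snd p))"
  unfolding message_families_def
  by (simp add: card_PiE prod.cartesian_product case_prod_beta)

lemma message_families_nonempty: "message_families M N n R \<noteq> {}"
proof -
  have "card (message_families M N n R) > 0"
    unfolding card_message_families using msg_count_pos by (intro prod_pos) auto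
  then show ?thesis by auto
qed

lemma expectation_message_pmf:
  fixes f :: "_ \<Rightarrow> real"
  shows "measure_pmf.expectation (message_pmf M N n R) f =
    (\<Sum>w\<in>message_families M N n R. f w) / card (message_families M N n R)"
  unfolding message_pmf_def
  by (rule integral_pmf_of_set[OF message_families_nonempty finite_message_families])

lemma error_prob_eq:
  "error_prob M N h n R enc dec \<kappa> j =
    (\<Sum>w\<in>message_families M N n R. measure (gaussian_noise n)
       {z \<in> space (gaussian_noise n). \<not> decodes M h n enc dec \<kappa> w j z}) / card (message_families M N n R)"
  unfolding error_prob_def expectation_message_pmf decodes_def by simp

text \<open>A union bound over the receivers; each mixed noise has the law of the original
  one.\<close>

lemma all_decode_prob_ge:
  assumes dec: "measurable_decoders M N J n dec" and \<kappa>: "\<kappa> \<in> realizations N J"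
    and \<alpha>\<beta>: "\<And>j. j < N \<Longrightarrow> \<alpha> j \<noteq> 0 \<and> \<beta> j \<noteq> 0 \<and> (\<alpha> j)\<^sup>2 + (\<beta> j)\<^sup>2 = 1"
  shows "1 - (\<Sum>j<N. measure (gaussian_noise n) {z \<in> space (gaussian_noise n). \<not> decodes M h n enc dec \<kappa> w j z})
    \<le> measure (gaussian_noise n \<Otimes>\<^sub>M gaussian_noise n) (all_decode M N h n enc dec \<kappa> \<alpha> \<beta> w)"
proof -
  interpret N: prob_space "gaussian_noise n" by (rule prob_space_gaussian_noise)
  interpret NN: pair_prob_space "gaussian_noise n" "gaussian_noise n" ..
  let ?\<Omega> = "gaussian_noise n \<Otimes>\<^sub>M gaussian_noise n"
  let ?A = "all_decode M N h n enc dec \<kappa> \<alpha> \<beta> w"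
  define F where "F j = {z \<in> space (gaussian_noise n). \<not> decodes M h n enc dec \<kappa> w j z}" for j
  define X where "X j = (\<lambda>\<omega>. mix n (\<alpha> j) (\<beta> j) (fst \<omega>) (snd \<omega>))" for j
  have X: "X j \<in> measurable ?\<Omega> (gaussian_noise n)" for j unfolding X_def by (rule measurable_mix_noise)
  have F: "F j \<in> sets (gaussian_noise n)" if "j < N" for j
    using decodes_measurable[OF dec \<kappa> that] unfolding F_def by measurable
  have meas: "measure ?\<Omega> (X j -` F j \<inter> space ?\<Omega>) = measure (gaussian_noise n) (F j)" if "j < N" for j
  proof -
    have "measure (gaussian_noise n) (F j) = measure (distr ?\<Omega> (gaussian_noise n) (X j)) (F j)"
      unfolding X_def using \<alpha>\<beta>[OF that] by (subst distr_gaussian_noise_mix) auto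
    also have "\<dots> = measure ?\<Omega> (X j -` F j \<inter> space ?\<Omega>)"
      by (rule measure_distr[OF X F[OF that]])
    finally show ?thesis by simp
  qed
  have "space ?\<Omega> - ?A \<subseteq> (\<Union>j<N. X j -` F j \<inter> space ?\<Omega>)"
  proof
    fix \<omega> assume \<omega>: "\<omega> \<in> space ?\<Omega> - ?A"
    then obtain j where j: "j < N" "\<not> decodes M h n enc dec \<kappa> w j (X j \<omega>)"
      by (auto simp: all_decode_def X_def)
    have "X j \<omega> \<in> space (gaussian_noise n)" using measurable_space[OF X] \<omega> by blast
    then show "\<omega> \<in> (\<Union>j<N. X j -` F j \<inter> space ?\<Omega>)" using j \<omega> by (auto simp: F_def)
  qed
  then have "measure ?\<Omega> (space ?\<Omega> - ?A) \<le> measure ?\<Omega> (\<Union>j<N. X j -` F j \<inter> space ?\<Omega>)"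
    using measurable_sets[OF X F] by (intro NN.finite_measure_mono sets.finite_UN) auto
  also have "\<dots> \<le> (\<Sum>j<N. measure ?\<Omega> (X j -` F j \<inter> space ?\<Omega>))"
    using measurable_sets[OF X F] by (intro NN.finite_measure_subadditive_finite) auto
  also have "\<dots> = (\<Sum>j<N. measure (gaussian_noise n) (F j))" by (intro sum.cong meas) auto
  also have "measure ?\<Omega> (space ?\<Omega> - ?A) = 1 - measure ?\<Omega> ?A"
    by (rule NN.prob_compl[OF all_decode_sets[OF dec \<kappa>]])
  finally show ?thesis by (simp add: F_def)
qed

section \<open>Cut bounds and their sum\<close>

definition cut_pairs :: "nat \<Rightarrow> nat \<Rightarrow> nat \<Rightarrow> nat \<Rightarrow> (nat \<times> nat) set" where
  "cut_pairs M N j i = {(j', i'). j' < N \<and> i' < M \<and> (j' = j \<or> i' = i)}"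

text \<open>The families are grouped by their messages outside the cut, and the packing bound is
  applied inside each group. Errors and power are controlled on average only: the error
  probabilities of all receivers cost a quarter of the success mass, families of excessive energy
  another quarter. The remaining half is the origin of the factor 2.\<close>

lemma cut_message_count_le:
  assumes dec: "measurable_decoders M N J n dec" and \<kappa>: "\<kappa> \<in> realizations N J"
    and power: "power_constraint M N n R P enc"
    and err: "\<And>j'. j' < N \<Longrightarrow> error_prob M N h n R enc dec \<kappa> j' \<le> 1 / (4 * real N)"
    and ji: "j < N" "i < M" and n: "n \<ge> 1" and P: "P \<ge> 1"
    and nz: "\<And>j'. j' < N \<Longrightarrow> h (j', i, \<kappa> j') \<noteq> 0"
    and s: "0 < s" "s \<le> 1" "\<And>j'. j' < N \<Longrightarrow> (s * h (j', i, \<kappa> j'))\<^sup>2 < 1"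
  defines "c \<equiv> real M * (\<Sum>i'<M. (h (j, i', \<kappa> j) / h (j, i, \<kappa> j))\<^sup>2)"
  shows "(\<Prod>p\<in>cut_pairs M N j i. real (msg_count n R (fst p) (snd p)))
    \<le> 2 * (sqrt 2 * sqrt P / s * exp (2 * c)) ^ n"
proof -
  define W where "W = message_families M N n R"
  have finW: "finite W" and W0: "card W > 0"
    using finite_message_families message_families_nonempty by (auto simp: W_def card_gt_0_iff)
  define a where "a w t = signal M h enc w \<kappa> j t / h (j, i, \<kappa> j)" for w t
  \<comment> \<open>Multiplying the observation with reduced noise \<open>s * u\<close> by the gain
    to \<open>j'\<close> produces exactly this share of \<open>u\<close>; \<open>\<beta>\<close>
    adds independent noise up to variance 1.\<close>
  define \<alpha> where "\<alpha> j' = s * h (j', i, \<kappa> j')" for j'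
  define \<beta> where "\<beta> j' = sqrt (1 - (\<alpha> j')\<^sup>2)" for j'
  define pok where "pok w = measure (gaussian_noise n \<Otimes>\<^sub>M gaussian_noise n) (all_decode M N h n enc dec \<kappa> \<alpha> \<beta> w)" for w
  define e where "e j' w = measure (gaussian_noise n) {z \<in> space (gaussian_noise n). \<not> decodes M h n enc dec \<kappa> w j' z}" for j' w
  \<comment> \<open>By Markov's inequality at most a quarter of the families violates this bound,
    since \<open>c * P\<close> bounds the average energy of \<open>a\<close> per channel
    use.\<close>
  define low where "low = {w \<in> W. (\<Sum>t<n. (a w t)\<^sup>2) \<le> real n * (4 * c) * (sqrt P)\<^sup>2}"
  define U where "U = ({..<N} - {j}) \<times> ({..<M} - {i})"
  define \<rho> where "\<rho> w = (\<lambda>p\<in>U. w (fst p) (snd p))" for w :: "nat \<Rightarrow> nat \<Rightarrow> nat"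
  define B where "B = (sqrt 2 * sqrt P / s * exp (4 * c / 2)) ^ n"
  have B0: "B > 0" using P s by (simp add: B_def)
  have finlow: "finite low" using finW by (simp add: low_def)
  have c1: "c > 0"
  proof -
    have "0 < (h (j, i, \<kappa> j) / h (j, i, \<kappa> j))\<^sup>2" using nz[OF ji(1)] by simp
    also have "\<dots> \<le> (\<Sum>i'<M. (h (j, i', \<kappa> j) / h (j, i, \<kappa> j))\<^sup>2)"
      using ji by (intro member_le_sum[of i]) auto
    finally show ?thesis unfolding c_def using ji by auto
  qed
  have \<alpha>\<beta>: "\<alpha> j' \<noteq> 0 \<and> \<beta> j' \<noteq> 0 \<and> (\<alpha> j')\<^sup>2 + (\<beta> j')\<^sup>2 = 1" if "j' < N" for j'
    using nz[OF that] s(1) s(3)[OF that] by (auto simp: \<alpha>_def \<beta>_def)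
  have pok_ge: "1 - (\<Sum>j'<N. e j' w) \<le> pok w" for w
    unfolding pok_def e_def by (rule all_decode_prob_ge[OF dec \<kappa> \<alpha>\<beta>])
  have e_sum: "(\<Sum>w\<in>W. e j' w) \<le> real (card W) / (4 * real N)" if "j' < N" for j'
    using err[OF that] W0 unfolding error_prob_eq W_def[symmetric] e_def[symmetric]
    by (simp add: field_simps)
  have a_sum: "(\<Sum>w\<in>W. \<Sum>t<n. (a w t)\<^sup>2) \<le> real (card W) * (real n * c * P)"
  proof -
    \<comment> \<open>Cauchy-Schwarz over the transmitters; this is the origin of
      \<open>c\<close>.\<close>
    have pt: "(a w t)\<^sup>2 \<le> real M * (\<Sum>i'<M. (h (j, i', \<kappa> j) / h (j, i, \<kappa> j))\<^sup>2 * (channel_input enc w i' t)\<^sup>2)" for w t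
    proof -
      have "a w t = (\<Sum>i'<M. h (j, i', \<kappa> j) / h (j, i, \<kappa> j) * channel_input enc w i' t)"
        unfolding a_def signal_def by (simp add: sum_divide_distrib)
      then have "(a w t)\<^sup>2 \<le> real (card {..<M}) * (\<Sum>i'<M. (h (j, i', \<kappa> j) / h (j, i, \<kappa> j) * channel_input enc w i' t)\<^sup>2)"
        using sum_squared_le_sum_of_squares[of "\<lambda>i'. h (j, i', \<kappa> j) / h (j, i, \<kappa> j) * channel_input enc w i' t" "{..<M}"]
        by (simp add: mult.commute)
      then show ?thesis by (simp add: power_mult_distrib power_divide)
    qed
    have x: "(\<Sum>w\<in>W. \<Sum>t<n. (channel_input enc w i' t)\<^sup>2) \<le> real (card W) * (real n * P)" if "i' < M" for i'
    proof -
      have "(\<Sum>w\<in>W. (\<Sum>t<n. (channel_input enc w i' t)\<^sup>2) / real n) / real (card W) \<le> P"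
        using power that unfolding power_constraint_def expectation_message_pmf W_def by blast
      then show ?thesis using W0 n by (simp add: sum_divide_distrib[symmetric] field_simps)
    qed
    have "(\<Sum>w\<in>W. \<Sum>t<n. (a w t)\<^sup>2) \<le> (\<Sum>w\<in>W. \<Sum>t<n. real M * (\<Sum>i'<M. (h (j, i', \<kappa> j) / h (j, i, \<kappa> j))\<^sup>2 * (channel_input enc w i' t)\<^sup>2))"
      by (intro sum_mono pt)
    also have "\<dots> = real M * (\<Sum>i'<M. (h (j, i', \<kappa> j) / h (j, i, \<kappa> j))\<^sup>2 * (\<Sum>w\<in>W. \<Sum>t<n. (channel_input enc w i' t)\<^sup>2))"
      unfolding sum_distrib_left by (subst sum.swap[of _ _ "{..<M}"], rule sum.cong[OF refl], rule sum.swap)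
    also have "\<dots> \<le> real M * (\<Sum>i'<M. (h (j, i', \<kappa> j) / h (j, i, \<kappa> j))\<^sup>2 * (real (card W) * (real n * P)))"
      using x by (intro mult_left_mono sum_mono) auto
    also have "\<dots> = real (card W) * (real n * c * P)"
      unfolding c_def by (subst sum_distrib_right[symmetric]) (simp only: mult_ac)
    finally show ?thesis .
  qed
  have low_card: "real (card low) \<ge> 3 / 4 * real (card W)"
  proof -
    have "real (card (W - low)) * (real n * (4 * c) * P) = (\<Sum>w\<in>W - low. real n * (4 * c) * P)" by simp
    also have "\<dots> \<le> (\<Sum>w\<in>W - low. \<Sum>t<n. (a w t)\<^sup>2)"
      using P by (intro sum_mono) (auto simp: low_def)
    also have "\<dots> \<le> (\<Sum>w\<in>W. \<Sum>t<n. (a w t)\<^sup>2)"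
      using finW by (intro sum_mono2) (auto intro: sum_nonneg)
    also note a_sum
    finally have "real (card (W - low)) * 4 * (real n * c * P) \<le> real (card W) * (real n * c * P)" by (simp add: mult_ac)
    moreover have "real n * c * P > 0" using n c1 P by simp
    ultimately have "real (card (W - low)) * 4 \<le> real (card W)" by (simp only: mult_le_cancel_right_pos)
    moreover have "card (W - low) = card W - card low" "card low \<le> card W"
      using finW by (auto simp: low_def card_Diff_subset intro: card_mono)
    ultimately show ?thesis by (simp add: of_nat_diff)
  qed
  have upper: "(\<Sum>w\<in>low. pok w) \<le> (\<Prod>p\<in>U. real (msg_count n R (fst p) (snd p))) * B"
  proof -
    have "(\<Sum>w\<in>low. pok w) = (\<Sum>d\<in>\<rho> ` low. \<Sum>w\<in>{w \<in> low. \<rho> w = d}. pok w)"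
      by (rule sum.image_gen[OF finlow])
    also have "\<dots> \<le> (\<Sum>d\<in>\<rho> ` low. B)"
    proof (rule sum_mono)
      fix d
      show "(\<Sum>w\<in>{w \<in> low. \<rho> w = d}. pok w) \<le> B"
        unfolding pok_def B_def \<alpha>_def
      proof (rule all_decode_sum_le[where h = h and j = j and i = i, OF dec \<kappa> ji nz[OF ji(1)] s(1)])
        show "s \<le> sqrt P" using s P by (meson order_trans real_sqrt_ge_1_iff)
        show "finite {w \<in> low. \<rho> w = d}" using finlow by simp
        show "{w \<in> low. \<rho> w = d} \<subseteq> message_families M N n R" by (auto simp: low_def W_def)
        show "w j' i' = w' j' i'" if "w \<in> {w \<in> low. \<rho> w = d}" "w' \<in> {w \<in> low. \<rho> w = d}"
          "j' < N" "i' < M" "j' \<noteq> j" "i' \<noteq> i" for w w' j' i'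
        proof -
          have "\<rho> w (j', i') = \<rho> w' (j', i')" using that by simp
          then show ?thesis using that by (simp add: \<rho>_def U_def)
        qed
        show "(\<Sum>t<n. (signal M h enc w \<kappa> j t / h (j, i, \<kappa> j))\<^sup>2) \<le> real n * (4 * c) * (sqrt P)\<^sup>2"
          if "w \<in> {w \<in> low. \<rho> w = d}" for w using that by (simp add: low_def a_def)
      qed
    qed
    also have "\<dots> = real (card (\<rho> ` low)) * B" by simp
    also have "\<dots> \<le> (\<Prod>p\<in>U. real (msg_count n R (fst p) (snd p))) * B"
    proof (rule mult_right_mono)
      have finU: "finite U" by (simp add: U_def)
      have "card (\<rho> ` low) \<le> card (\<Pi>\<^sub>E p\<in>U. {..<msg_count n R (fst p) (snd p)})"
      proof (rule card_mono)
        show "finite (\<Pi>\<^sub>E p\<in>U. {..<msg_count n R (fst p) (snd p)})" using finU by (intro finite_PiE) auto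
        have "\<rho> w \<in> (\<Pi>\<^sub>E p\<in>U. {..<msg_count n R (fst p) (snd p)})" if "w \<in> low" for w
        proof -
          have w: "w \<in> message_families M N n R" using that by (simp add: low_def W_def)
          have "w (fst p) (snd p) \<in> {..<msg_count n R (fst p) (snd p)}" if p: "p \<in> U" for p
          proof -
            have "fst p \<in> {..<N}" "snd p \<in> {..<M}" using p by (auto simp: U_def)
            then show ?thesis using PiE_mem[OF PiE_mem[OF w[unfolded message_families_def]]] by blast
          qed
          then show ?thesis unfolding \<rho>_def by (rule restrict_PiE_iff[THEN iffD2, OF ballI])
        qed
        then show "\<rho> ` low \<subseteq> (\<Pi>\<^sub>E p\<in>U. {..<msg_count n R (fst p) (snd p)})" by blast
      qed
      also have "\<dots> = (\<Prod>p\<in>U. msg_count n R (fst p) (snd p))" using finU by (simp add: card_PiE)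
      finally show "real (card (\<rho> ` low)) \<le> (\<Prod>p\<in>U. real (msg_count n R (fst p) (snd p)))"
        by (metis of_nat_le_iff of_nat_prod)
    qed (use B0 in simp)
    finally show ?thesis .
  qed
  have lower: "(\<Sum>w\<in>low. pok w) \<ge> 1 / 2 * real (card W)"
  proof -
    have "(\<Sum>w\<in>low. \<Sum>j'<N. e j' w) \<le> (\<Sum>w\<in>W. \<Sum>j'<N. e j' w)"
      using finW by (intro sum_mono2) (auto simp: low_def e_def intro!: sum_nonneg)
    also have "\<dots> = (\<Sum>j'<N. \<Sum>w\<in>W. e j' w)" by (rule sum.swap)
    also have "\<dots> \<le> (\<Sum>j'<N. real (card W) / (4 * real N))" using e_sum by (intro sum_mono) auto
    also have "\<dots> = real (card W) / 4" using ji by simp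
    finally have "real (card low) - real (card W) / 4 \<le> (\<Sum>w\<in>low. 1 - (\<Sum>j'<N. e j' w))"
      by (simp add: sum_subtractf)
    also have "\<dots> \<le> (\<Sum>w\<in>low. pok w)" by (intro sum_mono pok_ge)
    finally show ?thesis using low_card by simp
  qed
  let ?L = "\<lambda>p. real (msg_count n R (fst p) (snd p))"
  have U_cut: "{..<N} \<times> {..<M} = U \<union> cut_pairs M N j i" "U \<inter> cut_pairs M N j i = {}" "finite U" "finite (cut_pairs M N j i)"
    using ji by (auto simp: U_def cut_pairs_def intro: finite_subset[of _ "{..<N} \<times> {..<M}"])
  have cardW: "real (card W) = (\<Prod>p\<in>U. ?L p) * (\<Prod>p\<in>cut_pairs M N j i. ?L p)"
    unfolding W_def card_message_families U_cut(1) of_nat_prod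
    by (rule prod.union_disjoint[OF U_cut(3,4,2)])
  have "(\<Prod>p\<in>U. ?L p) > 0" using msg_count_pos by (intro prod_pos) auto
  moreover have "(\<Prod>p\<in>U. ?L p) * (\<Prod>p\<in>cut_pairs M N j i. ?L p) \<le> (\<Prod>p\<in>U. ?L p) * (2 * B)"
    using upper lower cardW by simp
  ultimately have "(\<Prod>p\<in>cut_pairs M N j i. ?L p) \<le> 2 * B" by (simp only: mult_le_cancel_left_pos)
  then show ?thesis by (simp add: B_def)
qed

text \<open>A code has to work for every realization, so a single one may be examined. The constants
  do not depend on the block length, hence one block length with moderately small error
  suffices.\<close>

lemma cut_rate_le:
  assumes J: "\<And>j. j < N \<Longrightarrow> J j \<ge> 1" and ji: "j < N" "i < M"
    and nz: "\<And>j'. j' < N \<Longrightarrow> h (j', i, 0) \<noteq> 0"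
  shows "\<exists>C. \<forall>P\<ge>1. \<forall>R. achievable M N J h P R \<longrightarrow>
           (\<Sum>p\<in>cut_pairs M N j i. R (fst p) (snd p)) \<le> 1 / 2 * log 2 P + C"
proof -
  define \<kappa> where "\<kappa> = (\<lambda>j\<in>{..<N}. 0::nat)"
  have \<kappa>: "\<kappa> \<in> realizations N J" using J by (force simp: \<kappa>_def realizations_def)
  have \<kappa>0: "\<kappa> j' = 0" if "j' < N" for j' using that by (simp add: \<kappa>_def)
  \<comment> \<open>Small enough that \<open>s * h (j', i, 0)\<close> has modulus below 1 at every
    receiver, so that the added noise has positive variance.\<close>
  define s where "s = 1 / (1 + (\<Sum>j'<N. \<bar>h (j', i, 0)\<bar>))"
  have sm: "0 \<le> (\<Sum>j'<N. \<bar>h (j', i, 0)\<bar>)" by (intro sum_nonneg) auto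
  have s: "0 < s" "s \<le> 1" unfolding s_def using sm by (simp_all add: add_pos_nonneg)
  have s2: "(s * h (j', i, 0))\<^sup>2 < 1" if "j' < N" for j'
  proof -
    have "\<bar>h (j', i, 0)\<bar> \<le> (\<Sum>j'<N. \<bar>h (j', i, 0)\<bar>)" using that by (intro member_le_sum) auto
    then have "\<bar>s * h (j', i, 0)\<bar> < 1" using sm by (simp add: s_def abs_mult divide_simps)
    then show ?thesis by (simp add: abs_square_less_1)
  qed
  define c where "c = real M * (\<Sum>i'<M. (h (j, i', 0) / h (j, i, 0))\<^sup>2)"
  define A where "A = sqrt 2 / s * exp (2 * c)"
  have A: "A > 0" using s by (simp add: A_def)
  have "(\<Sum>p\<in>cut_pairs M N j i. R (fst p) (snd p)) \<le> 1 / 2 * log 2 P + (1 + log 2 A)"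
    if P: "P \<ge> 1" and R: "achievable M N J h P R" for P R
  proof -
    have "\<exists>\<^sub>F n in sequentially. \<exists>enc dec. power_constraint M N n R P enc \<and> measurable_decoders M N J n dec \<and>
        (\<forall>\<kappa>\<in>realizations N J. \<forall>j<N. error_prob M N h n R enc dec \<kappa> j \<le> 1 / (4 * real N))"
      using R ji unfolding achievable_def by auto
    then obtain n enc dec where n: "n \<ge> 1" and code: "power_constraint M N n R P enc" "measurable_decoders M N J n dec"
        "\<And>j'. j' < N \<Longrightarrow> error_prob M N h n R enc dec \<kappa> j' \<le> 1 / (4 * real N)"
      unfolding frequently_sequentially using \<kappa> by blast
    have "(\<Prod>p\<in>cut_pairs M N j i. real (msg_count n R (fst p) (snd p))) \<le> 2 * (sqrt 2 * sqrt P / s * exp (2 * c)) ^ n"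
      using cut_message_count_le[OF code(2) \<kappa> code(1,3) ji n P _ s] nz s2 ji
      by (simp add: \<kappa>0 c_def)
    also have "sqrt 2 * sqrt P / s * exp (2 * c) = A * sqrt P" by (simp add: A_def)
    finally have le: "(\<Prod>p\<in>cut_pairs M N j i. real (msg_count n R (fst p) (snd p))) \<le> 2 * (A * sqrt P) ^ n" .
    have "2 powr (real n * (\<Sum>p\<in>cut_pairs M N j i. R (fst p) (snd p))) = (\<Prod>p\<in>cut_pairs M N j i. 2 powr (real n * R (fst p) (snd p)))"
      by (simp add: sum_distrib_left powr_sum)
    also have "\<dots> \<le> (\<Prod>p\<in>cut_pairs M N j i. real (msg_count n R (fst p) (snd p)))"
      by (intro prod_mono) (auto simp: of_nat_ceiling)
    also note le
    finally have "2 powr (real n * (\<Sum>p\<in>cut_pairs M N j i. R (fst p) (snd p))) \<le> 2 * (A * sqrt P) ^ n" .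
    then have "log 2 (2 powr (real n * (\<Sum>p\<in>cut_pairs M N j i. R (fst p) (snd p)))) \<le> log 2 (2 * (A * sqrt P) ^ n)"
      using A P by (subst log_le_cancel_iff) auto
    then have "real n * (\<Sum>p\<in>cut_pairs M N j i. R (fst p) (snd p)) \<le> 1 + real n * (log 2 A + 1 / 2 * log 2 P)"
      using A P by (simp add: log_mult log_nat_power log_powr sqrt_def[symmetric] powr_half_sqrt[symmetric])
    \<comment> \<open>The single bit from the factor 2 is charged as one bit per channel
      use.\<close>
    also have "\<dots> \<le> real n * (1 / 2 * log 2 P + (1 + log 2 A))" using n by (simp add: algebra_simps)
    finally show ?thesis using n by simp
  qed
  then show ?thesis by blast
qed

lemma sum_rate_le:
  assumes MN: "M \<ge> 1" "N \<ge> 1" and J: "\<And>j. j < N \<Longrightarrow> J j \<ge> 1"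
    and nz: "\<And>j i. j < N \<Longrightarrow> i < M \<Longrightarrow> h (j, i, 0) \<noteq> 0"
  shows "\<exists>C. \<forall>P\<ge>1. \<forall>R. achievable M N J h P R \<longrightarrow>
           (\<Sum>j<N. \<Sum>i<M. R j i) \<le> real M * real N / (real M + real N - 1) * (1 / 2 * log 2 P + C)"
proof -
  have "\<forall>j\<in>{..<N}. \<forall>i\<in>{..<M}. \<exists>C. \<forall>P\<ge>1. \<forall>R. achievable M N J h P R \<longrightarrow>
           (\<Sum>p\<in>cut_pairs M N j i. R (fst p) (snd p)) \<le> 1 / 2 * log 2 P + C"
  proof (intro ballI)
    fix j i assume "j \<in> {..<N}" "i \<in> {..<M}"
    then show "\<exists>C. \<forall>P\<ge>1. \<forall>R. achievable M N J h P R \<longrightarrow>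
           (\<Sum>p\<in>cut_pairs M N j i. R (fst p) (snd p)) \<le> 1 / 2 * log 2 P + C"
      using J nz by (intro cut_rate_le) auto
  qed
  then obtain C where C: "\<And>j i P R. j < N \<Longrightarrow> i < M \<Longrightarrow> P \<ge> 1 \<Longrightarrow> achievable M N J h P R \<Longrightarrow>
           (\<Sum>p\<in>cut_pairs M N j i. R (fst p) (snd p)) \<le> 1 / 2 * log 2 P + C j i"
    by (metis lessThan_iff)
  define C' where "C' = (\<Sum>j<N. \<Sum>i<M. \<bar>C j i\<bar>)"
  have C_le: "C j i \<le> C'" if "j < N" "i < M" for j i
  proof -
    have "\<bar>C j i\<bar> \<le> (\<Sum>i<M. \<bar>C j i\<bar>)" using that by (intro member_le_sum) auto
    also have "\<dots> \<le> C'" unfolding C'_def using that by (intro member_le_sum[of j]) (auto intro: sum_nonneg)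
    finally show ?thesis by simp
  qed
  have "(\<Sum>j<N. \<Sum>i<M. R j i) \<le> real M * real N / (real M + real N - 1) * (1 / 2 * log 2 P + C')"
    if P: "P \<ge> 1" and R: "achievable M N J h P R" for P R
  proof -
    have cut_sum: "(\<Sum>p\<in>cut_pairs M N j i. R (fst p) (snd p)) = (\<Sum>i'<M. R j i') + (\<Sum>j'<N. R j' i) - R j i"
      if ji: "j < N" "i < M" for j i
    proof -
      have "cut_pairs M N j i = {j} \<times> {..<M} \<union> ({..<N} - {j}) \<times> {i}" using ji by (auto simp: cut_pairs_def)
      then have "(\<Sum>p\<in>cut_pairs M N j i. R (fst p) (snd p)) =
          (\<Sum>p\<in>{j} \<times> {..<M}. R (fst p) (snd p)) + (\<Sum>p\<in>({..<N} - {j}) \<times> {i}. R (fst p) (snd p))"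
        by (simp only:) (rule sum.union_disjoint, auto)
      also have "(\<Sum>p\<in>{j} \<times> {..<M}. R (fst p) (snd p)) = (\<Sum>i'<M. R j i')"
        by (simp add: sum.cartesian_product')
      also have "(\<Sum>p\<in>({..<N} - {j}) \<times> {i}. R (fst p) (snd p)) = (\<Sum>j'\<in>{..<N} - {j}. R j' i)"
        by (simp add: sum.cartesian_product')
      also have "\<dots> = (\<Sum>j'<N. R j' i) - R j i" using ji by (simp add: sum_diff1)
      finally show ?thesis by simp
    qed
    let ?S = "\<Sum>j<N. \<Sum>i<M. R j i"
    have "(\<Sum>j<N. \<Sum>i<M. (\<Sum>i'<M. R j i') + (\<Sum>j'<N. R j' i) - R j i) = (real M + real N - 1) * ?S"
    proof -
      have "(\<Sum>j<N. \<Sum>i<M. \<Sum>i'<M. R j i') = real M * ?S" by (simp add: sum_distrib_left)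
      moreover have "(\<Sum>j<N. \<Sum>i<M. \<Sum>j'<N. R j' i) = real N * ?S"
        by (simp add: sum.swap[of _ "{..<N}" "{..<M}"])
      ultimately show ?thesis by (simp add: sum.distrib sum_subtractf algebra_simps)
    qed
    moreover have "(\<Sum>j<N. \<Sum>i<M. (\<Sum>i'<M. R j i') + (\<Sum>j'<N. R j' i) - R j i) \<le> (\<Sum>j<N. \<Sum>i<M. 1 / 2 * log 2 P + C')"
    proof (intro sum_mono)
      fix j i assume "j \<in> {..<N}" "i \<in> {..<M}"
      then show "(\<Sum>i'<M. R j i') + (\<Sum>j'<N. R j' i) - R j i \<le> 1 / 2 * log 2 P + C'"
        using C[OF _ _ P R, of j i] C_le[of j i] cut_sum[of j i] by simp
    qed
    ultimately have "(real M + real N - 1) * ?S \<le> real M * real N * (1 / 2 * log 2 P + C')" by (simp add: mult_ac)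
    then show ?thesis using MN by (simp add: field_simps)
  qed
  then show ?thesis by blast
qed

subsection \<open>Achievability from a separated constellation\<close>

text \<open>Messages are natural numbers, so the code is enumerated; the separation has the form
  that the uniqueness argument of the decoder uses.\<close>

lemma gilbert_varshamov_enum:
  assumes "q \<ge> 1"
  obtains K :: nat and cw :: "nat \<Rightarrow> nat \<Rightarrow> nat"
  where "\<And>\<mu> t. \<mu> < K \<Longrightarrow> t < n \<Longrightarrow> cw \<mu> t < q"
    and "\<And>\<mu> \<nu>. \<mu> < K \<Longrightarrow> \<nu> < K \<Longrightarrow> hamming n (cw \<mu>) (cw \<nu>) \<le> d \<Longrightarrow> \<mu> = \<nu>"
    and "q ^ n \<le> K * (2 ^ n * q ^ d)"
proof -
  have "finite {..<q}" "{..<q} \<noteq> {}" using assms by (auto simp: lessThan_empty_iff)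
  from gilbert_varshamov[OF this, where n = n and d = d] obtain C
    where C: "C \<subseteq> {..<n} \<rightarrow>\<^sub>E {..<q}" "\<And>x y. x \<in> C \<Longrightarrow> y \<in> C \<Longrightarrow> x \<noteq> y \<Longrightarrow> d < hamming n x y"
      "card {..<q} ^ n \<le> card C * (2 ^ n * card {..<q} ^ d)" by blast
  have "finite C" using C(1) by (rule finite_subset) (auto intro: finite_PiE)
  then obtain cw where cw: "bij_betw cw {..<card C} C"
    using ex_bij_betw_nat_finite by (metis lessThan_atLeast0)
  show thesis
  proof (rule that[of "card C" cw])
    fix \<mu> t assume "\<mu> < card C" "t < n"
    then have "cw \<mu> \<in> {..<n} \<rightarrow>\<^sub>E {..<q}" using cw C(1) by (auto simp: bij_betw_def)
    then show "cw \<mu> t < q" using \<open>t < n\<close> by auto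
  next
    fix \<mu> \<nu> assume \<mu>: "\<mu> < card C" "\<nu> < card C" "hamming n (cw \<mu>) (cw \<nu>) \<le> d"
    then have "cw \<mu> = cw \<nu>" using C(2) bij_betwE[OF cw] by (metis lessThan_iff not_le)
    then show "\<mu> = \<nu>" using \<mu> cw by (auto simp: bij_betw_def inj_on_def)
  qed (use C(3) in simp)
qed

text \<open>\<open>amp j'\<close> depends on the destination of a symbol and not on its transmitter:
  interference can align because all transmitters modulate in the same way.\<close>

definition noiseless ::
    "nat \<Rightarrow> nat \<Rightarrow> (nat \<times> nat \<times> nat \<Rightarrow> real) \<Rightarrow> (nat \<Rightarrow> nat \<Rightarrow> real) \<Rightarrow> nat \<Rightarrow> nat \<Rightarrow> (nat \<Rightarrow> nat \<Rightarrow> nat) \<Rightarrow> real" where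
  "noiseless M N h amp j k \<sigma> = (\<Sum>i<M. h (j, i, k) * (\<Sum>j'<N. amp j' (\<sigma> j' i)))"

text \<open>Only the desired symbol is decided. The other symbols are quantified away, as aligned
  interference cannot be resolved. A minimum distance of \<open>2 * T\<close> makes the regions for
  different \<open>a\<close> disjoint.\<close>

definition decision_region ::
    "nat \<Rightarrow> nat \<Rightarrow> (nat \<times> nat \<times> nat \<Rightarrow> real) \<Rightarrow> (nat \<Rightarrow> nat \<Rightarrow> real) \<Rightarrow> nat \<Rightarrow> real \<Rightarrow> nat \<Rightarrow> nat \<Rightarrow> nat \<Rightarrow> nat \<Rightarrow> real set" where
  "decision_region M N h amp q T j k i a =
     {y. \<exists>\<sigma>. (\<forall>j'<N. \<forall>i'<M. \<sigma> j' i' < q) \<and> \<sigma> j i = a \<and> \<bar>y - noiseless M N h amp j k \<sigma>\<bar> < T}"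

lemma decision_region_borel: "decision_region M N h amp q T j k i a \<in> sets borel"
proof -
  have "decision_region M N h amp q T j k i a =
      (\<Union>\<sigma>\<in>{\<sigma>. (\<forall>j'<N. \<forall>i'<M. \<sigma> j' i' < q) \<and> \<sigma> j i = a}. ball (noiseless M N h amp j k \<sigma>) T)"
    unfolding decision_region_def ball_def dist_real_def
    by (simp add: set_eq_iff abs_minus_commute)
  then show ?thesis by (auto intro!: borel_open)
qed

text \<open>
  Hard decisions per channel use, followed by an outer code that corrects the decisions spoiled
  by noise above the threshold \<open>T\<close>.
\<close>

lemma coded_achievable:
  fixes amp :: "nat \<Rightarrow> nat \<Rightarrow> real" and q b :: nat
  assumes q: "q \<ge> 1" and b: "b \<ge> 1"
    and peak: "\<And>\<sigma>. (\<And>j. j < N \<Longrightarrow> \<sigma> j < q) \<Longrightarrow> (\<Sum>j<N. amp j (\<sigma> j))\<^sup>2 \<le> P"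
    and sep: "\<And>j k \<sigma> \<sigma>' i. j < N \<Longrightarrow> k < J j \<Longrightarrow> i < M \<Longrightarrow>
        (\<And>j' i'. j' < N \<Longrightarrow> i' < M \<Longrightarrow> \<sigma> j' i' < q) \<Longrightarrow> (\<And>j' i'. j' < N \<Longrightarrow> i' < M \<Longrightarrow> \<sigma>' j' i' < q) \<Longrightarrow>
        \<sigma> j i \<noteq> \<sigma>' j i \<Longrightarrow> 2 * T \<le> \<bar>noiseless M N h amp j k \<sigma> - noiseless M N h amp j k \<sigma>'\<bar>"
    and tail: "measure std_gaussian {x. T \<le> \<bar>x\<bar>} \<le> (1 / 4) ^ b"
    and r: "0 \<le> r" "r \<le> (1 - 2 / real b) * log 2 (real q) - 1"
  shows "achievable M N J h P (\<lambda>j i. r)"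
  unfolding achievable_def
proof (intro conjI allI impI)
  fix \<epsilon> :: real assume \<epsilon>: "\<epsilon> > 0"
  have "\<forall>\<^sub>F n in sequentially. (1 / 2) ^ n < \<epsilon>"
    using order_tendstoD(2)[OF LIMSEQ_realpow_zero[of "1 / 2 :: real"] \<epsilon>] by simp
  then have "\<forall>\<^sub>F n in sequentially. (1 / 2) ^ n < \<epsilon> \<and> 1 \<le> n"
    using eventually_ge_at_top[of 1] by eventually_elim auto
  then have "\<forall>\<^sub>F n in sequentially. \<exists>enc dec. power_constraint M N n (\<lambda>j i. r) P enc \<and>
      measurable_decoders M N J n dec \<and>
      (\<forall>\<kappa>\<in>realizations N J. \<forall>j<N. error_prob M N h n (\<lambda>j i. r) enc dec \<kappa> j \<le> \<epsilon>)"
  proof eventually_elim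
    case (elim n)
    then have n: "n \<ge> 1" and n\<epsilon>: "(1 / 2) ^ n \<le> \<epsilon>" by auto
    \<comment> \<open>The outer code corrects a fraction \<open>1 / b\<close> of spoiled symbols,
      which needs a distance above \<open>2 * r0\<close> and costs the rate factor
      \<open>1 - 2 / real b\<close>. The 1 subtracted in the rate is the \<open>2 ^ n\<close> of the
      covering bound.\<close>
    define r0 where "r0 = n div b"
    obtain K cw where cw: "\<And>\<mu> t. \<mu> < K \<Longrightarrow> t < n \<Longrightarrow> cw \<mu> t < q"
      and cw_inj: "\<And>\<mu> \<nu>. \<mu> < K \<Longrightarrow> \<nu> < K \<Longrightarrow> hamming n (cw \<mu>) (cw \<nu>) \<le> 2 * r0 \<Longrightarrow> \<mu> = \<nu>"
      and K: "q ^ n \<le> K * (2 ^ n * q ^ (2 * r0))"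
      using gilbert_varshamov_enum[OF q] by blast
    have count: "msg_count n (\<lambda>j i. r) j i \<le> K" for j i
    proof -
      have q0: "real q > 0" using q by simp
      have r0_le: "real (2 * r0) \<le> 2 * real n / real b"
      proof -
        have "real (r0 * b) \<le> real n"
          unfolding r0_def of_nat_le_iff by (rule div_times_less_eq_dividend)
        then show ?thesis using b by (simp add: field_simps)
      qed
      have "real n * r \<le> real n * ((1 - 2 / real b) * log 2 (real q) - 1)"
        using r by (intro mult_left_mono) auto
      also have "\<dots> = (real n - 2 * real n / real b) * log 2 (real q) - real n"
        by (simp add: algebra_simps)
      also have "\<dots> \<le> (real n - real (2 * r0)) * log 2 (real q) - real n"
        using r0_le q by (intro diff_right_mono mult_right_mono) auto
      finally have "2 powr (real n * r) \<le> 2 powr ((real n - real (2 * r0)) * log 2 (real q) - real n)"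
        by simp
      also have "\<dots> = real q ^ n / (2 ^ n * real q ^ (2 * r0))"
      proof -
        have "2 powr ((real n - real (2 * r0)) * log 2 (real q) - real n) =
            2 powr (log 2 (real q) * real n) / (2 powr (log 2 (real q) * real (2 * r0)) * 2 powr real n)"
          by (simp add: powr_diff[symmetric] powr_add[symmetric] algebra_simps)
        also have "\<dots> = real q powr real n / (real q powr real (2 * r0) * 2 powr real n)"
          using q0 by (simp only: powr_powr[symmetric]) simp
        also have "\<dots> = real q ^ n / (2 ^ n * real q ^ (2 * r0))"
          using q0 by (simp only: powr_realpow) (simp add: mult.commute)
        finally show ?thesis .
      qed
      also have "\<dots> \<le> real K"
      proof -
        have "real (q ^ n) \<le> real (K * (2 ^ n * q ^ (2 * r0)))" using K of_nat_le_iff by blast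
        then have "real q ^ n \<le> real K * (2 ^ n * real q ^ (2 * r0))" by simp
        then show ?thesis using q0 by (simp add: divide_le_eq)
      qed
      finally have "\<lceil>2 powr (real n * r)\<rceil> \<le> int K" by (simp add: ceiling_le_iff)
      then show ?thesis by (simp only: nat_le_iff)
    qed
    define enc :: encoders where "enc i f t = (\<Sum>j'<N. amp j' (cw (f j') t))" for i f t
    define Rg where "Rg = decision_region M N h amp q T"
    \<comment> \<open>Bounded-distance decoding, where a position counts as a mismatch if the
      received value lies outside the region of the candidate's letter. Taking the least candidate
      keeps the decoder measurable.\<close>
    define dec :: decoders where
      "dec j \<kappa> y i = (LEAST \<mu>. \<mu> < K \<and> card {t. t < n \<and> y t \<notin> Rg j (\<kappa> j) i (cw \<mu> t)} \<le> r0)" for j \<kappa> y i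
    have msg: "w j i < K" if "w \<in> message_families M N n (\<lambda>j i. r)" "j < N" "i < M" for w j i
    proof -
      have "w j i < msg_count n (\<lambda>j i. r) j i"
        using PiE_mem[OF PiE_mem[OF that(1)[unfolded message_families_def]]] that by auto
      then show ?thesis using count by (rule less_le_trans)
    qed
    have "power_constraint M N n (\<lambda>j i. r) P enc"
      unfolding power_constraint_def expectation_message_pmf
    proof (intro allI impI)
      fix i assume i: "i < M"
      let ?W = "message_families M N n (\<lambda>j i. r)"
      have W0: "card ?W > 0"
        using finite_message_families message_families_nonempty by (auto simp: card_gt_0_iff)
      have "(\<Sum>t<n. (channel_input enc w i t)\<^sup>2) / real n \<le> P" if w: "w \<in> ?W" for w
      proof -
        have "(channel_input enc w i t)\<^sup>2 \<le> P" if "t < n" for t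
          unfolding channel_input_def enc_def using msg[OF w _ i] cw that by (intro peak) auto
        then have "(\<Sum>t<n. (channel_input enc w i t)\<^sup>2) \<le> (\<Sum>t<n. P)" by (intro sum_mono) auto
        then show ?thesis using n by (simp add: divide_le_eq mult.commute)
      qed
      then have "(\<Sum>w\<in>?W. (\<Sum>t<n. (channel_input enc w i t)\<^sup>2) / real n) \<le> (\<Sum>w\<in>?W. P)"
        by (intro sum_mono) auto
      then show "(\<Sum>w\<in>?W. (\<Sum>t<n. (channel_input enc w i t)\<^sup>2) / real n) / real (card ?W) \<le> P"
        using W0 by (simp add: divide_le_eq mult.commute)
    qed
    moreover have "measurable_decoders M N J n dec"
      unfolding measurable_decoders_def
    proof (intro ballI allI impI)
      fix \<kappa> j i
      have Rg_borel [measurable]: "Rg j' k' i' a' \<in> sets borel" for j' k' i' a'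
        unfolding Rg_def by (rule decision_region_borel)
      have "Measurable.pred (Pi\<^sub>M {..<n} (\<lambda>_. borel)) (\<lambda>y. t < n \<and> y t \<notin> Rg j (\<kappa> j) i (cw \<mu> t))" for \<mu> t
      proof (cases "t < n")
        case True
        then have [measurable]: "(\<lambda>y. y t) \<in> measurable (Pi\<^sub>M {..<n} (\<lambda>_. borel)) (borel :: real measure)"
          by (intro measurable_component_singleton) simp
        show ?thesis by measurable
      qed simp
      then have [measurable]: "(\<lambda>y. card {t. t < n \<and> y t \<notin> Rg j (\<kappa> j) i (cw \<mu> t)}) \<in> measurable (Pi\<^sub>M {..<n} (\<lambda>_. borel)) (count_space UNIV)" for \<mu>
        by (intro measurable_card) (auto simp: pred_def)
      show "(\<lambda>y. dec j \<kappa> y i) \<in> measurable (Pi\<^sub>M {..<n} (\<lambda>_. borel)) (count_space UNIV)"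
        unfolding dec_def by measurable
    qed
    moreover have "error_prob M N h n (\<lambda>j i. r) enc dec \<kappa> j \<le> \<epsilon>"
      if \<kappa>: "\<kappa> \<in> realizations N J" and j: "j < N" for \<kappa> j
    proof -
      let ?W = "message_families M N n (\<lambda>j i. r)"
      let ?bad = "\<lambda>z :: nat \<Rightarrow> real. {t. t < n \<and> T \<le> \<bar>z t\<bar>}"
      interpret Nz: prob_space "gaussian_noise n" by (rule prob_space_gaussian_noise)
      have kj: "\<kappa> j < J j" using \<kappa> j by (auto simp: realizations_def)
      have good: "decodes M h n enc dec \<kappa> w j z" if w: "w \<in> ?W" and z: "card (?bad z) \<le> r0" for w z
        unfolding decodes_def
      proof (intro allI impI)
        fix i assume i: "i < M"
        define y where "y = channel_output M h n enc w \<kappa> j z"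
        define \<sigma> where "\<sigma> t j' i' = cw (w j' i') t" for t j' i'
        have \<sigma>q: "\<sigma> t j' i' < q" if "t < n" "j' < N" "i' < M" for t j' i'
          unfolding \<sigma>_def using msg[OF w] cw that by auto
        have y: "y t = noiseless M N h amp j (\<kappa> j) (\<sigma> t) + z t" if "t < n" for t
          using that unfolding y_def channel_output_def noiseless_def channel_input_def enc_def \<sigma>_def by simp
        have near: "y t \<in> Rg j (\<kappa> j) i (cw (w j i) t)" if "t < n" "\<bar>z t\<bar> < T" for t
          unfolding Rg_def decision_region_def
          using that \<sigma>q[OF that(1)] y[OF that(1)] by (auto intro!: exI[of _ "\<sigma> t"] simp: \<sigma>_def)
        have true_ok: "card {t. t < n \<and> y t \<notin> Rg j (\<kappa> j) i (cw (w j i) t)} \<le> r0"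
        proof (rule order_trans[OF card_mono z])
          show "{t. t < n \<and> y t \<notin> Rg j (\<kappa> j) i (cw (w j i) t)} \<subseteq> ?bad z"
            using near by (auto simp: not_le[symmetric])
        qed simp
        have unique: "\<mu> = w j i" if \<mu>: "\<mu> < K" "card {t. t < n \<and> y t \<notin> Rg j (\<kappa> j) i (cw \<mu> t)} \<le> r0" for \<mu>
        proof (rule cw_inj[OF \<mu>(1) msg[OF w j i]])
          \<comment> \<open>Where the codewords differ, a symbol with noise below \<open>T\<close>
            cannot lie in the regions of both letters, by \<open>sep\<close>. So each such position
            is spoiled by noise or is a mismatch of \<open>\<mu>\<close>, with at most
            \<open>r0\<close> positions of either kind.\<close>
          have "{t. t < n \<and> cw \<mu> t \<noteq> cw (w j i) t} \<subseteq> ?bad z \<union> {t. t < n \<and> y t \<notin> Rg j (\<kappa> j) i (cw \<mu> t)}"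
          proof (intro subsetI, rule ccontr)
            fix t assume t: "t \<in> {t. t < n \<and> cw \<mu> t \<noteq> cw (w j i) t}"
              "t \<notin> ?bad z \<union> {t. t < n \<and> y t \<notin> Rg j (\<kappa> j) i (cw \<mu> t)}"
            then have tn: "t < n" and zt: "\<bar>z t\<bar> < T" and yt: "y t \<in> Rg j (\<kappa> j) i (cw \<mu> t)" by auto
            obtain \<sigma>' where \<sigma>': "\<And>j' i'. j' < N \<Longrightarrow> i' < M \<Longrightarrow> \<sigma>' j' i' < q" "\<sigma>' j i = cw \<mu> t"
              "\<bar>y t - noiseless M N h amp j (\<kappa> j) \<sigma>'\<bar> < T"
              using yt unfolding Rg_def decision_region_def by blast
            have "\<sigma> t j i \<noteq> \<sigma>' j i" using t \<sigma>'(2) by (auto simp: \<sigma>_def)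
            then have "2 * T \<le> \<bar>noiseless M N h amp j (\<kappa> j) (\<sigma> t) - noiseless M N h amp j (\<kappa> j) \<sigma>'\<bar>"
              using \<sigma>q[OF tn] \<sigma>'(1) by (intro sep[OF j kj i]) auto
            then show False using \<sigma>'(3) zt y[OF tn] by linarith
          qed
          then have "hamming n (cw \<mu>) (cw (w j i)) \<le> card (?bad z \<union> {t. t < n \<and> y t \<notin> Rg j (\<kappa> j) i (cw \<mu> t)})"
            unfolding hamming_def by (intro card_mono) auto
          also have "\<dots> \<le> card (?bad z) + card {t. t < n \<and> y t \<notin> Rg j (\<kappa> j) i (cw \<mu> t)}"
            by (rule card_Un_le)
          finally show "hamming n (cw \<mu>) (cw (w j i)) \<le> 2 * r0" using z \<mu>(2) by linarith
        qed
        have "dec j \<kappa> y i = w j i" unfolding dec_def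
        proof (rule Least_equality)
          fix \<mu> assume "\<mu> < K \<and> card {t. t < n \<and> y t \<notin> Rg j (\<kappa> j) i (cw \<mu> t)} \<le> r0"
          then show "w j i \<le> \<mu>" using unique by blast
        qed (use true_ok msg[OF w j i] in simp)
        then show "dec j \<kappa> (channel_output M h n enc w \<kappa> j z) i = w j i" by (simp add: y_def)
      qed
      have small: "measure (gaussian_noise n) {z \<in> space (gaussian_noise n). \<not> decodes M h n enc dec \<kappa> w j z} \<le> \<epsilon>"
        if w: "w \<in> ?W" for w
      proof -
        have "Measurable.pred (gaussian_noise n) (\<lambda>z. t < n \<and> T \<le> \<bar>z t\<bar>)" for t
        proof (cases "t < n")
          case True
          then have [measurable]: "(\<lambda>z. z t) \<in> measurable (gaussian_noise n) (borel :: real measure)"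
            unfolding measurable_cong_sets[OF sets_gaussian_noise refl]
            by (intro measurable_component_singleton) simp
          show ?thesis by measurable
        qed simp
        then have [measurable]: "(\<lambda>z. card (?bad z)) \<in> measurable (gaussian_noise n) (count_space UNIV)"
          by (intro measurable_card) (auto simp: pred_def)
        have "measure (gaussian_noise n) {z \<in> space (gaussian_noise n). \<not> decodes M h n enc dec \<kappa> w j z}
            \<le> measure (gaussian_noise n) {z \<in> space (gaussian_noise n). Suc r0 \<le> card (?bad z)}"
          using good[OF w] by (intro Nz.finite_measure_mono) (auto simp: not_less_eq_eq[symmetric])
        also have "\<dots> \<le> 2 ^ n * measure std_gaussian {x. T \<le> \<bar>x\<bar>} ^ Suc r0"
          by (rule gaussian_noise_many_large)
        also have "\<dots> \<le> 2 ^ n * ((1 / 4) ^ b) ^ Suc r0"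
          using tail by (intro mult_left_mono power_mono) auto
        also have "\<dots> = 2 ^ n * (1 / 4) ^ (b * Suc r0)" by (simp only: power_mult)
        also have "\<dots> \<le> 2 ^ n * (1 / 4) ^ n"
        proof (intro mult_left_mono power_decreasing)
          \<comment> \<open>A decoding error needs \<open>Suc r0\<close> spoiled symbols, and
            \<open>b * Suc r0 > n\<close> turns the tail bound into \<open>(1 / 4) ^ n\<close>,
            which beats the \<open>2 ^ n\<close> sets of positions.\<close>
          have "n < b + n div b * b" by (rule dividend_less_div_times) (use b in simp)
          then show "n \<le> b * Suc r0" unfolding r0_def by (simp add: mult.commute)
        qed auto
        also have "\<dots> = (1 / 2 :: real) ^ n" by (simp add: power_mult_distrib[symmetric])
        finally show ?thesis using n\<epsilon> by linarith
      qed
      have W0: "card ?W > 0"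
        using finite_message_families message_families_nonempty by (auto simp: card_gt_0_iff)
      have "(\<Sum>w\<in>?W. measure (gaussian_noise n) {z \<in> space (gaussian_noise n). \<not> decodes M h n enc dec \<kappa> w j z}) \<le> (\<Sum>w\<in>?W. \<epsilon>)"
        by (intro sum_mono small)
      then show ?thesis unfolding error_prob_eq using W0 by (simp add: divide_le_eq mult.commute)
    qed
    ultimately show ?case by blast
  qed
  then show "\<exists>\<^sub>F n in sequentially. \<exists>enc dec. power_constraint M N n (\<lambda>j i. r) P enc \<and>
      measurable_decoders M N J n dec \<and>
      (\<forall>\<kappa>\<in>realizations N J. \<forall>j<N. error_prob M N h n (\<lambda>j i. r) enc dec \<kappa> j \<le> \<epsilon>)"
    by (rule eventually_frequently[rotated]) simp
qed (use r in simp)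

subsection \<open>Aligned constellations\<close>

lemma finite_coeff_index: "finite (coeff_index M N J)"
proof (rule finite_subset)
  show "coeff_index M N J \<subseteq> (SIGMA j:{..<N}. {..<M} \<times> {..<J j})" by (auto simp: coeff_index_def)
qed auto

text \<open>Coefficients given on a subset are extended by 0. This is the quantitative form of the
  independence of distinct monomials over the integers.\<close>

lemma dioph_bound_subset:
  assumes lb: "dioph_bound I D C n h" and I: "finite I" and X: "X \<subseteq> exponents I D" and Q: "Q \<ge> 1"
    and b: "\<And>e. e \<in> X \<Longrightarrow> \<bar>b e\<bar> \<le> int Q" and nz: "\<exists>e\<in>X. b e \<noteq> 0"
  shows "1 / (real (Suc n) * real Q ^ C) \<le> \<bar>\<Sum>e\<in>X. real_of_int (b e) * (\<Prod>\<alpha>\<in>I. h \<alpha> ^ e \<alpha>)\<bar>"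
proof -
  define b' where "b' = (\<lambda>e\<in>exponents I D. if e \<in> X then b e else 0)"
  obtain Q' where Q': "Q = Suc Q'" using Q by (cases Q) auto
  have "b' \<in> int_coeffs I D (Suc Q')"
    using b nz X unfolding int_coeffs_def b'_def Q' by (fastforce simp: abs_le_iff)
  then have "1 / (real (Suc n) * real Q ^ C) \<le> \<bar>int_poly I D b' h\<bar>"
    using lb unfolding dioph_bound_def Q' by blast
  also have "int_poly I D b' h = (\<Sum>e\<in>exponents I D. if e \<in> X then real_of_int (b e) * (\<Prod>\<alpha>\<in>I. h \<alpha> ^ e \<alpha>) else 0)"
    unfolding int_poly_def by (intro sum.cong) (auto simp: b'_def)
  also have "\<dots> = (\<Sum>e\<in>X. real_of_int (b e) * (\<Prod>\<alpha>\<in>I. h \<alpha> ^ e \<alpha>))"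
    using X finite_exponents[OF I, of D] by (simp add: sum.inter_restrict[symmetric] Int_absorb1)
  finally show ?thesis .
qed

text \<open>The exponent vector of a monomial after multiplication by the variable
  \<open>\<alpha>\<close>.\<close>

definition bump :: "('a \<Rightarrow> nat) \<Rightarrow> 'a \<Rightarrow> 'a \<Rightarrow> nat" where
  "bump e \<alpha> = e(\<alpha> := Suc (e \<alpha>))"

lemma bump_inject: "bump e \<alpha> = bump e' \<alpha> \<longleftrightarrow> e = e'"
proof
  assume eq: "bump e \<alpha> = bump e' \<alpha>"
  show "e = e'"
  proof
    fix x show "e x = e' x" using fun_cong[OF eq, of x] by (cases "x = \<alpha>") (auto simp: bump_def)
  qed
qed simp

lemma prod_bump:
  fixes h :: "'a \<Rightarrow> real"
  assumes "finite I" "\<alpha> \<in> I"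
  shows "(\<Prod>x\<in>I. h x ^ bump e \<alpha> x) = h \<alpha> * (\<Prod>x\<in>I. h x ^ e x)"
proof -
  have "(\<Prod>x\<in>I - {\<alpha>}. h x ^ bump e \<alpha> x) = (\<Prod>x\<in>I - {\<alpha>}. h x ^ e x)"
    by (intro prod.cong) (auto simp: bump_def)
  then show ?thesis using assms by (simp add: prod.remove[of I \<alpha>] bump_def)
qed

text \<open>
  The messages for receiver \<open>j\<close> are sent along monomials in the coefficients of the other
  receivers, so that a coefficient of another receiver maps these monomials to monomials of
  slightly larger degree, whichever the transmitter and the state, whereas a coefficient of
  receiver \<open>j\<close> is a new variable and keeps the transmitters apart.  Each monomial is used with
  \<open>S * m ^ card {\<alpha>. fst \<alpha> = j}\<close> different weights, which makes the number of directions the same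
  for all receivers.
\<close>

locale alignment =
  fixes M N :: nat and J :: "nat \<Rightarrow> nat" and h :: "nat \<times> nat \<times> nat \<Rightarrow> real" and m S C n0 :: nat
  assumes M: "M \<ge> 1" and m: "m \<ge> 1" and lb: "dioph_bound (coeff_index M N J) m C n0 h"
begin

abbreviation I where "I \<equiv> coeff_index M N J"

abbreviation mon where "mon e \<equiv> (\<Prod>\<alpha>\<in>I. h \<alpha> ^ e \<alpha>)"

definition dirs :: "nat \<Rightarrow> (nat \<times> nat \<times> nat \<Rightarrow> nat) set" where
  "dirs j = (\<Pi>\<^sub>E \<alpha>\<in>I. if fst \<alpha> = j then {0} else {..<m})"

definition copies :: "nat \<Rightarrow> nat" where
  "copies j = S * m ^ card {\<alpha> \<in> I. fst \<alpha> = j}"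

definition received_dirs :: "nat \<Rightarrow> nat \<Rightarrow> nat \<Rightarrow> (nat \<times> nat \<times> nat \<Rightarrow> nat) set" where
  "received_dirs j k j' = (\<lambda>(i, e). bump e (j, i, k)) ` ({..<M} \<times> dirs j')"

definition slots :: "(nat \<times> nat) set" where
  "slots = (SIGMA j:{..<N}. {..<copies j})"

text \<open>Per unit of \<open>S\<close>, a bound for the directions at one receiver, counted with
  copies: the desired messages of the \<open>M\<close> transmitters stay apart, whereas those meant
  for another receiver fill at most \<open>(m + 1) ^ card I\<close> directions, whatever
  \<open>M\<close> is.\<close>

definition num_dirs :: nat where
  "num_dirs = M * m ^ card I + (N - 1) * (m + 1) ^ card I"

lemma finI: "finite I" by (rule finite_coeff_index)

lemma finite_dirs: "finite (dirs j)"
  unfolding dirs_def by (intro finite_PiE finI) auto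

lemma finite_slots: "finite slots" by (simp add: slots_def)

lemma card_split: "card {\<alpha> \<in> I. fst \<alpha> = j} + card {\<alpha> \<in> I. fst \<alpha> \<noteq> j} = card I"
proof -
  have "card I = card ({\<alpha> \<in> I. fst \<alpha> = j} \<union> {\<alpha> \<in> I. fst \<alpha> \<noteq> j})" by (rule arg_cong[where f = card]) auto
  also have "\<dots> = card {\<alpha> \<in> I. fst \<alpha> = j} + card {\<alpha> \<in> I. fst \<alpha> \<noteq> j}"
    using finI by (intro card_Un_disjoint) auto
  finally show ?thesis by simp
qed

lemma card_restricted_exponents:
  assumes "finite A"
  shows "card (\<Pi>\<^sub>E \<alpha>\<in>I. if fst \<alpha> = j then {0} else A) = card A ^ card {\<alpha> \<in> I. fst \<alpha> \<noteq> j}"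
proof -
  have "card (\<Pi>\<^sub>E \<alpha>\<in>I. if fst \<alpha> = j then {0} else A) = (\<Prod>\<alpha>\<in>I. if fst \<alpha> \<noteq> j then card A else 1)"
    using finI by (subst card_PiE) (auto intro: prod.cong)
  also have "\<dots> = (\<Prod>\<alpha>\<in>{\<alpha> \<in> I. fst \<alpha> \<noteq> j}. card A)"
    using finI by (simp add: prod.inter_filter[symmetric])
  finally show ?thesis by simp
qed

lemma copies_card_dirs: "copies j * card (dirs j) = S * m ^ card I"
  unfolding copies_def dirs_def using card_split[of j]
  by (simp add: card_restricted_exponents power_add[symmetric])

lemma received_dirs_subset:
  assumes "j < N" "k < J j"
  shows "received_dirs j k j' \<subseteq> exponents I m"
proof -
  have "bump e (j, i, k) \<in> exponents I m" if e: "e \<in> dirs j'" and "i < M" for e i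
  proof -
    have I: "(j, i, k) \<in> I" using assms that by (auto simp: coeff_index_def)
    have le: "e \<alpha> \<le> m - 1" if "\<alpha> \<in> I" for \<alpha>
      using PiE_mem[OF e[unfolded dirs_def] that] by (auto split: if_splits)
    have "bump e (j, i, k) \<alpha> \<le> m" if "\<alpha> \<in> I" for \<alpha>
      using le[OF that] m by (auto simp: bump_def)
    moreover have "bump e (j, i, k) \<alpha> = undefined" if "\<alpha> \<notin> I" for \<alpha>
    proof -
      have "\<alpha> \<noteq> (j, i, k)" using I that by blast
      then show ?thesis using PiE_arb[OF e[unfolded dirs_def] that] by (simp add: bump_def)
    qed
    ultimately show ?thesis by (auto simp: exponents_def PiE_iff extensional_def)
  qed
  then show ?thesis by (auto simp: received_dirs_def)
qed

lemma finite_received_dirs: "finite (received_dirs j k j')"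
  using finite_dirs by (simp add: received_dirs_def)

lemma card_received_own: "copies j * card (received_dirs j k j) \<le> S * (M * m ^ card I)"
proof -
  have "card (received_dirs j k j) \<le> card ({..<M} \<times> dirs j)"
    unfolding received_dirs_def using finite_dirs by (intro card_image_le) auto
  then have "copies j * card (received_dirs j k j) \<le> copies j * (M * card (dirs j))"
    by (simp only: card_cartesian_product card_lessThan mult_le_mono2)
  also have "\<dots> = M * (copies j * card (dirs j))" by simp
  also have "\<dots> = S * (M * m ^ card I)" unfolding copies_card_dirs by simp
  finally show ?thesis .
qed

text \<open>As \<open>j \<noteq> j'\<close>, a coefficient of \<open>j\<close> raises an exponent
  below \<open>m\<close> by one and leaves the variables of \<open>j'\<close> absent. The resulting
  box of exponents depends on neither the transmitter nor the state; this is the alignment.\<close>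

lemma card_received_other:
  assumes "j < N" "k < J j" "j \<noteq> j'"
  shows "copies j' * card (received_dirs j k j') \<le> S * (m + 1) ^ card I"
proof -
  have "received_dirs j k j' \<subseteq> (\<Pi>\<^sub>E \<alpha>\<in>I. if fst \<alpha> = j' then {0} else {..m})"
  proof
    fix x assume x: "x \<in> received_dirs j k j'"
    then obtain i e where ie: "i < M" "e \<in> dirs j'" "x = bump e (j, i, k)" by (auto simp: received_dirs_def)
    have "x \<in> exponents I m" using received_dirs_subset[OF assms(1,2)] x by blast
    moreover have "x \<alpha> = 0" if "\<alpha> \<in> I" "fst \<alpha> = j'" for \<alpha>
      using PiE_mem[OF ie(2)[unfolded dirs_def] that(1)] that ie(3) assms(3) by (auto simp: bump_def)
    ultimately show "x \<in> (\<Pi>\<^sub>E \<alpha>\<in>I. if fst \<alpha> = j' then {0} else {..m})"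
      by (auto simp: exponents_def PiE_iff)
  qed
  then have "card (received_dirs j k j') \<le> (m + 1) ^ card {\<alpha> \<in> I. fst \<alpha> \<noteq> j'}"
  proof -
    have "finite (\<Pi>\<^sub>E \<alpha>\<in>I. if fst \<alpha> = j' then {0} else {..m})" by (intro finite_PiE finI) auto
    from card_mono[OF this \<open>received_dirs j k j' \<subseteq> _\<close>] show ?thesis
      using card_restricted_exponents[of "{..m}" j'] by simp
  qed
  then have "copies j' * card (received_dirs j k j') \<le> S * m ^ card {\<alpha> \<in> I. fst \<alpha> = j'} * (m + 1) ^ card {\<alpha> \<in> I. fst \<alpha> \<noteq> j'}"
    unfolding copies_def by (rule mult_left_mono) simp
  \<comment> \<open>The number of copies is enlarged as well, so that the bound is the same for
    every \<open>j'\<close>.\<close>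
  also have "\<dots> \<le> S * (m + 1) ^ card {\<alpha> \<in> I. fst \<alpha> = j'} * (m + 1) ^ card {\<alpha> \<in> I. fst \<alpha> \<noteq> j'}"
    by (intro mult_right_mono mult_left_mono power_mono) auto
  also have "\<dots> = S * (m + 1) ^ card I" using card_split[of j'] by (simp add: power_add[symmetric])
  finally show ?thesis .
qed

lemma sum_card_received_le:
  assumes "j < N" "k < J j"
  shows "(\<Sum>(j', s)\<in>slots. card (received_dirs j k j')) \<le> S * num_dirs"
proof -
  have "(\<Sum>(j', s)\<in>slots. card (received_dirs j k j')) = (\<Sum>j'<N. copies j' * card (received_dirs j k j'))"
    unfolding slots_def by (subst sum.Sigma[symmetric]) auto
  also have "\<dots> = copies j * card (received_dirs j k j) + (\<Sum>j'\<in>{..<N} - {j}. copies j' * card (received_dirs j k j'))"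
    using assms by (subst sum.remove[of _ j]) auto
  also have "\<dots> \<le> S * (M * m ^ card I) + (\<Sum>j'\<in>{..<N} - {j}. S * (m + 1) ^ card I)"
    using card_received_other[OF assms] by (intro add_mono sum_mono card_received_own) auto
  also have "\<dots> = S * num_dirs" using assms by (simp add: num_dirs_def algebra_simps)
  finally show ?thesis .
qed

section \<open>Received differences as linear forms in the weights\<close>

definition received_coeff ::
    "nat \<Rightarrow> nat \<Rightarrow> (nat \<Rightarrow> nat \<Rightarrow> nat \<Rightarrow> (nat \<times> nat \<times> nat \<Rightarrow> nat) \<Rightarrow> int) \<Rightarrow> nat \<times> nat \<Rightarrow> real" where
  "received_coeff j k \<delta> p =
     (\<Sum>i<M. \<Sum>e\<in>dirs (fst p). real_of_int (\<delta> (fst p) i (snd p) e) * (h (j, i, k) * mon e))"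

text \<open>Symbol differences of several transmitters that arrive on the same monomial merge into
  one integer.\<close>

definition aligned_coeff ::
    "nat \<Rightarrow> nat \<Rightarrow> (nat \<Rightarrow> nat \<Rightarrow> nat \<Rightarrow> (nat \<times> nat \<times> nat \<Rightarrow> nat) \<Rightarrow> int) \<Rightarrow> nat \<times> nat \<Rightarrow> (nat \<times> nat \<times> nat \<Rightarrow> nat) \<Rightarrow> int" where
  "aligned_coeff j k \<delta> p e' =
     (\<Sum>i<M. \<Sum>e\<in>{e \<in> dirs (fst p). bump e (j, i, k) = e'}. \<delta> (fst p) i (snd p) e)"

lemma received_coeff_eq:
  assumes "j < N" "k < J j"
  shows "received_coeff j k \<delta> p = (\<Sum>e'\<in>received_dirs j k (fst p). real_of_int (aligned_coeff j k \<delta> p e') * mon e')"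
proof -
  let ?X = "received_dirs j k (fst p)"
  have "(\<Sum>e\<in>dirs (fst p). real_of_int (\<delta> (fst p) i (snd p) e) * (h (j, i, k) * mon e)) =
      (\<Sum>e'\<in>?X. \<Sum>e\<in>{e \<in> dirs (fst p). bump e (j, i, k) = e'}. real_of_int (\<delta> (fst p) i (snd p) e) * mon e')"
    if i: "i < M" for i
  proof -
    have I: "(j, i, k) \<in> I" using assms i by (auto simp: coeff_index_def)
    have "(\<Sum>e\<in>dirs (fst p). real_of_int (\<delta> (fst p) i (snd p) e) * (h (j, i, k) * mon e)) =
        (\<Sum>e\<in>dirs (fst p). real_of_int (\<delta> (fst p) i (snd p) e) * mon (bump e (j, i, k)))"
      by (simp add: prod_bump[OF finI I])
    also have "\<dots> = (\<Sum>e'\<in>?X. \<Sum>e\<in>{e \<in> dirs (fst p). bump e (j, i, k) = e'}. real_of_int (\<delta> (fst p) i (snd p) e) * mon (bump e (j, i, k)))"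
      using i by (intro sum.group[symmetric] finite_dirs finite_received_dirs) (auto simp: received_dirs_def)
    also have "\<dots> = (\<Sum>e'\<in>?X. \<Sum>e\<in>{e \<in> dirs (fst p). bump e (j, i, k) = e'}. real_of_int (\<delta> (fst p) i (snd p) e) * mon e')"
      by (intro sum.cong) auto
    finally show ?thesis .
  qed
  then have "received_coeff j k \<delta> p =
      (\<Sum>i<M. \<Sum>e'\<in>?X. \<Sum>e\<in>{e \<in> dirs (fst p). bump e (j, i, k) = e'}. real_of_int (\<delta> (fst p) i (snd p) e) * mon e')"
    unfolding received_coeff_def by simp
  also have "\<dots> = (\<Sum>e'\<in>?X. \<Sum>i<M. \<Sum>e\<in>{e \<in> dirs (fst p). bump e (j, i, k) = e'}. real_of_int (\<delta> (fst p) i (snd p) e) * mon e')"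
    by (rule sum.swap)
  also have "\<dots> = (\<Sum>e'\<in>?X. real_of_int (aligned_coeff j k \<delta> p e') * mon e')"
    unfolding aligned_coeff_def by (simp add: sum_distrib_right)
  finally show ?thesis .
qed

text \<open>\<open>bump\<close> is injective, so each transmitter contributes at most one symbol to
  a given monomial; hence the factor \<open>M\<close> instead of the number of directions.\<close>

lemma aligned_coeff_le:
  assumes \<delta>: "\<And>i e. i < M \<Longrightarrow> e \<in> dirs (fst p) \<Longrightarrow> \<bar>\<delta> (fst p) i (snd p) e\<bar> \<le> int Q"
  shows "\<bar>aligned_coeff j k \<delta> p e'\<bar> \<le> int (M * Q)"
proof -
  have "\<bar>aligned_coeff j k \<delta> p e'\<bar> \<le> (\<Sum>i<M. \<bar>\<Sum>e\<in>{e \<in> dirs (fst p). bump e (j, i, k) = e'}. \<delta> (fst p) i (snd p) e\<bar>)"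
    unfolding aligned_coeff_def by (rule sum_abs)
  also have "\<dots> \<le> (\<Sum>i<M. int Q)"
  proof (rule sum_mono)
    fix i assume i: "i \<in> {..<M}"
    show "\<bar>\<Sum>e\<in>{e \<in> dirs (fst p). bump e (j, i, k) = e'}. \<delta> (fst p) i (snd p) e\<bar> \<le> int Q"
    proof (cases "\<exists>e\<in>dirs (fst p). bump e (j, i, k) = e'")
      case True
      then obtain e where e: "e \<in> dirs (fst p)" "bump e (j, i, k) = e'" by blast
      then have "{e \<in> dirs (fst p). bump e (j, i, k) = e'} = {e}" by (auto simp: bump_inject)
      then show ?thesis using \<delta>[of i e] i e by simp
    next
      case False
      then have "{e \<in> dirs (fst p). bump e (j, i, k) = e'} = {}" by blast
      then show ?thesis by (simp only:) simp
    qed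
  qed
  finally show ?thesis by simp
qed

text \<open>Directions for \<open>j\<close> do not contain the coefficients of \<open>j\<close>.
  After reception the variable \<open>(j, i, k)\<close> has exponent 1 and reveals the transmitter
  \<open>i\<close>, so nothing is merged.\<close>

lemma aligned_coeff_own:
  assumes i: "i < M" and k: "k < J j" and j: "j < N" and e: "e \<in> dirs j"
  shows "aligned_coeff j k \<delta> (j, s) (bump e (j, i, k)) = \<delta> j i s e"
proof -
  have own: "e'' (j, i', k) = 0" if "e'' \<in> dirs j" "i' < M" for e'' i'
  proof -
    have "(j, i', k) \<in> I" using k j that by (auto simp: coeff_index_def)
    from PiE_mem[OF that(1)[unfolded dirs_def] this] show ?thesis by simp
  qed
  have "(\<Sum>e'\<in>{e' \<in> dirs j. bump e' (j, i', k) = bump e (j, i, k)}. \<delta> j i' s e') = (if i' = i then \<delta> j i s e else 0)"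
    if "i' < M" for i'
  proof (cases "i' = i")
    case True
    have "{e' \<in> dirs j. bump e' (j, i, k) = bump e (j, i, k)} = {e}" using e by (auto simp: bump_inject)
    then show ?thesis using True by simp
  next
    case False
    have "bump e' (j, i', k) \<noteq> bump e (j, i, k)" if e': "e' \<in> dirs j" for e'
    proof
      assume "bump e' (j, i', k) = bump e (j, i, k)"
      from fun_cong[OF this, of "(j, i, k)"] show False
        using False own[OF e' i] own[OF e i] by (simp add: bump_def)
    qed
    then have "{e' \<in> dirs j. bump e' (j, i', k) = bump e (j, i, k)} = {}" by blast
    then show ?thesis using False by (simp only:) simp
  qed
  then show ?thesis using i by (simp add: aligned_coeff_def)
qed

lemma received_coeff_own_nonzero:
  assumes j: "j < N" "k < J j" and i: "i < M" and e: "e \<in> dirs j" and nz: "\<delta> j i s e \<noteq> 0" and Q: "Q \<ge> 1"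
    and \<delta>: "\<And>i e. i < M \<Longrightarrow> e \<in> dirs j \<Longrightarrow> \<bar>\<delta> j i s e\<bar> \<le> int Q"
  shows "received_coeff j k \<delta> (j, s) \<noteq> 0"
proof -
  let ?X = "received_dirs j k j"
  have "bump e (j, i, k) \<in> ?X" using i e by (auto simp: received_dirs_def)
  then have ex: "\<exists>e'\<in>?X. aligned_coeff j k \<delta> (j, s) e' \<noteq> 0"
    using aligned_coeff_own[OF i j(2,1) e] nz by metis
  have "1 / (real (Suc n0) * real (M * Q) ^ C) \<le> \<bar>\<Sum>e'\<in>?X. real_of_int (aligned_coeff j k \<delta> (j, s) e') * mon e'\<bar>"
    by (rule dioph_bound_subset[OF lb finI received_dirs_subset[OF j] _ aligned_coeff_le ex])
      (use M Q \<delta> in auto)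
  moreover have "0 < 1 / (real (Suc n0) * real (M * Q) ^ C)" using M Q by simp
  ultimately show ?thesis unfolding received_coeff_eq[OF j] by auto
qed

text \<open>The possible coefficients of one weight. Their number is governed by the received
  directions after alignment, not by the number of symbols sent; the union bound for the weights
  rests on this.\<close>

definition received_values :: "nat \<Rightarrow> nat \<Rightarrow> nat \<Rightarrow> nat \<Rightarrow> real set" where
  "received_values Q j k j' = (\<lambda>b. \<Sum>e\<in>received_dirs j k j'. real_of_int (b e) * mon e) `
     (received_dirs j k j' \<rightarrow>\<^sub>E {- int (M * Q)..int (M * Q)})"

lemma finite_received_values: "finite (received_values Q j k j')"
  unfolding received_values_def using finite_received_dirs by (intro finite_imageI finite_PiE) auto

lemma card_received_values: "card (received_values Q j k j') \<le> (2 * (M * Q) + 1) ^ card (received_dirs j k j')"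
proof -
  have "card (received_values Q j k j') \<le> card (received_dirs j k j' \<rightarrow>\<^sub>E {- int (M * Q)..int (M * Q)})"
    unfolding received_values_def using finite_received_dirs by (intro card_image_le finite_PiE) auto
  also have "\<dots> = (2 * (M * Q) + 1) ^ card (received_dirs j k j')"
  proof -
    have "nat (int (M * Q) - - int (M * Q) + 1) = 2 * (M * Q) + 1" by linarith
    then show ?thesis using finite_received_dirs by (simp add: card_PiE del: of_nat_mult)
  qed
  finally show ?thesis .
qed

lemma received_values_lower:
  assumes j: "j < N" "k < J j" and Q: "Q \<ge> 1" and x: "x \<in> received_values Q j k j'" "x \<noteq> 0"
  shows "1 / (real (Suc n0) * real (M * Q) ^ C) \<le> \<bar>x\<bar>"
proof -
  let ?X = "received_dirs j k j'"
  obtain b where b: "b \<in> ?X \<rightarrow>\<^sub>E {- int (M * Q)..int (M * Q)}" "x = (\<Sum>e\<in>?X. real_of_int (b e) * mon e)"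
    using x by (auto simp: received_values_def)
  have ex: "\<exists>e\<in>?X. b e \<noteq> 0"
  proof (rule ccontr)
    assume "\<not> ?thesis"
    then have "x = 0" unfolding b(2) by (intro sum.neutral) auto
    then show False using x(2) by simp
  qed
  show ?thesis unfolding b(2)
  proof (rule dioph_bound_subset[OF lb finI received_dirs_subset[OF j] _ _ ex])
    show "\<bar>b e\<bar> \<le> int (M * Q)" if "e \<in> ?X" for e using PiE_mem[OF b(1) that] by (auto simp: abs_le_iff)
    show "M * Q \<ge> 1" using mult_le_mono[OF M Q] by simp
  qed
qed

lemma received_coeff_in_values:
  assumes j: "j < N" "k < J j"
    and \<delta>: "\<And>i e. i < M \<Longrightarrow> e \<in> dirs (fst p) \<Longrightarrow> \<bar>\<delta> (fst p) i (snd p) e\<bar> \<le> int Q"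
  shows "received_coeff j k \<delta> p \<in> received_values Q j k (fst p)"
  unfolding received_values_def
proof (rule image_eqI)
  let ?X = "received_dirs j k (fst p)"
  show "received_coeff j k \<delta> p = (\<Sum>e\<in>?X. real_of_int (restrict (aligned_coeff j k \<delta> p) ?X e) * mon e)"
    unfolding received_coeff_eq[OF j] by simp
  have "\<bar>aligned_coeff j k \<delta> p e\<bar> \<le> int (M * Q)" for e
    by (rule aligned_coeff_le) (rule \<delta>)
  then have "aligned_coeff j k \<delta> p e \<in> {- int (M * Q)..int (M * Q)}" for e
    unfolding atLeastAtMost_iff abs_le_iff by (simp only: minus_le_iff)
  then show "restrict (aligned_coeff j k \<delta> p) ?X \<in> ?X \<rightarrow>\<^sub>E {- int (M * Q)..int (M * Q)}" by simp
qed

definition num_states :: nat where "num_states = (\<Sum>j<N. J j)"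

text \<open>Collects the factors of the union bound that do not involve \<open>Q\<close>, such that
  the excluded intervals have total length below one half; \<open>Suc num_states\<close> keeps it
  positive.\<close>

definition sep_const :: real where
  "sep_const = 4 * real (Suc num_states) * (3 * real M) ^ (S * num_dirs) * real (Suc n0) * real M ^ C"

text \<open>The coefficient vectors of all receivers and states form one finite set
  \<open>F\<close>, so the same weights serve every realization at the price of the factor
  \<open>num_states\<close>. A nonzero entry is at least a constant over \<open>Q ^ C\<close>; so
  \<open>C\<close> is added once to the exponent \<open>S * num_dirs\<close> and does not multiply
  it.\<close>

lemma separating_weights_exist:
  assumes Q: "Q \<ge> 1"
  obtains \<theta> where "\<And>p. p \<in> slots \<Longrightarrow> \<bar>\<theta> p\<bar> \<le> 1"
    and "\<And>j k \<delta>. j < N \<Longrightarrow> k < J j \<Longrightarrow>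
      (\<And>j' i s e. (j', s) \<in> slots \<Longrightarrow> i < M \<Longrightarrow> e \<in> dirs j' \<Longrightarrow> \<bar>\<delta> j' i s e\<bar> \<le> int Q) \<Longrightarrow>
      (\<exists>p\<in>slots. received_coeff j k \<delta> p \<noteq> 0) \<Longrightarrow>
      1 / (sep_const * real Q ^ (C + S * num_dirs)) \<le> \<bar>\<Sum>p\<in>slots. \<theta> p * received_coeff j k \<delta> p\<bar>"
proof -
  define R where "R j k = (\<Pi>\<^sub>E p\<in>slots. received_values Q j k (fst p))" for j k
  define F where "F = (\<Union>x\<in>(SIGMA j:{..<N}. {..<J j}). R (fst x) (snd x))"
  define \<rho> where "\<rho> = 1 / (real (Suc n0) * real (M * Q) ^ C)"
  define \<eta> where "\<eta> = 1 / (sep_const * real Q ^ (C + S * num_dirs))"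
  have \<rho>: "\<rho> > 0" using M Q by (simp add: \<rho>_def)
  have \<eta>: "\<eta> > 0" using M Q by (simp add: \<eta>_def sep_const_def)
  have finR: "finite (R j k)" for j k
    unfolding R_def using finite_slots finite_received_values by (intro finite_PiE)
  have finF: "finite F" unfolding F_def using finR by auto
  have cardR: "card (R j k) \<le> (3 * (M * Q)) ^ (S * num_dirs)" if j: "j < N" "k < J j" for j k
  proof -
    have "card (R j k) = (\<Prod>p\<in>slots. card (received_values Q j k (fst p)))"
      unfolding R_def using finite_slots by (rule card_PiE)
    also have "\<dots> \<le> (\<Prod>p\<in>slots. (2 * (M * Q) + 1) ^ card (received_dirs j k (fst p)))"
      by (intro prod_mono conjI card_received_values) auto
    also have "\<dots> = (2 * (M * Q) + 1) ^ (\<Sum>p\<in>slots. card (received_dirs j k (fst p)))"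
      by (rule power_sum[symmetric])
    also have "\<dots> \<le> (2 * (M * Q) + 1) ^ (S * num_dirs)"
      using sum_card_received_le[OF j] by (intro power_increasing) (auto simp: case_prod_beta)
    also have "\<dots> \<le> (3 * (M * Q)) ^ (S * num_dirs)"
      using M Q by (intro power_mono) (auto simp: Suc_le_eq)
    finally show ?thesis .
  qed
  have cardF: "real (card F) \<le> real num_states * real (3 * (M * Q)) ^ (S * num_dirs)"
  proof -
    have "card F \<le> (\<Sum>x\<in>(SIGMA j:{..<N}. {..<J j}). card (R (fst x) (snd x)))"
      unfolding F_def by (intro card_UN_le) auto
    also have "\<dots> \<le> (\<Sum>x\<in>(SIGMA j:{..<N}. {..<J j}). (3 * (M * Q)) ^ (S * num_dirs))"
      using cardR by (intro sum_mono) auto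
    also have "\<dots> = num_states * (3 * (M * Q)) ^ (S * num_dirs)" by (simp add: num_states_def)
    finally show ?thesis by (metis of_nat_le_iff of_nat_mult of_nat_power)
  qed
  have ratio: "2 * \<eta> / \<rho> = 1 / (2 * real (Suc num_states) * real (3 * (M * Q)) ^ (S * num_dirs))"
    using M Q unfolding \<eta>_def \<rho>_def sep_const_def
    by (simp add: power_mult_distrib power_add divide_simps del: of_nat_Suc)
  have "real (card F) * (2 * \<eta> / \<rho>) \<le>
      real num_states * real (3 * (M * Q)) ^ (S * num_dirs) * (2 * \<eta> / \<rho>)"
    using cardF \<rho> \<eta> by (intro mult_right_mono) auto
  also have "\<dots> = real num_states / (2 * real (Suc num_states))"
    unfolding ratio using M Q by simp
  also have "\<dots> < 1" by (simp add: divide_simps)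
  finally have small: "real (card F) * (2 * \<eta> / \<rho>) < 1" .
  have big: "\<rho> \<le> \<bar>c p\<bar>" if c: "c \<in> F" and p: "p \<in> slots" and nz: "c p \<noteq> 0" for c p
  proof -
    obtain j k where j: "j < N" "k < J j" and cR: "c \<in> R j k" using c by (auto simp: F_def)
    have "c p \<in> received_values Q j k (fst p)" using PiE_mem[OF cR[unfolded R_def] p] .
    then show ?thesis unfolding \<rho>_def by (rule received_values_lower[OF j Q _ nz])
  qed
  have "\<exists>\<theta>. (\<forall>p\<in>slots. 0 \<le> \<theta> p \<and> \<theta> p \<le> 1) \<and>
      (\<forall>c\<in>F. (\<exists>p\<in>slots. c p \<noteq> 0) \<longrightarrow> \<eta> \<le> \<bar>\<Sum>p\<in>slots. \<theta> p * c p\<bar>)"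
    by (rule separating_weights[OF finite_slots finF \<rho> less_imp_le[OF \<eta>] _ small]) (rule big)
  then obtain \<theta> where \<theta>: "\<forall>p\<in>slots. 0 \<le> \<theta> p \<and> \<theta> p \<le> 1"
    "\<forall>c\<in>F. (\<exists>p\<in>slots. c p \<noteq> 0) \<longrightarrow> \<eta> \<le> \<bar>\<Sum>p\<in>slots. \<theta> p * c p\<bar>"
    by blast
  show thesis
  proof (rule that)
    show "\<bar>\<theta> p\<bar> \<le> 1" if "p \<in> slots" for p using \<theta>(1) that by auto
    fix j k \<delta>
    assume j: "j < N" "k < J j"
      and \<delta>: "\<And>j' i s e. (j', s) \<in> slots \<Longrightarrow> i < M \<Longrightarrow> e \<in> dirs j' \<Longrightarrow> \<bar>\<delta> j' i s e\<bar> \<le> int Q"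
      and nz: "\<exists>p\<in>slots. received_coeff j k \<delta> p \<noteq> 0"
    let ?c = "restrict (received_coeff j k \<delta>) slots"
    have "received_coeff j k \<delta> p \<in> received_values Q j k (fst p)" if "p \<in> slots" for p
      using \<delta> that by (intro received_coeff_in_values j) auto
    then have "?c \<in> R j k" by (simp add: R_def)
    then have "?c \<in> F" using j unfolding F_def by (intro UN_I[of "(j, k)"]) auto
    moreover have "\<exists>p\<in>slots. ?c p \<noteq> 0" using nz by auto
    ultimately have "\<eta> \<le> \<bar>\<Sum>p\<in>slots. \<theta> p * ?c p\<bar>" using \<theta>(2) by blast
    then show "1 / (sep_const * real Q ^ (C + S * num_dirs)) \<le> \<bar>\<Sum>p\<in>slots. \<theta> p * received_coeff j k \<delta> p\<bar>"
      by (simp add: \<eta>_def)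
  qed
qed

definition peak_const :: real where
  "peak_const = 1 + (\<Sum>p\<in>slots. \<Sum>e\<in>dirs (fst p). \<bar>mon e\<bar>)"

lemma constellation:
  assumes Q: "Q \<ge> 1"
  obtains amp :: "nat \<Rightarrow> nat \<Rightarrow> real"
  where "\<And>\<sigma>. (\<And>j. j < N \<Longrightarrow> \<sigma> j < Q ^ (S * m ^ card I)) \<Longrightarrow>
      \<bar>\<Sum>j<N. amp j (\<sigma> j)\<bar> \<le> sep_const * peak_const * real Q ^ (C + S * num_dirs + 1)"
    and "\<And>j k \<sigma> \<sigma>' i. j < N \<Longrightarrow> k < J j \<Longrightarrow> i < M \<Longrightarrow>
        (\<And>j' i'. j' < N \<Longrightarrow> i' < M \<Longrightarrow> \<sigma> j' i' < Q ^ (S * m ^ card I)) \<Longrightarrow>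
        (\<And>j' i'. j' < N \<Longrightarrow> i' < M \<Longrightarrow> \<sigma>' j' i' < Q ^ (S * m ^ card I)) \<Longrightarrow>
        \<sigma> j i \<noteq> \<sigma>' j i \<Longrightarrow> 1 \<le> \<bar>noiseless M N h amp j k \<sigma> - noiseless M N h amp j k \<sigma>'\<bar>"
proof -
  let ?q = "Q ^ (S * m ^ card I)"
  obtain \<theta> where \<theta>1: "\<And>p. p \<in> slots \<Longrightarrow> \<bar>\<theta> p\<bar> \<le> 1"
    and \<theta>2: "\<And>j k \<delta>. j < N \<Longrightarrow> k < J j \<Longrightarrow>
      (\<And>j' i s e. (j', s) \<in> slots \<Longrightarrow> i < M \<Longrightarrow> e \<in> dirs j' \<Longrightarrow> \<bar>\<delta> j' i s e\<bar> \<le> int Q) \<Longrightarrow>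
      (\<exists>p\<in>slots. received_coeff j k \<delta> p \<noteq> 0) \<Longrightarrow>
      1 / (sep_const * real Q ^ (C + S * num_dirs)) \<le> \<bar>\<Sum>p\<in>slots. \<theta> p * received_coeff j k \<delta> p\<bar>"
    using separating_weights_exist[OF Q] by blast
  \<comment> \<open>Scaling by the inverse of the separation makes the minimum distance 1; the whole
    cost appears as peak amplitude.\<close>
  define \<Lambda> where "\<Lambda> = sep_const * real Q ^ (C + S * num_dirs)"
  have \<Lambda>: "\<Lambda> > 0" using M Q by (simp add: \<Lambda>_def sep_const_def)
  \<comment> \<open>A symbol is a table of integers below \<open>Q\<close>, one for each copy of
    each direction. By \<open>copies_card_dirs\<close> the number of tables is the same for every
    \<open>j\<close>, which allows a common rate for all messages.\<close>
  define Sy where "Sy j = ({..<copies j} \<times> dirs j \<rightarrow>\<^sub>E {..<Q})" for j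
  have finSy: "finite (Sy j)" and cardSy: "card (Sy j) = ?q" for j
    using finite_dirs[of j] copies_card_dirs[of j]
    by (auto simp: Sy_def card_PiE card_cartesian_product intro!: finite_PiE)
  have "\<exists>f. bij_betw f {..<?q} (Sy j)" for j
    using ex_bij_betw_nat_finite[OF finSy[of j]] cardSy[of j] by (simp add: lessThan_atLeast0)
  then obtain sym where sym: "\<And>j. bij_betw (sym j) {..<?q} (Sy j)" by metis
  have sym_lt: "sym j a (s, e) < Q" if "a < ?q" "s < copies j" "e \<in> dirs j" for j a s e
  proof -
    have "sym j a \<in> Sy j" using bij_betwE[OF sym] that by blast
    from PiE_mem[OF this[unfolded Sy_def], of "(s, e)"] show ?thesis using that by simp
  qed
  define amp where "amp j a = \<Lambda> * (\<Sum>s<copies j. \<theta> (j, s) * (\<Sum>e\<in>dirs j. real (sym j a (s, e)) * mon e))" for j a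
  show thesis
  proof (rule that[of amp])
    fix \<sigma> assume \<sigma>: "\<And>j. j < N \<Longrightarrow> \<sigma> j < ?q"
    have "\<bar>\<Sum>j<N. amp j (\<sigma> j)\<bar> = \<Lambda> * \<bar>\<Sum>p\<in>slots. \<theta> p * (\<Sum>e\<in>dirs (fst p). real (sym (fst p) (\<sigma> (fst p)) (snd p, e)) * mon e)\<bar>"
    proof -
      have "(\<Sum>j<N. amp j (\<sigma> j)) = \<Lambda> * (\<Sum>j<N. \<Sum>s<copies j. \<theta> (j, s) * (\<Sum>e\<in>dirs j. real (sym j (\<sigma> j) (s, e)) * mon e))"
        by (simp add: amp_def sum_distrib_left)
      also have "(\<Sum>j<N. \<Sum>s<copies j. \<theta> (j, s) * (\<Sum>e\<in>dirs j. real (sym j (\<sigma> j) (s, e)) * mon e)) =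
          (\<Sum>p\<in>slots. \<theta> p * (\<Sum>e\<in>dirs (fst p). real (sym (fst p) (\<sigma> (fst p)) (snd p, e)) * mon e))"
        unfolding slots_def by (subst sum.Sigma) (auto simp: case_prod_beta)
      finally show ?thesis using \<Lambda> by (simp add: abs_mult)
    qed
    also have "\<dots> \<le> \<Lambda> * (\<Sum>p\<in>slots. \<Sum>e\<in>dirs (fst p). real Q * \<bar>mon e\<bar>)"
    proof (rule mult_left_mono)
      have "\<bar>\<Sum>p\<in>slots. \<theta> p * (\<Sum>e\<in>dirs (fst p). real (sym (fst p) (\<sigma> (fst p)) (snd p, e)) * mon e)\<bar>
          \<le> (\<Sum>p\<in>slots. \<bar>\<theta> p * (\<Sum>e\<in>dirs (fst p). real (sym (fst p) (\<sigma> (fst p)) (snd p, e)) * mon e)\<bar>)"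
        by (rule sum_abs)
      also have "\<dots> \<le> (\<Sum>p\<in>slots. \<Sum>e\<in>dirs (fst p). real Q * \<bar>mon e\<bar>)"
      proof (rule sum_mono)
        fix p assume p: "p \<in> slots"
        have "\<bar>\<theta> p * (\<Sum>e\<in>dirs (fst p). real (sym (fst p) (\<sigma> (fst p)) (snd p, e)) * mon e)\<bar>
            = \<bar>\<theta> p\<bar> * \<bar>\<Sum>e\<in>dirs (fst p). real (sym (fst p) (\<sigma> (fst p)) (snd p, e)) * mon e\<bar>"
          by (rule abs_mult)
        also have "\<dots> \<le> 1 * (\<Sum>e\<in>dirs (fst p). \<bar>real (sym (fst p) (\<sigma> (fst p)) (snd p, e)) * mon e\<bar>)"
          using \<theta>1[OF p] by (intro mult_mono sum_abs) auto
        also have "\<dots> \<le> (\<Sum>e\<in>dirs (fst p). real Q * \<bar>mon e\<bar>)"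
        proof -
          have "real (sym (fst p) (\<sigma> (fst p)) (snd p, e)) * \<bar>mon e\<bar> \<le> real Q * \<bar>mon e\<bar>" if "e \<in> dirs (fst p)" for e
            using sym_lt[of "\<sigma> (fst p)" "snd p" "fst p" e] \<sigma>[of "fst p"] p that
            by (intro mult_right_mono) (auto simp: slots_def)
          then show ?thesis by (simp add: abs_mult sum_mono)
        qed
        finally show "\<bar>\<theta> p * (\<Sum>e\<in>dirs (fst p). real (sym (fst p) (\<sigma> (fst p)) (snd p, e)) * mon e)\<bar>
            \<le> (\<Sum>e\<in>dirs (fst p). real Q * \<bar>mon e\<bar>)" .
      qed
      finally show "\<bar>\<Sum>p\<in>slots. \<theta> p * (\<Sum>e\<in>dirs (fst p). real (sym (fst p) (\<sigma> (fst p)) (snd p, e)) * mon e)\<bar>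
          \<le> (\<Sum>p\<in>slots. \<Sum>e\<in>dirs (fst p). real Q * \<bar>mon e\<bar>)" .
    qed (use \<Lambda> in simp)
    also have "\<dots> \<le> \<Lambda> * (real Q * peak_const)"
      using \<Lambda> by (intro mult_left_mono) (auto simp: peak_const_def sum_distrib_left[symmetric] algebra_simps)
    also have "\<dots> = sep_const * peak_const * real Q ^ (C + S * num_dirs + 1)"
      by (simp add: \<Lambda>_def power_add)
    finally show "\<bar>\<Sum>j<N. amp j (\<sigma> j)\<bar> \<le> sep_const * peak_const * real Q ^ (C + S * num_dirs + 1)" .
  next
    fix j k \<sigma> \<sigma>' i
    assume j: "j < N" "k < J j" and i: "i < M"
      and \<sigma>: "\<And>j' i'. j' < N \<Longrightarrow> i' < M \<Longrightarrow> \<sigma> j' i' < ?q" "\<And>j' i'. j' < N \<Longrightarrow> i' < M \<Longrightarrow> \<sigma>' j' i' < ?q"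
      and ne: "\<sigma> j i \<noteq> \<sigma>' j i"
    define \<delta> where "\<delta> j' i s e = int (sym j' (\<sigma> j' i) (s, e)) - int (sym j' (\<sigma>' j' i) (s, e))" for j' i s e
    have \<delta>_le: "\<bar>\<delta> j' i s e\<bar> \<le> int Q" if "(j', s) \<in> slots" "i < M" "e \<in> dirs j'" for j' i s e
      using sym_lt[of "\<sigma> j' i" s j' e] sym_lt[of "\<sigma>' j' i" s j' e] \<sigma>[of j' i] that
      by (auto simp: \<delta>_def slots_def)
    have sym_ne: "sym j (\<sigma> j i) \<noteq> sym j (\<sigma>' j i)"
      using sym[of j] ne \<sigma>(1)[OF j(1) i] \<sigma>(2)[OF j(1) i] by (auto simp: bij_betw_def inj_on_def)
    have sym_in: "sym j (\<sigma> j i) \<in> Sy j" "sym j (\<sigma>' j i) \<in> Sy j"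
      using bij_betwE[OF sym] \<sigma>(1)[OF j(1) i] \<sigma>(2)[OF j(1) i] by auto
    have "\<exists>x\<in>{..<copies j} \<times> dirs j. sym j (\<sigma> j i) x \<noteq> sym j (\<sigma>' j i) x"
    proof (rule ccontr)
      assume "\<not> ?thesis"
      then have "sym j (\<sigma> j i) = sym j (\<sigma>' j i)"
        by (intro PiE_ext[OF sym_in[unfolded Sy_def]]) blast
      then show False using sym_ne by simp
    qed
    then obtain s e where se: "s < copies j" "e \<in> dirs j" "sym j (\<sigma> j i) (s, e) \<noteq> sym j (\<sigma>' j i) (s, e)"
      by auto
    have slot: "(j, s) \<in> slots" using j se by (simp add: slots_def)
    \<comment> \<open>One nonzero coefficient suffices: the weights then bound the entire form from
      below, whatever the interference contributes.\<close>
    have "received_coeff j k \<delta> (j, s) \<noteq> 0"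
    proof (rule received_coeff_own_nonzero[OF j i se(2) _ Q])
      show "\<delta> j i s e \<noteq> 0" using se(3) by (simp add: \<delta>_def)
      show "\<bar>\<delta> j i' s e'\<bar> \<le> int Q" if "i' < M" "e' \<in> dirs j" for i' e'
        by (rule \<delta>_le[OF slot that])
    qed
    then have "1 / \<Lambda> \<le> \<bar>\<Sum>p\<in>slots. \<theta> p * received_coeff j k \<delta> p\<bar>"
      unfolding \<Lambda>_def using slot by (intro \<theta>2[OF j] \<delta>_le) blast+
    then have "1 \<le> \<Lambda> * \<bar>\<Sum>p\<in>slots. \<theta> p * received_coeff j k \<delta> p\<bar>"
      using \<Lambda> by (simp add: divide_le_eq mult.commute)
    also have "\<dots> = \<bar>\<Lambda> * (\<Sum>p\<in>slots. \<theta> p * received_coeff j k \<delta> p)\<bar>" using \<Lambda> by (simp add: abs_mult)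
    also have "\<Lambda> * (\<Sum>p\<in>slots. \<theta> p * received_coeff j k \<delta> p) = noiseless M N h amp j k \<sigma> - noiseless M N h amp j k \<sigma>'"
    proof -
      have "noiseless M N h amp j k \<sigma> - noiseless M N h amp j k \<sigma>' =
          (\<Sum>i<M. \<Sum>j'<N. h (j, i, k) * (amp j' (\<sigma> j' i) - amp j' (\<sigma>' j' i)))"
        unfolding noiseless_def by (simp add: sum_distrib_left sum_subtractf right_diff_distrib)
      also have "\<dots> = (\<Sum>i<M. \<Sum>j'<N. \<Sum>s<copies j'. \<Lambda> * \<theta> (j', s) * (\<Sum>e\<in>dirs j'. real_of_int (\<delta> j' i s e) * (h (j, i, k) * mon e)))"
      proof (intro sum.cong refl)
        fix i j'
        have "amp j' (\<sigma> j' i) - amp j' (\<sigma>' j' i) =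
            (\<Sum>s<copies j'. \<Lambda> * \<theta> (j', s) * (\<Sum>e\<in>dirs j'. real_of_int (\<delta> j' i s e) * mon e))"
          unfolding amp_def \<delta>_def
          by (simp add: sum_distrib_left left_diff_distrib right_diff_distrib sum_subtractf mult.assoc)
        then show "h (j, i, k) * (amp j' (\<sigma> j' i) - amp j' (\<sigma>' j' i)) =
            (\<Sum>s<copies j'. \<Lambda> * \<theta> (j', s) * (\<Sum>e\<in>dirs j'. real_of_int (\<delta> j' i s e) * (h (j, i, k) * mon e)))"
          by (simp add: sum_distrib_left mult_ac)
      qed
      also have "\<dots> = (\<Sum>i<M. \<Sum>p\<in>slots. \<Lambda> * \<theta> p * (\<Sum>e\<in>dirs (fst p). real_of_int (\<delta> (fst p) i (snd p) e) * (h (j, i, k) * mon e)))"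
        unfolding slots_def by (intro sum.cong refl, subst sum.Sigma) (auto simp: case_prod_beta)
      also have "\<dots> = (\<Sum>p\<in>slots. \<Sum>i<M. \<Lambda> * \<theta> p * (\<Sum>e\<in>dirs (fst p). real_of_int (\<delta> (fst p) i (snd p) e) * (h (j, i, k) * mon e)))"
        by (rule sum.swap)
      also have "\<dots> = \<Lambda> * (\<Sum>p\<in>slots. \<theta> p * received_coeff j k \<delta> p)"
        unfolding received_coeff_def by (simp add: sum_distrib_left mult.assoc)
      finally show ?thesis by simp
    qed
    finally show "1 \<le> \<bar>noiseless M N h amp j k \<sigma> - noiseless M N h amp j k \<sigma>'\<bar>" .
  qed
qed

end

subsection \<open>Degrees of freedom\<close>

text \<open>\<open>Q\<close> is taken as large as the power allows, so \<open>log 2 Q\<close> is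
  about \<open>1 / 2 * log 2 P\<close> divided by the exponent \<open>E\<close> of the peak
  amplitude. Each of the \<open>M * N\<close> messages carries about \<open>u * log 2 Q\<close>
  bits, whence the slope \<open>\<rho> = M * N * u / E\<close>; rounding and constants go into
  \<open>c\<close>.\<close>

lemma sum_capacity_ge:
  assumes M: "M \<ge> 1" and m: "m \<ge> 1" and S: "S \<ge> 1" and b: "b \<ge> 3"
    and lb: "dioph_bound (coeff_index M N J) m C n0 h"
  defines "p \<equiv> m ^ card (coeff_index M N J)" and "p' \<equiv> (m + 1) ^ card (coeff_index M N J)"
  defines "\<rho> \<equiv> real M * real N * (1 - 2 / real b) * (real S * real p) / (real C + real S * (real M * real p + real (N - 1) * real p') + 1)"
  shows "\<exists>c. \<forall>\<^sub>F P in at_top. ereal (\<rho> * (1 / 2 * log 2 P) - c) \<le> sum_capacity M N J h P"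
proof -
  interpret alignment M N J h m S C n0 by unfold_locales (use M m lb in auto)
  define L where "L = S * m ^ card I"
  define E where "E = C + S * num_dirs + 1"
  have L: "L \<ge> 1" using S m by (simp add: L_def Suc_le_eq)
  have E: "E \<ge> 1" by (simp add: E_def)
  obtain T where T: "T > 0" "measure std_gaussian {x. T \<le> \<bar>x\<bar>} \<le> (1 / 4) ^ b"
    using gaussian_tail_small[of "(1 / 4) ^ b"] by auto
  define B where "B = sep_const * peak_const"
  have "sep_const > 0" using M by (simp add: sep_const_def)
  moreover have "peak_const > 0"
    unfolding peak_const_def by (intro add_pos_nonneg sum_nonneg) auto
  ultimately have B: "B > 0" by (simp add: B_def)
  define A where "A = 2 * T * B"
  have A: "A > 0" using T B by (simp add: A_def)
  define u where "u = (1 - 2 / real b) * real L"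
  have u: "u > 0" using b L by (simp add: u_def)
  \<comment> \<open>Threshold for \<open>1 / 2 * log 2 P\<close> from which on \<open>Q\<close> is
    at least 1 and the rate \<open>r\<close> is nonnegative.\<close>
  define Z where "Z = \<bar>log 2 A\<bar> + real E * (1 + 1 / u)"
  define c where "c = real M * real N * (u * (log 2 A / real E + 1) + 1)"
  have "ereal (\<rho> * (1 / 2 * log 2 P) - c) \<le> sum_capacity M N J h P" if P: "P \<ge> 2 powr (2 * Z)" for P
  proof -
    have P0: "P > 0" using P powr_gt_zero[of 2 "2 * Z"] by linarith
    define l where "l = 1 / 2 * log 2 P"
    have "2 * Z \<le> log 2 P" using P P0 by (subst le_log_iff) auto
    then have l: "l \<ge> Z" by (simp add: l_def)
    define x where "x = sqrt P / A"
    have x0: "x > 0" using P0 A by (simp add: x_def)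
    have logx: "log 2 x = l - log 2 A"
      using P0 A by (simp add: x_def l_def log_divide powr_half_sqrt[symmetric] log_powr)
    define y where "y = x powr (1 / real E)"
    have y0: "y > 0" using x0 by (simp add: y_def)
    have logy: "log 2 y = (l - log 2 A) / real E"
      using x0 by (simp add: y_def log_powr logx)
    have "real E * (1 + 1 / u) \<le> l - log 2 A" using l by (simp add: Z_def)
    then have logy_ge: "1 + 1 / u \<le> log 2 y" unfolding logy using E by (simp add: field_simps)
    then have "0 \<le> log 2 y" using u by (simp add: add_nonneg_nonneg order_trans[of 0 "1 + 1 / u"])
    then have y1: "y \<ge> 1" using y0 by (simp add: zero_le_log_cancel_iff)
    define Q where "Q = nat \<lfloor>y\<rfloor>"
    have Q_le: "real Q \<le> y" using y0 by (simp add: Q_def)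
    have Q1: "Q \<ge> 1" using y1 by (simp add: Q_def le_nat_iff le_floor_iff)
    have "y < real Q + 1" using y0 by (simp add: Q_def)
    \<comment> \<open>Rounding down loses at most a factor 2, hence one bit of
      \<open>log 2 y\<close>.\<close>
    then have "y / 2 \<le> real Q" using Q1 by linarith
    then have "log 2 (y / 2) \<le> log 2 (real Q)" using y0 Q1 by (subst log_le_cancel_iff) auto
    then have logQ: "log 2 y - 1 \<le> log 2 (real Q)" using y0 by (simp add: log_divide)
    have QE: "real Q ^ E \<le> x"
    proof -
      have "real Q ^ E \<le> y ^ E" using Q_le by (intro power_mono) auto
      also have "\<dots> = x" using x0 E by (simp add: y_def powr_realpow[symmetric] powr_powr)
      finally show ?thesis .
    qed
    define r where "r = (1 - 2 / real b) * log 2 (real (Q ^ L)) - 1"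
    have r_eq: "r = u * log 2 (real Q) - 1" using Q1 by (simp add: r_def u_def log_nat_power)
    have r_ge: "u * (log 2 y - 1) - 1 \<le> r" unfolding r_eq using logQ u by simp
    have "1 / u \<le> log 2 y - 1" using logy_ge by simp
    then have "u * (1 / u) \<le> u * (log 2 y - 1)" using u by (intro mult_left_mono) auto
    then have r0: "r \<ge> 0" using r_ge u by simp
    obtain amp where peak: "\<And>\<sigma>. (\<And>j. j < N \<Longrightarrow> \<sigma> j < Q ^ (S * m ^ card I)) \<Longrightarrow>
        \<bar>\<Sum>j<N. amp j (\<sigma> j)\<bar> \<le> sep_const * peak_const * real Q ^ (C + S * num_dirs + 1)"
      and sep: "\<And>j k \<sigma> \<sigma>' i. j < N \<Longrightarrow> k < J j \<Longrightarrow> i < M \<Longrightarrow>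
        (\<And>j' i'. j' < N \<Longrightarrow> i' < M \<Longrightarrow> \<sigma> j' i' < Q ^ (S * m ^ card I)) \<Longrightarrow>
        (\<And>j' i'. j' < N \<Longrightarrow> i' < M \<Longrightarrow> \<sigma>' j' i' < Q ^ (S * m ^ card I)) \<Longrightarrow>
        \<sigma> j i \<noteq> \<sigma>' j i \<Longrightarrow> 1 \<le> \<bar>noiseless M N h amp j k \<sigma> - noiseless M N h amp j k \<sigma>'\<bar>"
      by (rule constellation[OF Q1]) blast
    \<comment> \<open>The minimum distance 1 is stretched to \<open>2 * T\<close>, twice the noise
      threshold.\<close>
    define amp' where "amp' j a = 2 * T * amp j a" for j a
    have scale: "noiseless M N h amp' j k \<sigma> = 2 * T * noiseless M N h amp j k \<sigma>" for j k \<sigma>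
      unfolding noiseless_def amp'_def by (simp add: sum_distrib_left mult_ac)
    have "achievable M N J h P (\<lambda>j i. r)"
    proof (rule coded_achievable[where q = "Q ^ L" and b = b and T = T and amp = amp'])
      show "Q ^ L \<ge> 1" using Q1 by simp
      show "b \<ge> 1" using b by simp
      show "(\<Sum>j<N. amp' j (\<sigma> j))\<^sup>2 \<le> P" if "\<And>j. j < N \<Longrightarrow> \<sigma> j < Q ^ L" for \<sigma>
      proof -
        have "\<bar>\<Sum>j<N. amp' j (\<sigma> j)\<bar> = 2 * T * \<bar>\<Sum>j<N. amp j (\<sigma> j)\<bar>"
          using T by (simp add: amp'_def sum_distrib_left[symmetric] abs_mult)
        also have "\<dots> \<le> 2 * T * (B * real Q ^ E)"
          using peak[of \<sigma>] that T unfolding B_def E_def L_def by (intro mult_left_mono) auto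
        also have "\<dots> = A * real Q ^ E" by (simp add: A_def)
        also have "\<dots> \<le> A * x" using QE A by (intro mult_left_mono) auto
        also have "\<dots> = sqrt P" using A by (simp add: x_def)
        finally have "(\<Sum>j<N. amp' j (\<sigma> j))\<^sup>2 \<le> (sqrt P)\<^sup>2"
          by (metis abs_ge_zero power2_abs power_mono)
        then show ?thesis using P0 by simp
      qed
      show "2 * T \<le> \<bar>noiseless M N h amp' j k \<sigma> - noiseless M N h amp' j k \<sigma>'\<bar>"
        if "j < N" "k < J j" "i < M" "\<And>j' i'. j' < N \<Longrightarrow> i' < M \<Longrightarrow> \<sigma> j' i' < Q ^ L"
          "\<And>j' i'. j' < N \<Longrightarrow> i' < M \<Longrightarrow> \<sigma>' j' i' < Q ^ L" "\<sigma> j i \<noteq> \<sigma>' j i" for j k \<sigma> \<sigma>' i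
      proof -
        have "2 * T * 1 \<le> 2 * T * \<bar>noiseless M N h amp j k \<sigma> - noiseless M N h amp j k \<sigma>'\<bar>"
          using T that unfolding L_def by (intro mult_left_mono sep[of j k i]) auto
        also have "\<dots> = \<bar>2 * T * (noiseless M N h amp j k \<sigma> - noiseless M N h amp j k \<sigma>')\<bar>"
          using T by (simp add: abs_mult)
        finally show ?thesis by (simp add: scale right_diff_distrib)
      qed
      show "measure std_gaussian {x. T \<le> \<bar>x\<bar>} \<le> (1 / 4) ^ b" by (rule T)
      show "0 \<le> r" by (rule r0)
      show "r \<le> (1 - 2 / real b) * log 2 (real (Q ^ L)) - 1" by (simp add: r_def)
    qed
    then have cap: "ereal (real M * real N * r) \<le> sum_capacity M N J h P"
      unfolding sum_capacity_def by (intro SUP_upper2[of "\<lambda>j i. r"]) (auto simp: mult_ac)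
    have "\<rho> = real M * real N * u / real E"
    proof -
      have "real E = real C + real S * (real M * real p + real (N - 1) * real p') + 1"
        by (simp only: E_def num_dirs_def p_def p'_def of_nat_add of_nat_mult of_nat_1)
      moreover have "real L = real S * real p" by (simp only: L_def p_def of_nat_mult)
      ultimately show ?thesis by (simp add: \<rho>_def u_def mult.assoc)
    qed
    then have "\<rho> * l - c = real M * real N * (u * (l / real E)) - real M * real N * (u * (log 2 A / real E + 1) + 1)"
      by (simp add: c_def)
    also have "\<dots> = real M * real N * (u * (log 2 y - 1) - 1)"
      unfolding logy diff_divide_distrib by (simp add: algebra_simps)
    also have "\<dots> \<le> real M * real N * r" using r_ge by (intro mult_left_mono) auto
    finally have "ereal (\<rho> * l - c) \<le> ereal (real M * real N * r)" by simp
    also note cap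
    finally show ?thesis by (simp add: l_def)
  qed
  then show ?thesis using eventually_ge_at_top[of "2 powr (2 * Z)"] by (blast intro: eventually_mono)
qed

text \<open>The order of the limits matters: \<open>m\<close> comes first, since \<open>C m\<close>
  depends on it; a large \<open>S\<close> then makes \<open>C m\<close> negligible, and a large
  \<open>b\<close> makes the outer code cheap. The quotient \<open>(m + 1) / m\<close> to the fixed
  power \<open>G\<close> tends to 1, which leaves \<open>M + N - 1\<close> in the
  denominator.\<close>

lemma scheme_parameters_exist:
  fixes M N G :: nat and C :: "nat \<Rightarrow> nat"
  assumes M: "M \<ge> 1" and N: "N \<ge> 1" and x: "x < real M * real N / (real M + real N - 1)"
  shows "\<exists>m\<ge>1. \<exists>S\<ge>1. \<exists>b\<ge>3. x < real M * real N * (1 - 2 / real b) * (real S * real (m ^ G)) /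
      (real (C m) + real S * (real M * real (m ^ G) + real (N - 1) * real ((m + 1) ^ G)) + 1)"
proof -
  have "(\<lambda>m. real M * real N / (real M + real (N - 1) * (real (Suc m) / real m) ^ G))
      \<longlonglongrightarrow> real M * real N / (real M + real (N - 1) * 1 ^ G)"
    using M by (intro tendsto_intros LIMSEQ_Suc_n_over_n) (simp add: add_pos_nonneg[THEN less_imp_neq, symmetric])
  then have "\<forall>\<^sub>F m in sequentially. x < real M * real N / (real M + real (N - 1) * (real (Suc m) / real m) ^ G)"
    by (rule order_tendstoD) (use x N in \<open>simp add: of_nat_diff add_diff_eq\<close>)
  then have "\<forall>\<^sub>F m in sequentially. x < real M * real N / (real M + real (N - 1) * (real (Suc m) / real m) ^ G) \<and> m \<ge> 1"
    using eventually_ge_at_top[of 1] by eventually_elim auto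
  then obtain m where m: "m \<ge> 1" "x < real M * real N / (real M + real (N - 1) * (real (Suc m) / real m) ^ G)"
    using eventually_happens[of _ sequentially] by auto
  define p where "p = real (m ^ G)"
  define v where "v = real M * real (m ^ G) + real (N - 1) * real ((m + 1) ^ G)"
  have p: "p > 0" using m by (simp add: p_def)
  have v: "v > 0" using m M by (simp add: v_def add_pos_nonneg)
  have "real M + real (N - 1) * (real (Suc m) / real m) ^ G = v / p"
  proof -
    have "(real (Suc m) / real m) ^ G = real ((m + 1) ^ G) / p"
      by (simp only: p_def power_divide of_nat_power Suc_eq_plus1)
    moreover have "v = real M * p + real (N - 1) * real ((m + 1) ^ G)" by (simp only: v_def p_def)
    ultimately show ?thesis using p by (simp only: add_divide_distrib) simp
  qed
  then have x1: "x < real M * real N * p / v" using m(2) p v by simp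
  have "(\<lambda>S. real M * real N * p / (v + (real (C m) + 1) / real S)) \<longlonglongrightarrow> real M * real N * p / (v + 0)"
    using v by (intro tendsto_intros lim_const_over_n) auto
  then have "\<forall>\<^sub>F S in sequentially. x < real M * real N * p / (v + (real (C m) + 1) / real S)"
    by (rule order_tendstoD) (use x1 in simp)
  then have "\<forall>\<^sub>F S in sequentially. x < real M * real N * p / (v + (real (C m) + 1) / real S) \<and> S \<ge> 1"
    using eventually_ge_at_top[of 1] by eventually_elim auto
  then obtain S where S: "S \<ge> 1" "x < real M * real N * p / (v + (real (C m) + 1) / real S)"
    using eventually_happens[of _ sequentially] by auto
  define w where "w = real (C m) + real S * v + 1"
  have "v + (real (C m) + 1) / real S = w / real S" using S by (simp add: w_def field_simps)
  then have x2: "x < real M * real N * (real S * p) / w" using S by (simp add: mult_ac)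
  have "(\<lambda>b. real M * real N * (1 - 2 / real b) * (real S * p) / w) \<longlonglongrightarrow> real M * real N * (1 - 0) * (real S * p) / w"
    using v by (intro tendsto_intros lim_const_over_n) (simp add: w_def add_nonneg_pos[THEN less_imp_neq, symmetric])
  then have "\<forall>\<^sub>F b in sequentially. x < real M * real N * (1 - 2 / real b) * (real S * p) / w"
    by (rule order_tendstoD) (use x2 in simp)
  then have "\<forall>\<^sub>F b in sequentially. x < real M * real N * (1 - 2 / real b) * (real S * p) / w \<and> b \<ge> 3"
    using eventually_ge_at_top[of 3] by eventually_elim auto
  then obtain b where b: "b \<ge> 3" "x < real M * real N * (1 - 2 / real b) * (real S * p) / w"
    using eventually_happens[of _ sequentially] by auto
  show ?thesis using m(1) S(1) b unfolding w_def v_def p_def by blast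
qed

text \<open>A single coefficient is itself an integer polynomial of degree 1. The converse needs
  this because it divides by the gains.\<close>

lemma dioph_bound_coeff_nonzero:
  assumes lb: "dioph_bound I 1 C n h" and I: "finite I" "\<alpha> \<in> I"
  shows "h \<alpha> \<noteq> 0"
proof
  assume zero: "h \<alpha> = 0"
  define e where "e = (\<lambda>\<beta>\<in>I. if \<beta> = \<alpha> then 1 else 0 :: nat)"
  have "{e} \<subseteq> exponents I 1" by (auto simp: e_def exponents_def)
  then have "1 / (real (Suc n) * real 1 ^ C) \<le> \<bar>\<Sum>e\<in>{e}. real_of_int 1 * (\<Prod>\<beta>\<in>I. h \<beta> ^ e \<beta>)\<bar>"
    by (rule dioph_bound_subset[OF lb I(1)]) auto
  moreover have "(\<Prod>\<beta>\<in>I. h \<beta> ^ e \<beta>) = 0"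
    using I zero by (intro prod_zero) (auto simp: e_def intro!: bexI[of _ \<alpha>])
  ultimately show False by simp
qed

text \<open>Each choice of parameters of the scheme loses something, so achievability enters through
  slopes \<open>\<rho>\<close> above any \<open>x < d\<close>. Additive constants vanish after
  division by \<open>log 2 P\<close>.\<close>

lemma has_dofI:
  assumes upper: "\<And>P R. P \<ge> 1 \<Longrightarrow> achievable M N J h P R \<Longrightarrow>
      (\<Sum>j<N. \<Sum>i<M. R j i) \<le> d * (1 / 2 * log 2 P + c)"
    and lower: "\<And>x. x < d \<Longrightarrow> \<exists>\<rho>>x. \<exists>c. \<forall>\<^sub>F P in at_top. ereal (\<rho> * (1 / 2 * log 2 P) - c) \<le> sum_capacity M N J h P"
  shows "has_dof M N J h d"
proof -
  define l where "l P = 1 / 2 * log 2 P" for P :: real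
  have l_top: "filterlim l at_top at_top"
  proof -
    have "filterlim (\<lambda>P. 1 / (2 * ln 2) * ln P) at_top (at_top :: real filter)"
      by (rule filterlim_tendsto_pos_mult_at_top[OF tendsto_const _ ln_at_top]) simp
    moreover have "(\<lambda>P. 1 / (2 * ln 2) * ln P) = l" by (simp add: l_def log_def fun_eq_iff)
    ultimately show ?thesis by simp
  qed
  have l_pos: "\<forall>\<^sub>F P in at_top. 0 < l P"
    using l_top by (simp add: filterlim_at_top_dense)
  have lim: "((\<lambda>P. a + k / l P) \<longlongrightarrow> a) at_top" for a k :: real
  proof -
    have "((\<lambda>P. a + k / l P) \<longlongrightarrow> a + 0) at_top"
      by (intro tendsto_intros tendsto_divide_0[OF tendsto_const] filterlim_at_top_imp_at_infinity l_top)
    then show ?thesis by simp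
  qed
  have "((\<lambda>P. sum_capacity M N J h P / ereal (l P)) \<longlongrightarrow> ereal d) at_top"
  proof (rule order_tendstoI)
    fix a assume "ereal d < a"
    moreover have "((\<lambda>P. ereal (d + d * c / l P)) \<longlongrightarrow> ereal d) at_top"
      using lim[of d "d * c"] by (simp only: lim_ereal)
    ultimately have "\<forall>\<^sub>F P in at_top. ereal (d + d * c / l P) < a" by (rule order_tendstoD(2)[rotated])
    then show "\<forall>\<^sub>F P in at_top. sum_capacity M N J h P / ereal (l P) < a"
      using l_pos eventually_ge_at_top[of 1]
    proof eventually_elim
      case (elim P)
      have "sum_capacity M N J h P \<le> ereal (d * (l P + c))"
        unfolding sum_capacity_def using upper[OF elim(3)] by (intro SUP_least) (auto simp: l_def)
      also have "\<dots> = ereal (l P) * ereal (d + d * c / l P)"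
        using elim(2) by (simp add: field_simps)
      finally have "sum_capacity M N J h P / ereal (l P) \<le> ereal (d + d * c / l P)"
        using elim(2) by (subst ereal_divide_le_pos) auto
      then show ?case using elim(1) by (rule le_less_trans)
    qed
  next
    fix a assume "a < ereal d"
    then obtain x where x: "a < ereal x" "x < d" using ereal_dense2 by (metis ereal_less(2) less_ereal.simps(1))
    obtain \<rho> c' where \<rho>: "\<rho> > x"
      and low: "\<forall>\<^sub>F P in at_top. ereal (\<rho> * (1 / 2 * log 2 P) - c') \<le> sum_capacity M N J h P"
      using lower[OF x(2)] by blast
    have "\<forall>\<^sub>F P in at_top. x < \<rho> + - c' / l P"
      using lim[of \<rho> "- c'"] \<rho> by (rule order_tendstoD)
    then show "\<forall>\<^sub>F P in at_top. a < sum_capacity M N J h P / ereal (l P)"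
      using low l_pos
    proof eventually_elim
      case (elim P)
      have "ereal (l P) * ereal (\<rho> + - c' / l P) = ereal (\<rho> * (1 / 2 * log 2 P) - c')"
        unfolding l_def[symmetric] using elim(3) by (simp add: field_simps)
      then have "ereal (\<rho> + - c' / l P) \<le> sum_capacity M N J h P / ereal (l P)"
        using elim(2,3) by (subst ereal_le_divide_pos) auto
      moreover have "a < ereal (\<rho> + - c' / l P)" using x(1) elim(1) by (meson ereal_less_le less_ereal.simps(1) less_trans)
      ultimately show ?case by (rule less_le_trans[rotated])
    qed
  qed
  then show ?thesis unfolding has_dof_def l_def .
qed

theorem theorem5:
  fixes M N :: nat and J :: "nat \<Rightarrow> nat"
    and D :: "(nat \<times> nat \<times> nat \<Rightarrow> real) measure"
  assumes "M \<ge> 1" and "N \<ge> 1" and "\<And>j. j < N \<Longrightarrow> J j \<ge> 1"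
    and "prob_space D"
    and "sets D = sets (coeff_lebesgue M N J)"
    and "absolutely_continuous (coeff_lebesgue M N J) D"
  shows "AE h in D. has_dof M N J h (real M * real N / (real M + real N - 1))"
proof (rule absolutely_continuous_AE[OF assms(5,6)])
  let ?I = "coeff_index M N J"
  let ?d = "real M * real N / (real M + real N - 1)"
  \<comment> \<open>The exponents for all degrees are fixed before \<open>h\<close> is drawn.
    Countably many degrees give a single exceptional null set, so \<open>m\<close> can still be
    chosen afterwards.\<close>
  obtain C where C: "\<And>m. AE h in coeff_lebesgue M N J. \<exists>n. dioph_bound ?I m (C m) n h"
    using AE_dioph_bound[OF finite_coeff_index] unfolding coeff_lebesgue_def by metis
  then have "AE h in coeff_lebesgue M N J. \<forall>m. \<exists>n. dioph_bound ?I m (C m) n h"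
    by (simp add: AE_all_countable)
  then show "AE h in coeff_lebesgue M N J. has_dof M N J h ?d"
  proof eventually_elim
    case (elim h)
    have "h (j, i, 0) \<noteq> 0" if "j < N" "i < M" for j i
    proof -
      obtain n where "dioph_bound ?I 1 (C 1) n h" using elim by blast
      then show ?thesis using assms(3)[of j] that
        by (intro dioph_bound_coeff_nonzero[OF _ finite_coeff_index]) (auto simp: coeff_index_def)
    qed
    then obtain c where c: "\<And>P R. P \<ge> 1 \<Longrightarrow> achievable M N J h P R \<Longrightarrow>
        (\<Sum>j<N. \<Sum>i<M. R j i) \<le> ?d * (1 / 2 * log 2 P + c)"
      using sum_rate_le[of M N J h] assms(1-3) by blast
    show ?case
    proof (rule has_dofI[OF c])
      fix x assume "x < ?d"
      then obtain m S b where par: "m \<ge> 1" "S \<ge> 1" "b \<ge> 3"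
        "x < real M * real N * (1 - 2 / real b) * (real S * real (m ^ card ?I)) /
          (real (C m) + real S * (real M * real (m ^ card ?I) + real (N - 1) * real ((m + 1) ^ card ?I)) + 1)"
        using scheme_parameters_exist[OF assms(1,2), of x "card ?I" C] by blast
      obtain n where "dioph_bound ?I m (C m) n h" using elim by blast
      from sum_capacity_ge[OF assms(1) par(1-3) this] par(4)
      show "\<exists>\<rho>>x. \<exists>c. \<forall>\<^sub>F P in at_top. ereal (\<rho> * (1 / 2 * log 2 P) - c) \<le> sum_capacity M N J h P"
        by blast
    qed
  qed
qed

end
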